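(* Let $W$ be an irreducible CFC-finite Coxeter group. Suppose that $w\in\mathrm{CFC}(W)$, and that some generator $s\in S$ appears in $w$ (i.e. in a reduced expression for $w$) more than once. Then there exists a unique generator $t\in S$ with $m(s,t)\geq 5$. Furthermore, the generators $s$ and $t$ occur $j$ times each in $w$, in alternating order (but not necessarily consecutively), where $2j<m(s,t)$.
   Context: $(W,S)$ is a Coxeter system of finite rank: $W=\langle S\mid (st)^{m(s,t)}=1\rangle$, where $m(s,t)=m(t,s)\in\{1,2,\dots,\infty\}$, $m(s,t)=1$ iff $s=t$, and $m(s,t)=\infty$ means no relation. The Coxeter graph has vertex set $S$ and an edge $\{s,t\}$ labeled $m(s,t)$ whenever $m(s,t)\ge 3$; $W$ is irreducible if this graph is connected. An expression for $w$ is a word in $S$ representing $w$; it is reduced if it has minimal length. Two words are commutation equivalent if they differ by a sequence of moves $st\leftrightarrow ts$ with $m(s,t)=2$. An element is fully commutative (FC) if all its reduced expressions are commutation equivalent. A cyclic shift of a word is any word obtained by repeatedly moving the first letter to the end. $w$ is cyclically fully commutative, $w\in\mathrm{CFC}(W)$, if every cyclic shift of every reduced expression for $w$ is a reduced expression for an FC element. $W$ is CFC-finite if $\mathrm{CFC}(W)$ is finite. (For FC elements the number of occurrences of each generator, and the relative order of occurrences of two noncommuting generators, is the same in all reduced expressions.) *)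

theory Defs
  imports "HOL-Algebra.Generated_Groups" "HOL-Library.Extended_Nat"
begin

text \<open>
  A letter is a pair of a generator and a sign: \<open>(x, True)\<close> stands for \<open>x\<close> and
  \<open>(x, False)\<close> for the inverse of \<open>x\<close>.  The relation \<open>pres_eq X R\<close> is the congruence on words in
  these letters generated by free cancellation and by \<open>r = 1\<close> for \<open>r \<in> R\<close>; its quotient is the
  free group on \<open>X\<close> modulo the normal closure of \<open>R\<close>.
\<close>

inductive pres_eq :: "'a set \<Rightarrow> ('a \<times> bool) list set \<Rightarrow> ('a \<times> bool) list \<Rightarrow> ('a \<times> bool) list \<Rightarrow> bool"
  for X R where
  cancel: "\<lbrakk>x \<in> X; u \<in> lists (X \<times> UNIV); v \<in> lists (X \<times> UNIV)\<rbrakk>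
    \<Longrightarrow> pres_eq X R (u @ [(x, b), (x, \<not> b)] @ v) (u @ v)"
| relator: "\<lbrakk>r \<in> R; u \<in> lists (X \<times> UNIV); v \<in> lists (X \<times> UNIV)\<rbrakk>
    \<Longrightarrow> pres_eq X R (u @ r @ v) (u @ v)"
| refl: "u \<in> lists (X \<times> UNIV) \<Longrightarrow> pres_eq X R u u"
| sym: "pres_eq X R u v \<Longrightarrow> pres_eq X R v u"
| trans: "pres_eq X R u v \<Longrightarrow> pres_eq X R v w \<Longrightarrow> pres_eq X R u w"

definition letter_val :: "('a, 'b) monoid_scheme \<Rightarrow> 'a \<times> bool \<Rightarrow> 'a" where
  "letter_val W l = (if snd l then fst l else inv\<^bsub>W\<^esub> (fst l))"

definition word_prod :: "('a, 'b) monoid_scheme \<Rightarrow> 'a list \<Rightarrow> 'a" where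
  "word_prod W u = foldr (\<otimes>\<^bsub>W\<^esub>) u \<one>\<^bsub>W\<^esub>"

definition has_presentation :: "('a, 'b) monoid_scheme \<Rightarrow> 'a set \<Rightarrow> ('a \<times> bool) list set \<Rightarrow> bool" where
  "has_presentation W X R \<longleftrightarrow>
     group W \<and> X \<subseteq> carrier W \<and> R \<subseteq> lists (X \<times> UNIV) \<and> generate W X = carrier W \<and>
     (\<forall>u \<in> lists (X \<times> UNIV). word_prod W (map (letter_val W) u) = \<one>\<^bsub>W\<^esub> \<longleftrightarrow> pres_eq X R u [])"

definition coxeter_relators :: "'a set \<Rightarrow> ('a \<Rightarrow> 'a \<Rightarrow> enat) \<Rightarrow> ('a \<times> bool) list set" where
  "coxeter_relators S m =
     {concat (replicate k [(s, True), (t, True)]) | s t k. s \<in> S \<and> t \<in> S \<and> m s t = enat k}"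

definition coxeter_system :: "('a, 'b) monoid_scheme \<Rightarrow> 'a set \<Rightarrow> ('a \<Rightarrow> 'a \<Rightarrow> enat) \<Rightarrow> bool" where
  "coxeter_system W S m \<longleftrightarrow>
     finite S \<and>
     (\<forall>s \<in> S. \<forall>t \<in> S. m s t = m t s \<and> 1 \<le> m s t \<and> (m s t = 1 \<longleftrightarrow> s = t)) \<and>
     has_presentation W S (coxeter_relators S m)"

definition coxeter_edges :: "'a set \<Rightarrow> ('a \<Rightarrow> 'a \<Rightarrow> enat) \<Rightarrow> ('a \<times> 'a) set" where
  "coxeter_edges S m = {(s, t). s \<in> S \<and> t \<in> S \<and> 3 \<le> m s t}"

definition coxeter_irreducible :: "'a set \<Rightarrow> ('a \<Rightarrow> 'a \<Rightarrow> enat) \<Rightarrow> bool" where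
  "coxeter_irreducible S m \<longleftrightarrow> (\<forall>s \<in> S. \<forall>t \<in> S. (s, t) \<in> (coxeter_edges S m)\<^sup>*)"

definition expression :: "('a, 'b) monoid_scheme \<Rightarrow> 'a set \<Rightarrow> 'a list \<Rightarrow> 'a \<Rightarrow> bool" where
  "expression W S u w \<longleftrightarrow> u \<in> lists S \<and> word_prod W u = w"

definition reduced_expression :: "('a, 'b) monoid_scheme \<Rightarrow> 'a set \<Rightarrow> 'a list \<Rightarrow> 'a \<Rightarrow> bool" where
  "reduced_expression W S u w \<longleftrightarrow>
     expression W S u w \<and> (\<forall>v. expression W S v w \<longrightarrow> length u \<le> length v)"

inductive comm_step :: "('a \<Rightarrow> 'a \<Rightarrow> enat) \<Rightarrow> 'a list \<Rightarrow> 'a list \<Rightarrow> bool" for m where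
  "m s t = 2 \<Longrightarrow> comm_step m (u @ [s, t] @ v) (u @ [t, s] @ v)"

text \<open>On words in \<open>S\<close> this is an equivalence relation, because \<open>m\<close> is symmetric on \<open>S\<close>.\<close>

definition comm_equiv :: "('a \<Rightarrow> 'a \<Rightarrow> enat) \<Rightarrow> 'a list \<Rightarrow> 'a list \<Rightarrow> bool" where
  "comm_equiv m = (comm_step m)\<^sup>*\<^sup>*"

definition FC :: "('a, 'b) monoid_scheme \<Rightarrow> 'a set \<Rightarrow> ('a \<Rightarrow> 'a \<Rightarrow> enat) \<Rightarrow> 'a set" where
  "FC W S m = {w \<in> carrier W. \<forall>u v. reduced_expression W S u w \<longrightarrow> reduced_expression W S v w
     \<longrightarrow> comm_equiv m u v}"

definition CFC :: "('a, 'b) monoid_scheme \<Rightarrow> 'a set \<Rightarrow> ('a \<Rightarrow> 'a \<Rightarrow> enat) \<Rightarrow> 'a set" where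
  "CFC W S m = {w \<in> carrier W. \<forall>u. reduced_expression W S u w \<longrightarrow>
     (\<forall>n. \<exists>x \<in> FC W S m. reduced_expression W S (rotate n u) x)}"

definition CFC_finite :: "('a, 'b) monoid_scheme \<Rightarrow> 'a set \<Rightarrow> ('a \<Rightarrow> 'a \<Rightarrow> enat) \<Rightarrow> bool" where
  "CFC_finite W S m \<longleftrightarrow> finite (CFC W S m)"

definition alternate_in :: "'a \<Rightarrow> 'a \<Rightarrow> 'a list \<Rightarrow> bool" where
  "alternate_in s t u \<longleftrightarrow> distinct_adj (filter (\<lambda>x. x = s \<or> x = t) u)"

end

theory Submission
  imports Defs Complex_Main "HOL-Library.Multiset"
begin

text \<open>
  By the exchange condition, a word whose commutation class contains no square and no long braid is
  reduced, and its class consists of all reduced expressions of a fully commutative element.  So if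
  all powers of a word are of this kind, then they represent infinitely many CFC elements.  Suitable
  words show that the Coxeter graph of an irreducible CFC-finite group is a tree with finite labels
  and at most one feature: a vertex of degree \<open>3\<close> or an edge with label at least \<open>4\<close>, whose position
  and label are restricted further.

  Now read a reduced expression of \<open>w\<close> cyclically.  Two consecutive occurrences of \<open>t\<close> enclose two
  letters adjacent to \<open>t\<close>, unless the only one belongs to an edge with label at least \<open>4\<close>.  Hence along
  a branch without features occurrences of its first vertex \<open>t\<close> are separated by occurrences of the
  vertex \<open>s\<close> it is attached to, and \<open>s\<close> occurs more often than \<open>t\<close>.  Following all branches inwards, a
  repeated generator forces a repeated generator at the feature.  There, a vertex of degree \<open>3\<close> and
  an edge with label \<open>4\<close> lead to a contradiction, and the two ends of an edge with label at least \<open>5\<close>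
  alternate and occur less than half the label many times.
\<close>

text \<open>The group is given only through the congruence \<open>pres_eq\<close>, so anything that
  distinguishes elements must come from a function on words that respects squares and relators. Two
  are used: parities of reflections yield the exchange condition, and a linear action built from
  cosines shows that the product of \<open>s\<close> and \<open>t\<close> really has order
  \<open>m s t\<close>. The second matters because with a smaller order a word without long braids
  need not be reduced. Induction on the length of words then takes the place of Matsumoto's theorem,
  and what follows concerns only words up to commutation.

  The graphs that survive the exclusions are those of types A, B, D, E, F, H and I_2(m), where E, F
  and H may have any rank. Since such groups can be infinite, finiteness of the group cannot be
  exploited; the argument compares instead which neighbours lie in the gaps between equal letters.
  The bound 2j < m has two origins. In rank two the word is itself alternating and must not contain
  the braid; in higher rank the label is 5 and one of the two generators cannot occur three
  times.\<close>

primrec alt :: "nat \<Rightarrow> 'a \<Rightarrow> 'a \<Rightarrow> 'a list" where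
  "alt 0 s t = []"
| "alt (Suc n) s t = s # alt n t s"

lemma length_alt [simp]: "length (alt n s t) = n"
  by (induction n arbitrary: s t) auto

lemma set_alt: "set (alt n s t) \<subseteq> {s, t}"
  by (induction n arbitrary: s t) auto

lemma alt_lists: "s \<in> S \<Longrightarrow> t \<in> S \<Longrightarrow> alt n s t \<in> lists S"
  using set_alt[of n s t] by (auto simp: in_lists_conv_set)

lemma alt_double: "alt (2 * k) s t = concat (replicate k [s, t])"
  by (induction k) auto

section \<open>Words in the generators and invariants of the presentation\<close>

locale coxeter_matrix =
  fixes S :: "'a set" and m :: "'a \<Rightarrow> 'a \<Rightarrow> enat"
  assumes finite_S: "finite S"
    and m_sym: "\<And>s t. s \<in> S \<Longrightarrow> t \<in> S \<Longrightarrow> m s t = m t s"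
    and m_ge_1: "\<And>s t. s \<in> S \<Longrightarrow> t \<in> S \<Longrightarrow> 1 \<le> m s t"
    and m_eq_1: "\<And>s t. s \<in> S \<Longrightarrow> t \<in> S \<Longrightarrow> m s t = 1 \<longleftrightarrow> s = t"

locale coxeter_group = coxeter_matrix S m + group W
  for W :: "('a, 'b) monoid_scheme" (structure) and S m +
  assumes pres: "has_presentation W S (coxeter_relators S m)"
begin

abbreviation wp :: "'a list \<Rightarrow> 'a" where "wp \<equiv> word_prod W"

lemma S_carrier: "s \<in> S \<Longrightarrow> s \<in> carrier W"
  using pres by (auto simp: has_presentation_def)

lemma wp_Nil [simp]: "wp [] = \<one>" by (simp add: word_prod_def)

lemma wp_Cons [simp]: "wp (x # u) = x \<otimes> wp u" by (simp add: word_prod_def)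

lemma wp_closed [simp]: "u \<in> lists S \<Longrightarrow> wp u \<in> carrier W"
  by (induction u) (auto simp: S_carrier)

lemma wp_append: "u \<in> lists S \<Longrightarrow> v \<in> lists S \<Longrightarrow> wp (u @ v) = wp u \<otimes> wp v"
  by (induction u) (auto simp: S_carrier m_assoc)

lemma pres_eq_iff:
  "U \<in> lists (S \<times> UNIV) \<Longrightarrow> wp (map (letter_val W) U) = \<one> \<longleftrightarrow> pres_eq S (coxeter_relators S m) U []"
  using pres by (auto simp: has_presentation_def)

lemma wp_relator:
  assumes "s \<in> S" "t \<in> S" "m s t = enat k"
  shows "wp (alt (2 * k) s t) = \<one>"
proof -
  let ?r = "concat (replicate k [(s, True), (t, True)])"
  have "?r \<in> coxeter_relators S m" using assms by (auto simp: coxeter_relators_def)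
  from pres_eq.relator[OF this, of "[]" S "[]"]
  have "pres_eq S (coxeter_relators S m) ?r []" by simp
  moreover have "?r \<in> lists (S \<times> UNIV)" using assms by (auto simp: in_lists_conv_set)
  ultimately have "wp (map (letter_val W) ?r) = \<one>" by (simp add: pres_eq_iff)
  moreover have "map (letter_val W) ?r = alt (2 * k) s t"
    unfolding alt_double by (simp add: map_concat letter_val_def)
  ultimately show ?thesis by simp
qed

lemma gen_sq: "s \<in> S \<Longrightarrow> s \<otimes> s = \<one>"
  using wp_relator[of s s 1] m_eq_1[of s s] by (simp add: numeral_2_eq_2 one_enat_def S_carrier)

lemma gen_inv: "s \<in> S \<Longrightarrow> inv s = s"
  using gen_sq S_carrier inv_equality by blast

lemma gen_cancel: "s \<in> S \<Longrightarrow> x \<in> carrier W \<Longrightarrow> s \<otimes> (s \<otimes> x) = x"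
  using gen_sq[of s] S_carrier[of s] by (metis l_one m_assoc)

lemma wp_rev: "u \<in> lists S \<Longrightarrow> wp (rev u) = inv (wp u)"
proof (induction u)
  case (Cons a u)
  then have "rev u \<in> lists S" by (auto simp: in_lists_conv_set)
  with Cons show ?case by (simp add: wp_append inv_mult_group S_carrier gen_inv)
qed simp

lemma wp_letters:
  "U \<in> lists (S \<times> UNIV) \<Longrightarrow> wp (map (letter_val W) U) = wp (map fst U)"
proof (induction U)
  case (Cons a U)
  then have "letter_val W a = fst a" using gen_inv by (auto simp: letter_val_def)
  with Cons show ?case by simp
qed simp

text \<open>Signs can be forgotten because \<open>E\<close> ignores squares: free cancellation
  becomes the deletion of a square. The suffix \<open>z\<close> prepares for relations of the form u
  = v, which the presentation states only as a word equal to 1.\<close>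

lemma presentation_invariant_aux:
  fixes E :: "'a list \<Rightarrow> 'c"
  assumes sq: "\<And>x u v. x \<in> S \<Longrightarrow> u \<in> lists S \<Longrightarrow> v \<in> lists S \<Longrightarrow> E (u @ [x, x] @ v) = E (u @ v)"
    and rel: "\<And>s t k u v. s \<in> S \<Longrightarrow> t \<in> S \<Longrightarrow> m s t = enat k \<Longrightarrow> u \<in> lists S \<Longrightarrow> v \<in> lists S
      \<Longrightarrow> E (u @ alt (2 * k) s t @ v) = E (u @ v)"
    and "pres_eq S (coxeter_relators S m) U V"
  shows "z \<in> lists S \<Longrightarrow> E (map fst U @ z) = E (map fst V @ z)"
  using assms(3)
proof (induction rule: pres_eq.induct)
  case (cancel x u v b)
  then have "map fst u \<in> lists S" "map fst v @ z \<in> lists S" by (auto simp: in_lists_conv_set)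
  from sq[OF cancel(1) this] show ?case by simp
next
  case (relator r u v)
  then obtain s t k where r: "r = concat (replicate k [(s, True), (t, True)])" "s \<in> S" "t \<in> S"
    "m s t = enat k" by (auto simp: coxeter_relators_def)
  have "map fst r = alt (2 * k) s t" unfolding r alt_double by (simp add: map_concat)
  moreover have "map fst u \<in> lists S" "map fst v @ z \<in> lists S"
    using relator by (auto simp: in_lists_conv_set)
  ultimately show ?case using rel[OF r(2-4), of "map fst u" "map fst v @ z"] by simp
qed auto

text \<open>The presentation only decides which words are trivial. So \<open>u @ rev v\<close> is
  reduced to the empty word with \<open>v\<close> as suffix, and in \<open>u @ rev v @ v\<close> the
  last two factors cancel square by square.\<close>

lemma presentation_invariant:
  fixes E :: "'a list \<Rightarrow> 'c"
  assumes sq: "\<And>x u v. x \<in> S \<Longrightarrow> u \<in> lists S \<Longrightarrow> v \<in> lists S \<Longrightarrow> E (u @ [x, x] @ v) = E (u @ v)"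
    and rel: "\<And>s t k u v. s \<in> S \<Longrightarrow> t \<in> S \<Longrightarrow> m s t = enat k \<Longrightarrow> u \<in> lists S \<Longrightarrow> v \<in> lists S
      \<Longrightarrow> E (u @ alt (2 * k) s t @ v) = E (u @ v)"
    and u: "u \<in> lists S" and v: "v \<in> lists S" and eq: "wp u = wp v"
  shows "E u = E v"
proof -
  let ?U = "map (\<lambda>x. (x, True)) (u @ rev v)"
  have fst: "map fst ?U = u @ rev v" by (simp add: comp_def)
  have U: "?U \<in> lists (S \<times> UNIV)" using u v by (auto simp: in_lists_conv_set)
  have rv: "rev v \<in> lists S" using v by (auto simp: in_lists_conv_set)
  have "wp (u @ rev v) = \<one>" using u v rv eq by (simp add: wp_append wp_rev)
  then have "pres_eq S (coxeter_relators S m) ?U []"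
    using pres_eq_iff[OF U] wp_letters[OF U] fst by metis
  then have p: "pres_eq S (coxeter_relators S m) ?U []" .
  have "E (map fst ?U @ v) = E (map fst ([] :: ('a \<times> bool) list) @ v)"
    by (rule presentation_invariant_aux[of E]) (fact sq rel p v)+
  then have "E (u @ rev v @ v) = E v" unfolding fst by simp
  moreover have "E (u @ rev x @ x @ y) = E (u @ y)" if "x \<in> lists S" "y \<in> lists S" for x y
    using that
  proof (induction x arbitrary: y)
    case (Cons a x)
    then have "E ((u @ rev x) @ [a, a] @ (x @ y)) = E ((u @ rev x) @ (x @ y))"
      using u by (intro sq) (auto simp: in_lists_conv_set)
    with Cons show ?case by auto
  qed simp
  from this[OF v, of "[]"] have "E (u @ rev v @ v) = E u" by simp
  ultimately show ?thesis by simp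
qed

section \<open>The exchange condition\<close>

text \<open>
  \<open>refl_odd u t\<close>: the reflection \<open>t\<close> occurs an odd number of times among the conjugates
  \<open>s\<^sub>1 \<dots> s\<^sub>i \<dots> s\<^sub>1\<close> of the letters of \<open>u = s\<^sub>1 \<dots> s\<^sub>n\<close>.
\<close>

primrec refl_odd :: "'a list \<Rightarrow> 'a \<Rightarrow> bool" where
  "refl_odd [] t = False"
| "refl_odd (x # u) t = ((t = x) \<noteq> refl_odd u (x \<otimes> t \<otimes> x))"

text \<open>Cocycle rule: the reflections contributed by \<open>v\<close> are conjugated by
  \<open>wp u\<close>.\<close>

lemma refl_odd_append:
  assumes "u \<in> lists S" "t \<in> carrier W"
  shows "refl_odd (u @ v) t = (refl_odd u t \<noteq> refl_odd v (inv (wp u) \<otimes> t \<otimes> wp u))"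
  using assms
proof (induction u arbitrary: t)
  case (Cons x u)
  then have x: "x \<in> carrier W" "x \<in> S" "wp u \<in> carrier W" "u \<in> lists S" by (auto simp: S_carrier)
  have "inv (wp u) \<otimes> (x \<otimes> t \<otimes> x) \<otimes> wp u = inv (x \<otimes> wp u) \<otimes> t \<otimes> (x \<otimes> wp u)"
    using x Cons.prems gen_inv by (simp add: inv_mult_group m_assoc)
  with Cons.IH[of "x \<otimes> t \<otimes> x"] Cons.prems x show ?case by auto
qed simp

lemma odd_card_Suc:
  "odd (card {i. i < Suc n \<and> P i}) = (P 0 \<noteq> odd (card {i. i < n \<and> P (Suc i)}))"
proof -
  have "{i. i < Suc n \<and> P i} = (if P 0 then {0} else {}) \<union> Suc ` {i. i < n \<and> P (Suc i)}"
    (is "_ = ?A \<union> ?B")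
    by (auto simp: image_iff less_Suc_eq_0_disj)
  moreover have "card (?A \<union> ?B) = card ?A + card ?B"
    by (intro card_Un_disjoint) auto
  moreover have "card ?B = card {i. i < n \<and> P (Suc i)}" by (simp add: card_image)
  ultimately show ?thesis by simp
qed

lemma wp_alt_closed [simp]: "s \<in> S \<Longrightarrow> t \<in> S \<Longrightarrow> wp (alt n s t) \<in> carrier W"
  by (simp add: alt_lists)

lemma wp_alt_snoc:
  "s \<in> S \<Longrightarrow> t \<in> S \<Longrightarrow> wp (alt (2 * i) t s) \<otimes> t = wp (alt (Suc (2 * i)) t s)"
proof (induction i)
  case (Suc i)
  then show ?case using S_carrier by (simp add: m_assoc)
qed (simp add: S_carrier)

text \<open>The i-th reflection of s t s ... is the alternating word of length 2i + 1 that starts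
  with \<open>s\<close>.\<close>

lemma refl_odd_alt:
  assumes "s \<in> S" "t \<in> S" "r \<in> carrier W"
  shows "refl_odd (alt n s t) r = odd (card {i. i < n \<and> r = wp (alt (Suc (2 * i)) s t)})"
  using assms
proof (induction n arbitrary: s t r)
  case (Suc n)
  have sc: "s \<in> carrier W" "t \<in> carrier W" using Suc.prems S_carrier by auto
  have "(s \<otimes> r \<otimes> s = wp (alt (Suc (2 * i)) t s)) = (r = wp (alt (Suc (2 * Suc i)) s t))" for i
  proof -
    have *: "alt (Suc (2 * Suc i)) s t = s # alt (2 * Suc i) t s" by simp
    have w: "wp (alt (2 * Suc i) t s) = wp (alt (Suc (2 * i)) t s) \<otimes> s"
    proof -
      have "wp (alt (Suc (2 * i)) s t) = wp (alt (2 * i) s t) \<otimes> s"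
        using wp_alt_snoc[of t s i] Suc.prems by simp
      then have "t \<otimes> wp (alt (Suc (2 * i)) s t) = t \<otimes> wp (alt (2 * i) s t) \<otimes> s"
        using sc Suc.prems by (simp add: m_assoc)
      then show ?thesis by simp
    qed
    define y where "y = wp (alt (Suc (2 * i)) t s)"
    have y: "y \<in> carrier W" using Suc.prems unfolding y_def by (intro wp_closed alt_lists) auto
    have "(s \<otimes> r \<otimes> s = y) = (r = s \<otimes> (y \<otimes> s))"
    proof
      assume "s \<otimes> r \<otimes> s = y"
      then have "s \<otimes> (y \<otimes> s) = s \<otimes> (s \<otimes> (r \<otimes> (s \<otimes> s)))"
        using sc Suc.prems by (simp add: m_assoc[symmetric])
      then show "r = s \<otimes> (y \<otimes> s)" using sc Suc.prems by (simp add: gen_sq gen_cancel)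
    next
      assume "r = s \<otimes> (y \<otimes> s)"
      then have "s \<otimes> r \<otimes> s = s \<otimes> (s \<otimes> (y \<otimes> (s \<otimes> s)))"
        using sc y by (simp add: m_assoc)
      then show "s \<otimes> r \<otimes> s = y" using sc y Suc.prems by (simp add: gen_sq gen_cancel)
    qed
    then show ?thesis unfolding * wp_Cons w y_def .
  qed
  then have "refl_odd (alt n t s) (s \<otimes> r \<otimes> s) = odd (card {i. i < n \<and> r = wp (alt (Suc (2 * Suc i)) s t)})"
    using Suc.IH[of t s "s \<otimes> r \<otimes> s"] Suc.prems sc by simp
  then show ?case
    unfolding odd_card_Suc using sc by (simp add: eq_commute)
qed simp

text \<open>Since (s t)^k = 1, the sequence of reflections has period \<open>k\<close>, so over 2k
  letters each reflection is met an even number of times.\<close>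

lemma refl_odd_relator:
  assumes "s \<in> S" "t \<in> S" "m s t = enat k" "r \<in> carrier W"
  shows "\<not> refl_odd (alt (2 * k) s t) r"
proof -
  define P where "P i = (r = wp (alt (Suc (2 * i)) s t))" for i
  have per: "P (i + k) = P i" for i
  proof -
    have split: "alt (2 * k + j) s t = alt (2 * k) s t @ alt j s t" for j
      by (induction k) auto
    have "wp (alt (Suc (2 * (i + k))) s t) = wp (alt (2 * k + Suc (2 * i)) s t)"
      by (simp add: algebra_simps)
    also have "\<dots> = wp (alt (Suc (2 * i)) s t)"
      unfolding split using assms wp_relator by (simp add: wp_append alt_lists S_carrier del: alt.simps)
    finally show ?thesis unfolding P_def by simp
  qed
  have "{i. i < 2 * k \<and> P i} = {i. i < k \<and> P i} \<union> (\<lambda>i. i + k) ` {i. i < k \<and> P i}" (is "_ = ?A \<union> ?B")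
  proof (intro equalityI subsetI)
    fix i assume i: "i \<in> {i. i < 2 * k \<and> P i}"
    show "i \<in> ?A \<union> ?B"
    proof (cases "i < k")
      case False
      then have "P (i - k)" "i = (i - k) + k" "i - k < k" using i per[of "i - k"] by auto
      then show ?thesis by blast
    qed (use i in auto)
  qed (use per in auto)
  moreover have "card (?A \<union> ?B) = card ?A + card ?B" by (intro card_Un_disjoint) auto
  moreover have "card ?B = card ?A" by (simp add: card_image)
  ultimately have "even (card {i. i < 2 * k \<and> P i})" by simp
  then show ?thesis using refl_odd_alt[OF assms(1,2,4)] unfolding P_def by simp
qed

text \<open>Squares and relators have value 1 and contribute no parity, so by the cocycle rule
  inserting them changes nothing.\<close>

lemma refl_odd_wp:
  assumes "u \<in> lists S" "v \<in> lists S" "wp u = wp v" "t \<in> carrier W"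
  shows "refl_odd u t = refl_odd v t"
proof -
  have ins: "refl_odd (x @ r @ y) t = refl_odd (x @ y) t"
    if "x \<in> lists S" "r \<in> lists S" "wp r = \<one>" "\<And>t. t \<in> carrier W \<Longrightarrow> \<not> refl_odd r t" for x r y
    using that assms(4) by (simp add: refl_odd_append)
  show ?thesis
  proof (rule presentation_invariant[of "\<lambda>u. refl_odd u t", OF _ _ assms(1-3)], goal_cases)
    case (1 x u v)
    have nr: "\<not> refl_odd [x, x] r" if "r \<in> carrier W" for r
    proof -
      have x: "x \<in> carrier W" using 1 S_carrier by blast
      have "x \<otimes> (x \<otimes> r \<otimes> x) \<otimes> x = r" using 1 x that by (simp add: m_assoc gen_sq gen_cancel)
      moreover have "x \<otimes> x \<otimes> x = x" using 1 x by (simp add: gen_sq)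
      ultimately have "(x \<otimes> r \<otimes> x = x) = (r = x)" by metis
      then show ?thesis by auto
    qed
    show ?case by (rule ins) (use 1 nr in \<open>auto simp: S_carrier gen_sq simp del: refl_odd.simps\<close>)
  next
    case (2 s t k u v)
    then show ?case using refl_odd_relator wp_relator by (intro ins) (auto simp: alt_lists)
  qed
qed

text \<open>Multiplying \<open>wp u\<close> on the left by this reflection deletes the letter at
  position \<open>i\<close>.\<close>

definition refl_at :: "'a list \<Rightarrow> nat \<Rightarrow> 'a" where
  "refl_at u i = wp (take i u) \<otimes> (u ! i) \<otimes> inv (wp (take i u))"

lemma take_lists: "u \<in> lists S \<Longrightarrow> take i u \<in> lists S"
  by (meson in_listsD in_listsI in_set_takeD)

lemma drop_lists: "u \<in> lists S \<Longrightarrow> drop i u \<in> lists S"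
  by (meson in_listsD in_listsI in_set_dropD)

lemma refl_odd_occurs:
  assumes "u \<in> lists S" "t \<in> carrier W" "refl_odd u t"
  shows "\<exists>i < length u. t = refl_at u i"
  using assms
proof (induction u arbitrary: t)
  case (Cons x u)
  then have x: "x \<in> S" "x \<in> carrier W" "u \<in> lists S" by (auto simp: S_carrier)
  show ?case
  proof (cases "t = x")
    case True
    then have "t = refl_at (x # u) 0" using x by (simp add: refl_at_def)
    then show ?thesis by blast
  next
    case False
    with Cons.prems have "refl_odd u (x \<otimes> t \<otimes> x)" by simp
    then obtain i where i: "i < length u" "x \<otimes> t \<otimes> x = refl_at u i"
      using Cons.IH[of "x \<otimes> t \<otimes> x"] x Cons.prems by auto
    have ui: "u ! i \<in> carrier W" using i x by (simp add: S_carrier in_lists_conv_set)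
    have "t = x \<otimes> (x \<otimes> t \<otimes> x) \<otimes> x"
      using x Cons.prems by (simp add: m_assoc gen_sq gen_cancel)
    also have "\<dots> = refl_at (x # u) (Suc i)"
      unfolding i(2) refl_at_def using x ui take_lists[OF x(3), of i]
      by (simp add: m_assoc inv_mult_group gen_inv)
    finally show ?thesis using i by (metis Suc_mono length_Cons)
  qed
qed simp

definition red :: "'a list \<Rightarrow> bool" where
  "red u \<longleftrightarrow> u \<in> lists S \<and> (\<forall>v \<in> lists S. wp v = wp u \<longrightarrow> length u \<le> length v)"

lemma red_lists: "red u \<Longrightarrow> u \<in> lists S" by (simp add: red_def)

lemma red_same_length: "red u \<Longrightarrow> red v \<Longrightarrow> wp u = wp v \<Longrightarrow> length u = length v"
  by (metis le_antisym red_def)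

lemma red_transfer: "red u \<Longrightarrow> v \<in> lists S \<Longrightarrow> wp v = wp u \<Longrightarrow> length v = length u \<Longrightarrow> red v"
  by (simp add: red_def)

lemma red_appendD:
  assumes "red (u @ v)" shows "red u" "red v"
proof -
  have l: "u \<in> lists S" "v \<in> lists S" using assms by (auto simp: red_def)
  show "red u" unfolding red_def
  proof (intro conjI ballI impI l)
    fix x assume "x \<in> lists S" "wp x = wp u"
    then have "wp (x @ v) = wp (u @ v)" "x @ v \<in> lists S" using l by (auto simp: wp_append)
    then have "length (u @ v) \<le> length (x @ v)" using assms unfolding red_def by blast
    then show "length u \<le> length x" by simp
  qed
  show "red v" unfolding red_def
  proof (intro conjI ballI impI l)
    fix x assume "x \<in> lists S" "wp x = wp v"
    then have "wp (u @ x) = wp (u @ v)" "u @ x \<in> lists S" using l by (auto simp: wp_append)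
    then have "length (u @ v) \<le> length (u @ x)" using assms unfolding red_def by blast
    then show "length v \<le> length x" by simp
  qed
qed

lemma red_tl: "red (s # u) \<Longrightarrow> red u"
  using red_appendD(2)[of "[s]" u] by simp

lemma delete_refl_at:
  assumes "u \<in> lists S" "i < length u" "s \<in> S" "s = refl_at u i"
  shows "wp (s # take i u @ drop (Suc i) u) = wp u"
proof -
  have ui: "u ! i \<in> S" using assms by (simp add: in_lists_conv_set)
  have u: "u = take i u @ u ! i # drop (Suc i) u" using assms by (simp add: id_take_nth_drop)
  have tc: "wp (take i u) \<in> carrier W" "wp (drop (Suc i) u) \<in> carrier W" "u ! i \<in> carrier W"
    using assms take_lists drop_lists ui S_carrier by auto
  have "wp (s # take i u @ drop (Suc i) u) = refl_at u i \<otimes> (wp (take i u) \<otimes> wp (drop (Suc i) u))"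
    using assms take_lists drop_lists by (simp add: wp_append)
  also have "\<dots> = wp (take i u) \<otimes> (u ! i \<otimes> wp (drop (Suc i) u))"
    unfolding refl_at_def using tc by (simp add: m_assoc inv_solve_left')
  also have "\<dots> = wp (take i u @ u ! i # drop (Suc i) u)"
    using assms take_lists drop_lists ui by (simp add: wp_append)
  finally show ?thesis using u by simp
qed

text \<open>Let \<open>v\<close> be a shorter word for \<open>s # u\<close>. If \<open>s\<close> had
  even parity in \<open>u\<close>, hence in \<open>s # v\<close>, it would have odd parity in
  \<open>v\<close>; deleting the corresponding letter of \<open>v\<close> would give a word for
  \<open>wp u\<close> shorter than \<open>u\<close>.\<close>

lemma exchange:
  assumes u: "red u" and s: "s \<in> S" and nred: "\<not> red (s # u)"
  shows "\<exists>i < length u. s = refl_at u i"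
proof -
  have ul: "u \<in> lists S" using u red_lists by blast
  have sc: "s \<in> carrier W" using s S_carrier by blast
  obtain v where v: "v \<in> lists S" "wp v = wp (s # u)" "length v < length (s # u)"
    using nred ul s by (force simp: red_def not_le)
  have svu: "wp (s # v) = wp u" using v s ul sc by (simp add: gen_cancel)
  have "refl_odd u s"
  proof (rule ccontr)
    assume "\<not> refl_odd u s"
    then have "\<not> refl_odd (s # v) s" using refl_odd_wp[of u "s # v" s] v ul s sc svu by simp
    then have "refl_odd v s" using s sc by (simp add: gen_sq)
    then obtain i where i: "i < length v" "s = refl_at v i"
      using refl_odd_occurs[of v s] v sc by blast
    let ?v = "take i v @ drop (Suc i) v"
    have vl: "?v \<in> lists S" using v take_lists drop_lists by simp
    have "wp (s # ?v) = wp v" using delete_refl_at[OF v(1) i(1) s i(2)] .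
    then have "s \<otimes> wp ?v = s \<otimes> wp u" using v by simp
    then have "wp ?v = wp u" using vl ul sc by simp
    then have "length u \<le> length ?v" using u vl unfolding red_def by blast
    then show False using i v by simp
  qed
  then show ?thesis using refl_odd_occurs ul sc by blast
qed

end

section \<open>The order of the product of two generators\<close>

text \<open>
  The contragredient of the geometric representation, in coordinates: \<open>\<phi> s\<close> is the value of a
  linear form on the simple root of \<open>s\<close>.
\<close>

definition cox_form :: "('a \<Rightarrow> 'a \<Rightarrow> enat) \<Rightarrow> 'a \<Rightarrow> 'a \<Rightarrow> real" where
  "cox_form m s t = (case m s t of enat k \<Rightarrow> - cos (pi / k) | \<infinity> \<Rightarrow> - 1)"

definition cox_act :: "('a \<Rightarrow> 'a \<Rightarrow> enat) \<Rightarrow> 'a \<Rightarrow> ('a \<Rightarrow> real) \<Rightarrow> 'a \<Rightarrow> real" where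
  "cox_act m s \<phi> = (\<lambda>x. \<phi> x - 2 * cox_form m s x * \<phi> s)"

lemma cox_form_enat: "m s t = enat k \<Longrightarrow> cox_form m s t = - cos (pi / k)"
  by (simp add: cox_form_def)

lemma cox_form_infinity: "m s t = \<infinity> \<Longrightarrow> cox_form m s t = - 1"
  by (simp add: cox_form_def)

text \<open>After multiplication by 2 sin(pi/k) the sum telescopes, and its two ends differ by a
  full turn.\<close>

lemma sum_cos_eq_0:
  assumes "k \<ge> 2"
  shows "(\<Sum>j<k. cos (\<beta> + 2 * (pi / real k) * real j)) = 0"
proof -
  let ?\<theta> = "pi / real k"
  have th: "0 < ?\<theta>" "?\<theta> < pi" using assms by (auto simp: field_simps)
  then have "sin ?\<theta> \<noteq> 0" using sin_gt_zero by fastforce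
  define h where "h j = sin (\<beta> + 2 * ?\<theta> * real j - ?\<theta>)" for j
  have "2 * sin ?\<theta> * cos (\<beta> + 2 * ?\<theta> * real j) = h (Suc j) - h j" for j
  proof -
    have "x + 2 * y * real (Suc j) - y = (x + 2 * y * real j) + y" for x y :: real
      by (simp add: algebra_simps)
    then have "h (Suc j) = sin ((\<beta> + 2 * ?\<theta> * real j) + ?\<theta>)" unfolding h_def by metis
    then show ?thesis unfolding h_def sin_add sin_diff by simp
  qed
  then have "2 * sin ?\<theta> * (\<Sum>j<k. cos (\<beta> + 2 * ?\<theta> * real j)) = (\<Sum>j<k. h (Suc j) - h j)"
    by (simp add: sum_distrib_left)
  also have "\<dots> = h k - h 0" by (rule sum_lessThan_telescope)
  also have "h k = sin ((\<beta> - ?\<theta>) + 2 * pi)"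
    unfolding h_def using assms by (simp add: field_simps)
  also have "\<dots> = h 0" unfolding h_def sin_periodic by simp
  finally show ?thesis using \<open>sin ?\<theta> \<noteq> 0\<close> by simp
qed

text \<open>In the polar coordinates \<open>R, \<alpha>\<close>, the product \<open>s t\<close> is the rotation by \<open>2 \<theta>\<close>.\<close>

lemma cox_act_round:
  fixes \<theta> \<alpha> R :: real
  assumes b: "cox_form m s t = - cos \<theta>" "cox_form m t s = - cos \<theta>"
    "cox_form m s s = 1" "cox_form m t t = 1"
    and p: "\<phi> s = R * cos \<alpha>" "\<phi> t = - R * cos (\<alpha> + \<theta>)"
  shows "cox_act m s (cox_act m t \<phi>) s = R * cos (\<alpha> + 2 * \<theta>)"
    and "cox_act m s (cox_act m t \<phi>) t = - R * cos (\<alpha> + 2 * \<theta> + \<theta>)"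
    and "cox_act m s (cox_act m t \<phi>) x = \<phi> x + 2 * R * cox_form m t x * cos (\<alpha> + \<theta>)
      + 2 * R * cox_form m s x * cos (\<alpha> + 2 * \<theta>)"
proof -
  have sum: "cos (x - \<theta>) + cos (x + \<theta>) = 2 * cos \<theta> * cos x" for x
    by (simp add: cos_add cos_diff)
  have c: "cos \<alpha> + cos (\<alpha> + 2 * \<theta>) = 2 * cos \<theta> * cos (\<alpha> + \<theta>)"
    "cos (\<alpha> + \<theta>) + cos (\<alpha> + 3 * \<theta>) = 2 * cos \<theta> * cos (\<alpha> + 2 * \<theta>)"
    using sum[of "\<alpha> + \<theta>"] sum[of "\<alpha> + 2 * \<theta>"] by (simp_all add: algebra_simps)
  have t1: "cox_act m t \<phi> s = - R * cos (\<alpha> + 2 * \<theta>)"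
  proof -
    have "cox_act m t \<phi> s = R * cos \<alpha> - R * (2 * cos \<theta> * cos (\<alpha> + \<theta>))"
      unfolding cox_act_def b p by simp
    then show ?thesis unfolding c(1)[symmetric] by (simp add: algebra_simps)
  qed
  have t2: "cox_act m t \<phi> t = R * cos (\<alpha> + \<theta>)" unfolding cox_act_def b p by simp
  show "cox_act m s (cox_act m t \<phi>) s = R * cos (\<alpha> + 2 * \<theta>)"
    unfolding cox_act_def[of m s] b t1 by simp
  have "cox_act m s (cox_act m t \<phi>) t = R * cos (\<alpha> + \<theta>) - R * (2 * cos \<theta> * cos (\<alpha> + 2 * \<theta>))"
    unfolding cox_act_def[of m s] b t1 t2 by simp
  then show "cox_act m s (cox_act m t \<phi>) t = - R * cos (\<alpha> + 2 * \<theta> + \<theta>)"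
    unfolding c(2)[symmetric] by (simp add: algebra_simps)
  show "cox_act m s (cox_act m t \<phi>) x = \<phi> x + 2 * R * cox_form m t x * cos (\<alpha> + \<theta>)
      + 2 * R * cox_form m s x * cos (\<alpha> + 2 * \<theta>)"
    unfolding cox_act_def[of m s] t1 unfolding cox_act_def p by (simp add: algebra_simps)
qed

text \<open>The values at \<open>s\<close> and \<open>t\<close> rotate, and the increments at an
  arbitrary \<open>x\<close> add up to two trigonometric sums, which vanish after a full
  period.\<close>

lemma cox_act_rounds:
  fixes \<theta> \<alpha> R :: real
  assumes b: "cox_form m s t = - cos \<theta>" "cox_form m t s = - cos \<theta>"
    "cox_form m s s = 1" "cox_form m t t = 1"
    and p: "\<phi> s = R * cos \<alpha>" "\<phi> t = - R * cos (\<alpha> + \<theta>)"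
  defines "\<phi>' \<equiv> \<lambda>n. ((\<lambda>\<phi>. cox_act m s (cox_act m t \<phi>)) ^^ n) \<phi>"
  shows "\<phi>' n s = R * cos (\<alpha> + 2 * \<theta> * real n)"
    and "\<phi>' n t = - R * cos (\<alpha> + 2 * \<theta> * real n + \<theta>)"
    and "\<phi>' n x = \<phi> x + 2 * R * cox_form m t x * (\<Sum>j<n. cos (\<alpha> + \<theta> + 2 * \<theta> * real j))
      + 2 * R * cox_form m s x * (\<Sum>j<n. cos (\<alpha> + 2 * \<theta> + 2 * \<theta> * real j))"
proof -
  have st: "\<phi>' n s = R * cos (\<alpha> + 2 * \<theta> * real n) \<and> \<phi>' n t = - R * cos (\<alpha> + 2 * \<theta> * real n + \<theta>)" for n
  proof (induction n)
    case (Suc n)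
    have S: "\<phi>' (Suc n) = cox_act m s (cox_act m t (\<phi>' n))" unfolding \<phi>'_def by simp
    show ?case unfolding S
      using cox_act_round(1,2)[OF b, of "\<phi>' n" R "\<alpha> + 2 * \<theta> * real n"] Suc
      by (simp add: algebra_simps)
  qed (simp add: \<phi>'_def p)
  then show "\<phi>' n s = R * cos (\<alpha> + 2 * \<theta> * real n)"
    "\<phi>' n t = - R * cos (\<alpha> + 2 * \<theta> * real n + \<theta>)" by auto
  show "\<phi>' n x = \<phi> x + 2 * R * cox_form m t x * (\<Sum>j<n. cos (\<alpha> + \<theta> + 2 * \<theta> * real j))
      + 2 * R * cox_form m s x * (\<Sum>j<n. cos (\<alpha> + 2 * \<theta> + 2 * \<theta> * real j))"
  proof (induction n)
    case (Suc n)
    have S: "\<phi>' (Suc n) = cox_act m s (cox_act m t (\<phi>' n))" unfolding \<phi>'_def by simp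
    show ?case unfolding S
      using cox_act_round(3)[OF b, of "\<phi>' n" R "\<alpha> + 2 * \<theta> * real n" x] st[of n] Suc
      by (simp add: algebra_simps)
  qed (simp add: \<phi>'_def)
qed

lemma polar_coordinates:
  fixes p q \<theta> :: real
  assumes "sin \<theta> \<noteq> 0"
  shows "\<exists>R \<alpha>. p = R * cos \<alpha> \<and> q = - R * cos (\<alpha> + \<theta>)"
proof -
  define y where "y = (q + p * cos \<theta>) / sin \<theta>"
  have y: "q = y * sin \<theta> - p * cos \<theta>" using assms unfolding y_def by (simp add: field_simps)
  obtain R \<alpha> where "p = R * cos \<alpha>" "y = R * sin \<alpha>"
    using polar_Ex by blast
  then have "p = R * cos \<alpha> \<and> q = - R * cos (\<alpha> + \<theta>)"
    unfolding y by (simp add: cos_add algebra_simps)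
  then show ?thesis by blast
qed

context coxeter_matrix
begin

lemma cox_form_self: "s \<in> S \<Longrightarrow> cox_form m s s = 1"
  using m_eq_1[of s s] by (simp add: cox_form_def one_enat_def)

lemma cox_form_sym: "s \<in> S \<Longrightarrow> t \<in> S \<Longrightarrow> cox_form m s t = cox_form m t s"
  using m_sym by (simp add: cox_form_def)

lemma cox_act_involution: "s \<in> S \<Longrightarrow> cox_act m s (cox_act m s \<phi>) = \<phi>"
  by (auto simp: cox_act_def cox_form_self)

lemma m_ge_2: "s \<in> S \<Longrightarrow> t \<in> S \<Longrightarrow> s \<noteq> t \<Longrightarrow> m s t = enat k \<Longrightarrow> k \<ge> 2"
  using m_ge_1[of s t] m_eq_1[of s t] by (cases k) (auto simp: one_enat_def zero_enat_def)

lemma sin_label: "k \<ge> 2 \<Longrightarrow> sin (pi / real k) \<noteq> 0"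
  using sin_gt_zero[of "pi / real k"] by (fastforce simp: field_simps)

text \<open>The sum formula holds at every \<open>x\<close>, including \<open>s\<close> and
  \<open>t\<close>, so two vanishing cosine sums settle all coordinates at once.\<close>

lemma cox_act_relation:
  assumes "s \<in> S" "t \<in> S" "m s t = enat k"
  shows "((\<lambda>\<phi>. cox_act m s (cox_act m t \<phi>)) ^^ k) \<phi> = \<phi>"
proof (cases "s = t")
  case True
  then show ?thesis using assms m_eq_1[of s s] by (simp add: cox_act_involution one_enat_def)
next
  case False
  then have k: "k \<ge> 2" using assms m_ge_2 by blast
  let ?\<theta> = "pi / real k"
  obtain R \<alpha> where p: "\<phi> s = R * cos \<alpha>" "\<phi> t = - R * cos (\<alpha> + ?\<theta>)"
    using polar_coordinates[OF sin_label[OF k], of "\<phi> s" "\<phi> t"] by blast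
  have b: "cox_form m s t = - cos ?\<theta>" "cox_form m t s = - cos ?\<theta>"
    "cox_form m s s = 1" "cox_form m t t = 1"
    using assms cox_form_sym[of s t] by (simp_all add: cox_form_self cox_form_enat)
  show ?thesis
    using cox_act_rounds(3)[of m s t ?\<theta> \<phi> R \<alpha> k, OF b p]
      sum_cos_eq_0[OF k, of "\<alpha> + ?\<theta>"] sum_cos_eq_0[OF k, of "\<alpha> + 2 * ?\<theta>"]
    by (intro ext) simp
qed

lemma cox_act_order:
  assumes s: "s \<in> S" "t \<in> S" "s \<noteq> t" and n: "0 < n" "enat n < m s t"
  shows "\<exists>\<phi>. ((\<lambda>\<phi>. cox_act m s (cox_act m t \<phi>)) ^^ n) \<phi> \<noteq> \<phi>"
proof (cases "m s t")
  case (enat k)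
  then have k: "k \<ge> 2" "n < k" using m_ge_2 s n by auto
  let ?\<theta> = "pi / real k"
  have b: "cox_form m s t = - cos ?\<theta>" "cox_form m t s = - cos ?\<theta>"
    "cox_form m s s = 1" "cox_form m t t = 1"
    using s cox_form_sym[of s t] enat by (simp_all add: cox_form_self cox_form_enat)
  \<comment> \<open>This is R = 1, \<alpha> = 0. After \<open>n\<close> rounds the value at
    \<open>s\<close> is cos(2 n pi / k), which is 1 only if \<open>k\<close> divides
    \<open>n\<close>.\<close>
  define \<phi> where "\<phi> = (\<lambda>x. if x = s then 1 else - cos ?\<theta>)"
  have p: "\<phi> s = 1 * cos 0" "\<phi> t = - 1 * cos (0 + ?\<theta>)" using s by (auto simp: \<phi>_def)
  have "((\<lambda>\<phi>. cox_act m s (cox_act m t \<phi>)) ^^ n) \<phi> s = cos (2 * ?\<theta> * real n)"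
    using cox_act_rounds(1)[of m s t ?\<theta> \<phi> 1 0 n, OF b p] by simp
  moreover have "cos (2 * ?\<theta> * real n) \<noteq> 1"
  proof
    assume "cos (2 * ?\<theta> * real n) = 1"
    then obtain j :: int where "2 * ?\<theta> * real n = of_int j * 2 * pi"
      using cos_one_2pi_int by blast
    then have "real n = of_int j * real k" using k by (simp add: field_simps)
    then have "int n = j * int k" by (metis of_int_eq_iff of_int_mult of_int_of_nat_eq)
    then show False using k n by (metis dvd_triv_right less_imp_of_nat_less nat_dvd_not_less
        of_nat_dvd_iff)
  qed
  moreover have "\<phi> s = 1" by (simp add: \<phi>_def)
  ultimately show ?thesis by metis
next
  case infinity
  have b: "cox_form m s t = - 1" "cox_form m t s = - 1" "cox_form m s s = 1" "cox_form m t t = 1"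
    using s cox_form_sym[of s t] infinity by (simp_all add: cox_form_self cox_form_infinity)
  \<comment> \<open>An infinite label corresponds to the angle 0, where the polar coordinates
    degenerate. The action is then unipotent, and the values grow linearly.\<close>
  define \<phi> :: "'a \<Rightarrow> real" where "\<phi> = (\<lambda>x. if x = s then 1 else 0)"
  have "((\<lambda>\<phi>. cox_act m s (cox_act m t \<phi>)) ^^ n) \<phi> s = 1 - 2 * real n \<and>
    ((\<lambda>\<phi>. cox_act m s (cox_act m t \<phi>)) ^^ n) \<phi> t = 2 * real n" for n
  proof (induction n)
    case 0
    show ?case using s by (auto simp: \<phi>_def)
  next
    case (Suc n)
    then show ?case by (simp add: cox_act_def b)
  qed
  then have "((\<lambda>\<phi>. cox_act m s (cox_act m t \<phi>)) ^^ n) \<phi> s \<noteq> \<phi> s" using n by (simp add: \<phi>_def)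
  then show ?thesis by metis
qed

end

context coxeter_group
begin

lemma foldr_cox_act_alt:
  "foldr (cox_act m) (alt (2 * k) s t) \<phi> = ((\<lambda>\<phi>. cox_act m s (cox_act m t \<phi>)) ^^ k) \<phi>"
  by (induction k) auto

lemma cox_act_wp:
  assumes "u \<in> lists S" "v \<in> lists S" "wp u = wp v"
  shows "foldr (cox_act m) u = foldr (cox_act m) v"
proof (rule presentation_invariant[of "foldr (cox_act m)", OF _ _ assms], goal_cases)
  case (1 x u v)
  then show ?case by (intro ext) (simp add: cox_act_involution)
next
  case (2 s t k u v)
  then show ?case by (intro ext) (simp add: foldr_cox_act_alt cox_act_relation)
qed

lemma wp_alt_neq_1:
  assumes "s \<in> S" "t \<in> S" "s \<noteq> t" "0 < n" "enat n < m s t"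
  shows "wp (alt (2 * n) s t) \<noteq> \<one>"
proof
  assume "wp (alt (2 * n) s t) = \<one>"
  then have "foldr (cox_act m) (alt (2 * n) s t) = foldr (cox_act m) []"
    using assms by (intro cox_act_wp) (auto simp: alt_lists)
  then have "((\<lambda>\<phi>. cox_act m s (cox_act m t \<phi>)) ^^ n) \<phi> = \<phi>" for \<phi>
    by (simp add: foldr_cox_act_alt fun_eq_iff)
  then show False using cox_act_order[OF assms] by blast
qed

lemma wp_braid:
  assumes "s \<in> S" "t \<in> S" "m s t = enat k"
  shows "wp (alt k s t) = wp (alt k t s)"
proof -
  have "alt (2 * k) s t = alt k s t @ rev (alt k t s)" for k
  proof (induction k arbitrary: s t)
    case (Suc k)
    have "rev (alt (Suc k) t s) = rev (alt k s t) @ [t]" by simp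
    moreover have "alt (2 * Suc k) s t = s # alt (2 * k) t s @ [t]"
    proof -
      have "alt (2 * k) t s @ [t] = t # alt (2 * k) s t" by (induction k) auto
      then show ?thesis by simp
    qed
    ultimately show ?case using Suc[of t s] by simp
  qed simp
  then have "wp (alt k s t) \<otimes> inv (wp (alt k t s)) = \<one>"
    using wp_relator[OF assms] assms
    by (metis alt_lists in_lists_conv_set set_rev wp_append wp_rev)
  then show ?thesis using assms by (metis inv_equality inv_inv inv_closed wp_alt_closed)
qed

lemma rev_lists: "u \<in> lists S \<Longrightarrow> rev u \<in> lists S"
  by (auto simp: in_lists_conv_set)

section \<open>Left descents and braids\<close>

definition ldesc :: "'a \<Rightarrow> 'a \<Rightarrow> bool" where
  "ldesc s w \<longleftrightarrow> (\<exists>u. red (s # u) \<and> wp (s # u) = w)"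

lemma red_ConsD: "red (s # u) \<Longrightarrow> s \<in> S \<and> u \<in> lists S"
  using red_lists[of "s # u"] by auto

lemma ldesc_in_S: "ldesc s w \<Longrightarrow> s \<in> S"
  using red_ConsD by (auto simp: ldesc_def)

lemma ldesc_exchange:
  assumes "ldesc s w" "red u" "wp u = w"
  shows "\<exists>i < length u. s = refl_at u i"
proof (rule exchange)
  obtain v where v: "red (s # v)" "wp (s # v) = w" using assms by (auto simp: ldesc_def)
  have l: "s \<in> S" "v \<in> lists S" using v red_ConsD by blast+
  then show "s \<in> S" by blast
  show "red u" by fact
  show "\<not> red (s # u)"
  proof
    assume r: "red (s # u)"
    have "wp (s # u) = s \<otimes> (s \<otimes> wp v)" using v(2) assms(3) by simp
    then have "wp (s # u) = wp v" using l by (simp add: gen_cancel)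
    then have "length (s # u) \<le> length v" using r l unfolding red_def by metis
    moreover have "length (s # v) = length u" using red_same_length[OF v(1) assms(2)] v assms by simp
    ultimately show False by simp
  qed
qed

text \<open>
  The exchange condition lets an alternating prefix grow, since a deletion inside the prefix would
  make the order of \<open>s t\<close> too small.
\<close>

lemma ldesc_alt_prefix:
  assumes s: "ldesc s w" "ldesc t w" "s \<noteq> t" and n: "enat n \<le> m s t"
  shows "\<exists>a b z. {a, b} = {s, t} \<and> red (alt n a b @ z) \<and> wp (alt n a b @ z) = w"
  using n
proof (induction n)
  case 0
  show ?case using s by (auto simp: ldesc_def)
next
  case (Suc n)
  have sS: "s \<in> S" "t \<in> S" using s ldesc_in_S by blast+
  have "enat n \<le> m s t" using Suc.prems by (meson Suc_ile_eq le_less)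
  then obtain a b z where ab: "{a, b} = {s, t}" "red (alt n a b @ z)" "wp (alt n a b @ z) = w"
    using Suc.IH by blast
  have abS: "a \<in> S" "b \<in> S" "a \<noteq> b" "ldesc b w" "m a b = m s t"
    using ab(1) sS s m_sym by (auto simp: doubleton_eq_iff)
  let ?x = "alt n a b @ z"
  obtain i where i: "i < length ?x" "b = refl_at ?x i"
    using ldesc_exchange[OF abS(4) ab(2,3)] by blast
  have xl: "?x \<in> lists S" using ab red_lists by blast
  \<comment> \<open>Inside the prefix the deleted letter has as reflection the alternating word of
    length 2i + 1 starting with \<open>a\<close>. If this equals \<open>b\<close>, multiplication by
    \<open>b\<close> gives (b a)^(i+1) = 1 with i + 1 < \<open>m a b\<close>.\<close>
  have "\<not> i < n"
  proof
    assume "i < n"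
    have sp: "alt n a b = alt i a b @ alt (n - i) (if even i then a else b) (if even i then b else a)"
      using \<open>i < n\<close>
    proof (induction i arbitrary: n a b)
      case (Suc i)
      then obtain n' where "n = Suc n'" by (cases n) auto
      then show ?case using Suc.IH[of n' b a] Suc.prems by auto
    qed simp
    obtain l where l: "n - i = Suc l" using \<open>i < n\<close> by (metis Suc_diff_Suc)
    have tk: "take i ?x = alt i a b" "?x ! i = (if even i then a else b)"
      unfolding sp l by (auto simp: nth_append)
    have "refl_at ?x i = wp (alt i a b @ [if even i then a else b] @ rev (alt i a b))"
      unfolding refl_at_def tk using abS rev_lists[of "alt i a b"]
      by (simp add: wp_append alt_lists wp_rev m_assoc S_carrier)
    also have "alt i a b @ [if even i then a else b] @ rev (alt i a b) = alt (Suc (2 * i)) a b"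
    proof (induction i arbitrary: a b)
      case (Suc i)
      have "alt (Suc (2 * i)) b a @ [a] = alt (2 * Suc i) b a"
        by (induction i) (auto simp: numeral_2_eq_2)
      moreover have "alt (Suc i) a b @ [if even (Suc i) then a else b] @ rev (alt (Suc i) a b)
        = a # (alt i b a @ [if even i then b else a] @ rev (alt i b a)) @ [a]" by auto
      ultimately show ?case unfolding Suc[of b a] by simp
    qed simp
    finally have "b = wp (alt (Suc (2 * i)) a b)" using i by simp
    then have "b \<otimes> b = wp (alt (2 * Suc i) b a)" by simp
    then have "wp (alt (2 * Suc i) b a) = \<one>" using abS gen_sq by simp
    moreover have "enat (Suc i) < m b a"
    proof -
      have "enat (Suc i) < enat (Suc n)" using \<open>i < n\<close> by simp
      then show ?thesis using Suc.prems abS m_sym[of a b] by (metis less_le_trans)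
    qed
    ultimately show False using wp_alt_neq_1[of b a "Suc i"] abS by auto
  qed
  then have tk: "take i ?x @ drop (Suc i) ?x = alt n a b @ (take (i - n) z @ drop (Suc (i - n)) z)"
    by (simp add: Suc_diff_le)
  let ?z = "take (i - n) z @ drop (Suc (i - n)) z"
  have e: "wp (alt (Suc n) b a @ ?z) = wp ?x"
    using delete_refl_at[OF xl i(1) abS(2) i(2)] unfolding tk by simp
  moreover have "alt (Suc n) b a @ ?z \<in> lists S"
    using xl abS take_lists drop_lists by (auto simp: alt_lists)
  moreover have "length (alt (Suc n) b a @ ?z) = length ?x" using i \<open>\<not> i < n\<close> by auto
  ultimately have "red (alt (Suc n) b a @ ?z)" using red_transfer[OF ab(2)] by blast
  then show ?case using ab(1,3) e by (metis insert_commute)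
qed

text \<open>The alternating prefix is grown to length \<open>m s t\<close>, where both starting
  letters give the same element. For an infinite label it would outgrow the length of
  \<open>w\<close>.\<close>

lemma ldesc_braid:
  assumes s: "ldesc s w" "ldesc t w" "s \<noteq> t"
  shows "\<exists>k z. m s t = enat k \<and> red (alt k s t @ z) \<and> wp (alt k s t @ z) = w"
proof -
  have sS: "s \<in> S" "t \<in> S" using s ldesc_in_S by blast+
  obtain u where u: "red u" "wp u = w" using s by (auto simp: ldesc_def)
  show ?thesis
  proof (cases "m s t")
    case infinity
    then obtain a b z where "red (alt (Suc (length u)) a b @ z)" "wp (alt (Suc (length u)) a b @ z) = w"
      using ldesc_alt_prefix[OF s, of "Suc (length u)"] by auto
    then have "length (alt (Suc (length u)) a b @ z) = length u"
      using u red_same_length by metis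
    then show ?thesis by simp
  next
    case (enat k)
    then obtain a b z where ab: "{a, b} = {s, t}" "red (alt k a b @ z)" "wp (alt k a b @ z) = w"
      using ldesc_alt_prefix[OF s, of k] by auto
    have z: "z \<in> lists S" using red_lists[OF ab(2)] by auto
    have "wp (alt k a b) = wp (alt k s t)" using ab(1) wp_braid[OF sS enat] by (auto simp: doubleton_eq_iff)
    moreover have "a \<in> S" "b \<in> S" using ab(1) sS by auto
    ultimately have "wp (alt k s t @ z) = wp (alt k a b @ z)" using z sS by (simp add: wp_append alt_lists)
    then have "wp (alt k s t @ z) = w" using ab(3) by simp
    then have "red (alt k s t @ z)" using red_transfer[OF ab(2)] ab z sS by (auto simp: alt_lists)
    with \<open>wp (alt k s t @ z) = w\<close> enat show ?thesis by blast
  qed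
qed

end

section \<open>Fully commutative words\<close>

lemma comm_equiv_refl [simp]: "comm_equiv m u u"
  by (simp add: comm_equiv_def)

lemma comm_equiv_trans: "comm_equiv m u v \<Longrightarrow> comm_equiv m v w \<Longrightarrow> comm_equiv m u w"
  unfolding comm_equiv_def by (rule rtranclp_trans)

lemma comm_equiv_swap: "m s t = 2 \<Longrightarrow> comm_equiv m (p @ s # t # q) (p @ t # s # q)"
  unfolding comm_equiv_def using comm_step.intros[of m s t p q] by auto

lemma comm_equiv_context:
  assumes "comm_equiv m u v" shows "comm_equiv m (p @ u @ q) (p @ v @ q)"
  using assms unfolding comm_equiv_def
proof (induction rule: rtranclp_induct)
  case (step y z)
  from step(2) have "comm_step m (p @ y @ q) (p @ z @ q)"
  proof cases
    case (1 s t a b)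
    then show ?thesis using comm_step.intros[of m s t "p @ a" "b @ q"] by simp
  qed
  with step show ?case by (meson rtranclp.rtrancl_into_rtrancl)
qed simp

lemma comm_equiv_Cons: "comm_equiv m u v \<Longrightarrow> comm_equiv m (x # u) (x # v)"
  using comm_equiv_context[of m u v "[x]" "[]"] by simp

lemma comm_equiv_mset: "comm_equiv m u v \<Longrightarrow> mset u = mset v"
  unfolding comm_equiv_def by (induction rule: rtranclp_induct) (auto elim!: comm_step.cases)

lemma comm_equiv_filter:
  assumes "comm_equiv m u v" "\<And>a b. P a \<Longrightarrow> P b \<Longrightarrow> m a b \<noteq> 2"
  shows "filter P u = filter P v"
  using assms(1) unfolding comm_equiv_def
proof (induction rule: rtranclp_induct)
  case (step y z)
  from step(2) have "filter P y = filter P z"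
    by cases (use assms(2) in auto)
  with step show ?case by simp
qed simp

lemma comm_equiv_commute_past:
  assumes "\<And>y. y \<in> set v \<Longrightarrow> m x y = 2"
  shows "comm_equiv m (p @ x # v @ q) (p @ v @ x # q)"
  using assms
proof (induction v arbitrary: p)
  case (Cons y v)
  have "comm_equiv m (p @ x # y # v @ q) (p @ y # x # v @ q)"
    using Cons.prems by (intro comm_equiv_swap) auto
  moreover have "comm_equiv m ((p @ [y]) @ x # v @ q) ((p @ [y]) @ v @ x # q)"
    using Cons.prems by (intro Cons.IH) auto
  ultimately show ?case using comm_equiv_trans by fastforce
qed simp

context coxeter_matrix
begin

lemma comm_equiv_lists: "comm_equiv m u v \<Longrightarrow> u \<in> lists S \<Longrightarrow> v \<in> lists S"
  using comm_equiv_mset by (metis in_lists_conv_set set_mset_mset)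

lemma comm_equiv_sym:
  assumes "comm_equiv m u v" "u \<in> lists S" shows "comm_equiv m v u"
proof -
  have "comm_equiv m v u \<and> v \<in> lists S"
    using assms unfolding comm_equiv_def
  proof (induction rule: rtranclp_induct)
    case (step y z)
    from step(2) show ?case
    proof cases
      case (1 s t a b)
      then have "m t s = 2" using step m_sym[of s t] by auto
      then have "comm_step m z y" using comm_step.intros[of m t s a b] 1 by simp
      with step 1 show ?thesis by (auto intro: converse_rtranclp_into_rtranclp)
    qed
  qed simp
  then show ?thesis by blast
qed

definition has_braid :: "'a list \<Rightarrow> bool" where
  "has_braid u \<longleftrightarrow> (\<exists>p q s. u = p @ [s, s] @ q) \<or>
     (\<exists>p q s t k. m s t = enat k \<and> 3 \<le> k \<and> u = p @ alt k s t @ q)"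

text \<open>Reducedness is deliberately not demanded: it is derived from the absence of squares and
  long braids in the commutation class. Goodness is thus a condition on words alone.\<close>

definition good :: "'a list \<Rightarrow> bool" where
  "good u \<longleftrightarrow> u \<in> lists S \<and> (\<forall>v. comm_equiv m u v \<longrightarrow> \<not> has_braid v)"

lemma good_lists: "good u \<Longrightarrow> u \<in> lists S"
  by (simp add: good_def)

lemma has_braid_context: "has_braid u \<Longrightarrow> has_braid (p @ u @ q)"
  unfolding has_braid_def by (metis append.assoc)

lemma good_factor: "good (p @ u @ q) \<Longrightarrow> good u"
  unfolding good_def using has_braid_context[of _ p q] comm_equiv_context[of m u _ p q] by auto blast

lemma good_comm_equiv: "good u \<Longrightarrow> comm_equiv m u v \<Longrightarrow> good v"
  unfolding good_def using comm_equiv_trans comm_equiv_lists by blast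

end

context coxeter_group
begin

lemma comm_equiv_wp:
  assumes "comm_equiv m u v" "u \<in> lists S" shows "wp u = wp v"
proof -
  have "wp u = wp v \<and> v \<in> lists S"
    using assms unfolding comm_equiv_def
  proof (induction rule: rtranclp_induct)
    case (step y z)
    from step(2) show ?case
    proof cases
      case (1 s t a b)
      then have l: "a \<in> lists S" "b \<in> lists S" "s \<in> S" "t \<in> S" using step by auto
      have "wp (alt 2 s t) = wp (alt 2 t s)"
        using 1 l by (intro wp_braid) (auto simp: numeral_eq_enat)
      then have "s \<otimes> t = t \<otimes> s" using l S_carrier by (simp add: numeral_2_eq_2)
      then have "s \<otimes> (t \<otimes> wp b) = t \<otimes> (s \<otimes> wp b)" using l S_carrier by (metis m_assoc wp_closed)
      then show ?thesis using step 1 l by (simp add: wp_append)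
    qed
  qed simp
  then show ?thesis by blast
qed

lemma comm_equiv_red:
  assumes "comm_equiv m u v" "red u" shows "red v"
proof (rule red_transfer[OF assms(2)])
  show "v \<in> lists S" using comm_equiv_lists assms red_lists by blast
  show "wp v = wp u" using comm_equiv_wp assms red_lists by metis
  show "length v = length u" using comm_equiv_mset[OF assms(1)] by (metis size_mset)
qed

lemma red_no_square: "red (p @ [s, s] @ q) \<Longrightarrow> False"
proof -
  assume r: "red (p @ [s, s] @ q)"
  then have l: "p \<in> lists S" "q \<in> lists S" "s \<in> S" using red_lists[OF r] by auto
  then have "wp (p @ q) = wp (p @ [s, s] @ q)" "p @ q \<in> lists S" by (simp_all add: wp_append gen_cancel)
  then have "length (p @ [s, s] @ q) \<le> length (p @ q)" using r unfolding red_def by blast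
  then show False by simp
qed

text \<open>Write u = s u'. If \<open>u\<close> were not reduced, exchange and uniqueness for u'
  would put a second \<open>s\<close> at the front of u', a square. If a reduced word for the same
  element starts with t different from \<open>s\<close>, both letters are left descents, so some
  reduced word starts with the braid on \<open>s\<close> and t. By uniqueness for u' it lies in the
  class of \<open>u\<close>, and therefore m(s, t) = 2.\<close>

theorem good_red_unique:
  assumes "good u" shows "red u \<and> (\<forall>v. red v \<and> wp v = wp u \<longrightarrow> comm_equiv m u v)"
  using assms
proof (induction "length u" arbitrary: u rule: less_induct)
  case less
  show ?case
  proof (cases u)
    case Nil
    then have "red u" by (simp add: red_def)
    moreover have "comm_equiv m u v" if "red v" "wp v = wp u" for v
      using red_same_length[OF that(1) \<open>red u\<close> that(2)] Nil by simp
    ultimately show ?thesis by blast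
  next
    case (Cons s u')
    have g': "good u'" using less.prems good_factor[of "[s]" u' "[]"] Cons by simp
    have sS: "s \<in> S" "u' \<in> lists S" using good_lists[OF less.prems] Cons by auto
    have IH: "red u'" "\<And>v. red v \<Longrightarrow> wp v = wp u' \<Longrightarrow> comm_equiv m u' v"
      using less.hyps[of u'] g' Cons by auto
    have nb: "\<not> has_braid v" if "comm_equiv m u v" for v
      using less.prems that unfolding good_def by blast
    have ru: "red u"
    proof (rule ccontr)
      assume "\<not> red u"
      then obtain i where i: "i < length u'" "s = refl_at u' i"
        using exchange[OF IH(1) sS(1)] Cons by blast
      let ?v = "take i u' @ drop (Suc i) u'"
      have w: "wp (s # ?v) = wp u'" using delete_refl_at[OF sS(2) i(1) sS(1) i(2)] .
      have "red (s # ?v)"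
        using i sS by (intro red_transfer[OF IH(1)] w) (auto simp: take_lists drop_lists)
      then have "comm_equiv m u' (s # ?v)" using IH(2) w by blast
      then have "comm_equiv m u (s # s # ?v)" using Cons comm_equiv_Cons by auto
      moreover have "has_braid (s # s # ?v)" unfolding has_braid_def
        by (metis append_Cons append_Nil)
      ultimately show False using nb by blast
    qed
    have "comm_equiv m u v" if v: "red v" "wp v = wp u" for v
    proof -
      have "length v = length u" using red_same_length[OF v(1) ru v(2)] .
      then obtain t v' where vt: "v = t # v'" using Cons by (cases v) auto
      have tS: "t \<in> S" "v' \<in> lists S" using v vt red_ConsD by auto
      have rv': "red v'" using v vt red_tl by blast
      show ?thesis
      proof (cases "t = s")
        case True
        then have "wp v' = wp u'" using v vt Cons sS tS S_carrier by simp
        then show ?thesis using IH(2) rv' vt Cons True comm_equiv_Cons by metis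
      next
        case False
        have "ldesc s (wp u)" "ldesc t (wp u)" using ru Cons v vt unfolding ldesc_def by metis+
        then obtain k z where k: "m s t = enat k" "red (alt k s t @ z)" "wp (alt k s t @ z) = wp u"
          using ldesc_braid False by metis
        have "k \<ge> 2" using m_ge_2 k(1) sS tS False by blast
        then obtain j where j: "k = Suc (Suc j)" by (metis Suc_le_D numeral_2_eq_2 Suc_le_mono)
        let ?y = "alt (Suc j) t s @ z"
        have y: "alt k s t @ z = s # ?y" unfolding j by simp
        have yl: "?y \<in> lists S" using k(2) unfolding y using red_ConsD by blast
        have "wp ?y = wp u'" using k(3) unfolding y Cons using yl sS S_carrier by simp
        moreover have "red ?y" using k(2) unfolding y by (rule red_tl)
        ultimately have "comm_equiv m u' ?y" by (intro IH(2))
        then have c: "comm_equiv m u (alt k s t @ z)" unfolding y Cons by (rule comm_equiv_Cons)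
        have "\<not> 3 \<le> k"
        proof
          assume "3 \<le> k"
          then have "has_braid (alt k s t @ z)" unfolding has_braid_def using k(1)
            by (metis append_Nil)
          then show False using nb c by blast
        qed
        then have k2: "k = 2" using \<open>k \<ge> 2\<close> by simp
        then have m2: "m s t = 2" using k by (simp add: numeral_eq_enat)
        have "comm_equiv m u (s # t # z)" using c k2 by (simp add: numeral_2_eq_2)
        then have cu: "comm_equiv m u (t # s # z)"
          using comm_equiv_swap[of m s t "[]" z] m2 comm_equiv_trans by fastforce
        then have g: "good (t # s # z)" using good_comm_equiv less.prems by blast
        \<comment> \<open>After cancelling \<open>t\<close>, the hypothesis is needed for the good
          word \<open>s # z\<close>. It is not the tail of \<open>u\<close>, so the induction runs
          over the length.\<close>
        then have gs: "good (s # z)" using good_factor[of "[t]" "s # z" "[]"] by simp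
        have "wp (t # s # z) = wp (t # v')"
          using comm_equiv_wp[OF cu] good_lists[OF less.prems] v vt by simp
        then have "wp v' = wp (s # z)" using tS good_lists[OF gs] S_carrier by simp
        moreover have "length (s # z) < length u"
          using comm_equiv_mset[OF cu] by (metis length_Cons lessI size_mset)
        ultimately have "comm_equiv m (s # z) v'" using less.hyps[of "s # z"] gs rv' by blast
        then show ?thesis unfolding vt using cu comm_equiv_Cons comm_equiv_trans by metis
      qed
    qed
    then show ?thesis using ru by blast
  qed
qed

lemma reduced_expression_iff: "reduced_expression W S u w \<longleftrightarrow> red u \<and> wp u = w"
  unfolding reduced_expression_def expression_def red_def by auto

lemma good_FC:
  assumes "good u" shows "wp u \<in> FC W S m" "reduced_expression W S u (wp u)"
proof -
  note g = good_red_unique[OF assms]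
  have u: "u \<in> lists S" using good_lists assms by blast
  show "reduced_expression W S u (wp u)" using g by (simp add: reduced_expression_iff)
  have "comm_equiv m v v'" if "red v \<and> wp v = wp u" "red v' \<and> wp v' = wp u" for v v'
  proof -
    have "comm_equiv m u v" "comm_equiv m u v'" using g that by blast+
    then show ?thesis using comm_equiv_sym comm_equiv_trans u by blast
  qed
  then show "wp u \<in> FC W S m" using u unfolding FC_def reduced_expression_iff by auto
qed

text \<open>Turning a long braid around keeps the element and the length. Commutation moves,
  however, preserve the order of the letters \<open>s\<close> and \<open>t\<close> among themselves,
  so the two words cannot be equivalent.\<close>

lemma FC_good:
  assumes "wp u \<in> FC W S m" "red u" shows "good u"
  unfolding good_def
proof (intro conjI allI impI notI)
  show "u \<in> lists S" using assms red_lists by blast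
  fix v assume v: "comm_equiv m u v" "has_braid v"
  have r: "red v" "wp v = wp u"
    using comm_equiv_red[OF v(1) assms(2)] comm_equiv_wp[OF v(1) red_lists[OF assms(2)]] by auto
  from v(2) show False unfolding has_braid_def
  proof (elim disjE exE conjE)
    fix p q s assume "v = p @ [s, s] @ q"
    then show False using r red_no_square by blast
  next
    fix p q s t k assume k: "m s t = enat k" "3 \<le> k" "v = p @ alt k s t @ q"
    obtain j where j: "k = Suc (Suc j)" using k by (metis Suc_le_D numeral_3_eq_3 Suc_le_mono)
    have l: "p \<in> lists S" "q \<in> lists S" "s \<in> S" "t \<in> S"
      using red_lists[OF r(1)] unfolding k(3) j by auto
    let ?v = "p @ alt k t s @ q"
    have w: "wp ?v = wp v" unfolding k(3) using l wp_braid[OF l(3,4) k(1)]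
      by (simp add: wp_append alt_lists)
    have "red ?v" using l by (intro red_transfer[OF r(1)] w) (auto simp: alt_lists k(3))
    then have "comm_equiv m v ?v"
      using assms r w unfolding FC_def reduced_expression_iff by auto
    then have "filter (\<lambda>x. x = s \<or> x = t) v = filter (\<lambda>x. x = s \<or> x = t) ?v"
    proof (rule comm_equiv_filter)
      fix a b assume "a = s \<or> a = t" "b = s \<or> b = t"
      then show "m a b \<noteq> 2"
        using k m_sym[of s t] l m_eq_1[of s s] m_eq_1[of t t] by (auto simp: numeral_eq_enat one_enat_def)
    qed
    then have "filter (\<lambda>x. x = s \<or> x = t) (alt k s t @ q) = filter (\<lambda>x. x = s \<or> x = t) (alt k t s @ q)"
      unfolding k(3) filter_append append_same_eq same_append_eq .
    moreover have "hd (filter (\<lambda>x. x = s \<or> x = t) (alt k s t @ q)) = s"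
      "hd (filter (\<lambda>x. x = s \<or> x = t) (alt k t s @ q)) = t" unfolding j by simp_all
    ultimately have "s = t" by simp
    then show False using k m_eq_1[of s s] l by (auto simp: one_enat_def)
  qed
qed

lemma CFC_rotate_good:
  assumes "w \<in> CFC W S m" "reduced_expression W S u w" shows "good (rotate n u)"
proof -
  obtain x where "x \<in> FC W S m" "reduced_expression W S (rotate n u) x"
    using assms unfolding CFC_def by blast
  then show ?thesis using FC_good by (auto simp: reduced_expression_iff)
qed

lemma CFC_count:
  assumes "w \<in> CFC W S m" "reduced_expression W S u w" "reduced_expression W S v w"
  shows "mset u = mset v"
proof -
  have "good u" using CFC_rotate_good[OF assms(1,2), of 0] by simp
  then have "comm_equiv m u v"
    using good_red_unique[OF \<open>good u\<close>] assms by (auto simp: reduced_expression_iff)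
  then show ?thesis by (rule comm_equiv_mset)
qed

text \<open>If v is a reduced expression of the k-th power, then v v is equivalent to the power 2k,
  hence good, and every cyclic shift of v is a factor of v v. Different powers have different
  lengths.\<close>

theorem infinite_CFC:
  assumes "u \<noteq> []" and good: "\<And>k. good (concat (replicate k u))"
  shows "infinite (CFC W S m)"
proof -
  define U where "U k = concat (replicate k u)" for k
  have gU: "good (U k)" for k unfolding U_def by (rule good)
  have CFC: "wp (U k) \<in> CFC W S m" for k
  proof -
    have "\<exists>x\<in>FC W S m. reduced_expression W S (rotate n v) x"
      if v: "reduced_expression W S v (wp (U k))" for v n
    proof -
      have c: "comm_equiv m (U k) v"
        using good_red_unique[OF gU] v by (auto simp: reduced_expression_iff)
      have "U (2 * k) = U k @ U k"
        unfolding U_def by (simp add: mult_2 replicate_add)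
      moreover have "comm_equiv m (U k @ U k) (v @ v)"
        using comm_equiv_context[OF c, of "[]" "U k"] comm_equiv_context[OF c, of v "[]"]
          comm_equiv_trans by fastforce
      ultimately have "good (v @ v)" using gU[of "2 * k"] good_comm_equiv by metis
      moreover have "v @ v = take (n mod length v) v @ rotate n v @ drop (n mod length v) v"
        by (simp add: rotate_drop_take)
      ultimately have "good (rotate n v)" using good_factor by metis
      then show ?thesis using good_FC by blast
    qed
    then show ?thesis unfolding CFC_def using good_lists[OF gU] by simp
  qed
  have len: "length (U k) = k * length u" for k
    unfolding U_def by (induction k) auto
  have "inj (\<lambda>k. wp (U k))"
  proof (rule injI)
    fix j k assume "wp (U j) = wp (U k)"
    then have "length (U j) = length (U k)"
      using good_red_unique[OF gU] red_same_length by metis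
    then show "j = k" using assms(1) by (simp add: len)
  qed
  then have "infinite (range (\<lambda>k. wp (U k)))" using finite_imageD by blast
  moreover have "range (\<lambda>k. wp (U k)) \<subseteq> CFC W S m" using CFC by blast
  ultimately show ?thesis using finite_subset by blast
qed

end

section \<open>Criteria for full commutativity\<close>

context coxeter_matrix
begin

definition adj :: "'a \<Rightarrow> 'a \<Rightarrow> bool" where
  "adj s t \<longleftrightarrow> s \<in> S \<and> t \<in> S \<and> 3 \<le> m s t"

lemma adj_sym: "adj s t \<Longrightarrow> adj t s"
  using m_sym by (auto simp: adj_def)

lemma adj_label_sym: "adj s t \<Longrightarrow> m s t = m t s"
  using m_sym by (simp add: adj_def)

lemma adj_3: "adj s t \<Longrightarrow> enat 3 \<le> m s t"
  by (simp add: adj_def numeral_eq_enat)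

lemma adj_irrefl: "\<not> adj s s"
  using m_eq_1[of s s] by (auto simp: adj_def one_enat_def numeral_eq_enat)

lemma adj_neq: "adj s t \<Longrightarrow> s \<noteq> t"
  using adj_irrefl by blast

lemma adj_noncomm: "adj s t \<Longrightarrow> m s t \<noteq> 2"
  by (auto simp: adj_def numeral_eq_enat)

lemma m_cases:
  assumes "s \<in> S" "t \<in> S" shows "s = t \<or> m s t = 2 \<or> adj s t"
proof (cases "m s t")
  case (enat k)
  then show ?thesis
    using assms m_ge_2[of s t k] by (cases "s = t"; cases "k = 2") (auto simp: adj_def numeral_eq_enat)
qed (use assms in \<open>auto simp: adj_def\<close>)

text \<open>
  If the letters of a word are tagged by the entries of a sorted list, then commutation moves can be
  followed on the tags, and tags of noncommuting letters keep their order.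
\<close>

definition order_kept :: "('p \<Rightarrow> 'a) \<Rightarrow> ('p \<Rightarrow> nat) \<Rightarrow> 'p list \<Rightarrow> bool" where
  "order_kept f \<kappa> V \<longleftrightarrow> sorted_wrt (\<lambda>x y. m (f x) (f y) \<noteq> 2 \<longrightarrow> \<kappa> x \<le> \<kappa> y) V"

lemma comm_equiv_lift:
  assumes "comm_equiv m (map f U) v" "map f U \<in> lists S" "sorted (map \<kappa> U)"
  shows "\<exists>V. v = map f V \<and> mset V = mset U \<and> order_kept f \<kappa> V"
  using assms(1) unfolding comm_equiv_def
proof (induction rule: rtranclp_induct)
  case base
  have "order_kept f \<kappa> U" using assms(3) unfolding order_kept_def sorted_wrt_map
    by (rule sorted_wrt_mono_rel[rotated]) auto
  then show ?case by blast
next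
  case (step y z)
  then obtain Y where Y: "y = map f Y" "mset Y = mset U" "order_kept f \<kappa> Y" by blast
  from step(2) show ?case
  proof cases
    case (1 s t a b)
    then obtain A i j B where Yd: "Y = A @ i # j # B" "a = map f A" "s = f i" "t = f j" "b = map f B"
      using Y(1) by (auto simp: map_eq_append_conv map_eq_Cons_conv Cons_eq_map_conv append_eq_map_conv)
    have "set Y = set U" using Y(2) by (metis set_mset_mset)
    then have "i \<in> set U" "j \<in> set U" unfolding Yd by auto
    then have "f i \<in> S" "f j \<in> S" using assms(2) by auto
    then have "m (f j) (f i) = 2" using 1 m_sym Yd by metis
    then have "order_kept f \<kappa> (A @ j # i # B)"
      using Y(3) unfolding Yd order_kept_def by (auto simp: sorted_wrt_append)
    moreover have "mset (A @ j # i # B) = mset U" using Y(2) unfolding Yd by (simp add: add_mset_commute)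
    ultimately show ?thesis using 1 Yd by (intro exI[of _ "A @ j # i # B"]) auto
  qed
qed

text \<open>A letter that commutes with neither of two letters cannot leave the place between them,
  in any word of the class.\<close>

lemma order_kept_between:
  assumes V: "order_kept f \<kappa> (p @ es @ q)" and i: "i \<in> set es" and j: "j \<in> set es"
    and z: "z \<in> set (p @ es @ q)" "\<kappa> i < \<kappa> z" "\<kappa> z < \<kappa> j"
    and nc: "m (f z) (f i) \<noteq> 2" "m (f j) (f z) \<noteq> 2"
  shows "z \<in> set es"
proof (rule ccontr)
  assume "z \<notin> set es"
  then consider "z \<in> set p" | "z \<in> set q" using z by auto
  then show False
  proof cases
    case 1
    then have "\<kappa> z \<le> \<kappa> i" using V i nc(1) unfolding order_kept_def sorted_wrt_append by auto
    then show False using z by simp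
  next
    case 2
    then have "\<kappa> j \<le> \<kappa> z" using V j nc(2) unfolding order_kept_def sorted_wrt_append by auto
    then show False using z by simp
  qed
qed

lemma has_braidE:
  assumes "has_braid u" "u \<in> lists S"
  obtains (square) p q s where "u = p @ [s, s] @ q"
  | (braid) p q s t k where "m s t = enat k" "3 \<le> k" "u = p @ alt k s t @ q" "adj s t"
proof -
  from assms(1) consider "\<exists>p q s. u = p @ [s, s] @ q" |
    "\<exists>p q s t k. m s t = enat k \<and> 3 \<le> k \<and> u = p @ alt k s t @ q" unfolding has_braid_def by blast
  then show ?thesis
  proof cases
    case 2
    then obtain p q s t k where k: "m s t = enat k" "3 \<le> k" "u = p @ alt k s t @ q" by blast
    obtain j where "k = Suc (Suc j)" using k by (metis Suc_le_D numeral_3_eq_3 Suc_le_mono)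
    then have "adj s t" using k assms(2) by (auto simp: adj_def numeral_eq_enat)
    then show ?thesis using braid k by blast
  qed (use square in blast)
qed

text \<open>Letters of successive blocks do not commute, so commutation moves stay inside the blocks.\<close>

lemma layered_good:
  fixes B :: "nat \<Rightarrow> 'a list"
  assumes ne: "\<And>i. B i \<noteq> []" and dist: "\<And>i. distinct (B i)"
    and adj: "\<And>i x y. x \<in> set (B i) \<Longrightarrow> y \<in> set (B (Suc i)) \<Longrightarrow> adj x y"
    and L3: "\<And>i x y. x \<in> set (B i) \<Longrightarrow> B (Suc i) = [y] \<Longrightarrow> x \<in> set (B (Suc (Suc i))) \<Longrightarrow> 4 \<le> m x y"
    and L4: "\<And>i x y. x \<in> set (B i) \<Longrightarrow> B (Suc i) = [y] \<Longrightarrow> B (Suc (Suc i)) = [x]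
      \<Longrightarrow> y \<notin> set (B (Suc (Suc (Suc i))))"
  shows "good (concat (map B [0..<K]))"
proof -
  define U where "U = concat (map (\<lambda>i. map (Pair i) (B i)) [0..<K])"
  have mapU: "map snd U = concat (map B [0..<K])"
    unfolding U_def by (simp add: map_concat comp_def)
  have setU: "set U = {(i, x). i < K \<and> x \<in> set (B i)}" unfolding U_def by auto
  have sortU: "sorted (map fst U)"
    unfolding U_def by (induction K) (auto simp: sorted_append comp_def map_replicate_const)
  have distU: "distinct U"
    unfolding U_def by (induction K) (auto simp: distinct_map dist intro: inj_onI)
  have BS: "x \<in> S" if "x \<in> set (B i)" for i x
    using that adj ne[of "Suc i"] by (metis adj_def list.set_intros(1) neq_Nil_conv)
  have lU: "map snd U \<in> lists S" using BS unfolding in_lists_conv_set by (auto simp: setU)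
  have "\<not> has_braid v" if v: "comm_equiv m (map snd U) v" for v
  proof
    assume b: "has_braid v"
    obtain V where V: "v = map snd V" "mset V = mset U" "order_kept snd fst V"
      using comm_equiv_lift[OF v lU sortU] by blast
    have sV: "set V = {(i, x). i < K \<and> x \<in> set (B i)}" using V(2) setU by (metis set_mset_mset)
    have dV: "distinct V" using V(2) distU by (metis mset_eq_imp_distinct_iff)
    have ord: "i < k \<and> Suc i \<noteq> k" if "V = p @ (i, x) # r @ (k, x) # q" for p i x r k q
    proof -
      have x: "x \<in> set (B i)" "x \<in> set (B k)" "i \<noteq> k" using sV dV that by auto
      have "m x x \<noteq> 2" using m_eq_1[of x x] BS[OF x(1)] by auto
      then have "i \<le> k" using V(3) unfolding that order_kept_def by (auto simp: sorted_wrt_append)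
      moreover have "Suc i \<noteq> k" using adj[OF x(1)] x(2) adj_irrefl by blast
      ultimately show ?thesis using x by simp
    qed
    have between: "z \<in> set es"
      if "V = p @ es @ q" "(i, x) \<in> set es" "(k, x) \<in> set es" "z \<in> set V" "i < fst z" "fst z < k"
        "fst z = Suc i \<or> Suc (fst z) = k" for p es q i x k z
    proof (rule order_kept_between[of snd fst p es q "(i, x)" "(k, x)"])
      have "(i, x) \<in> set V" "(k, x) \<in> set V" using that(1-3) by simp_all
      then have xz: "x \<in> set (B i)" "x \<in> set (B k)" "snd z \<in> set (B (fst z))"
        using that(4) unfolding sV by auto
      have "adj (snd z) x" using that(7)
        by (metis adj adj_sym xz)
      then show "m (snd z) (snd (i, x)) \<noteq> 2" "m (snd (k, x)) (snd z) \<noteq> 2"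
        using adj_noncomm adj_sym by auto
    qed (use that V(3) in auto)
    \<comment> \<open>All letters of the blocks \<open>Suc i\<close> and \<open>k - 1\<close> stay
      between the two occurrences of \<open>x\<close>. As only one letter is there, both blocks are
      this letter alone and coincide.\<close>
    have triple: "j = Suc i \<and> k = Suc (Suc i) \<and> B (Suc i) = [y]"
      if Vd: "V = p @ [(i, x), (j, y), (k, x)] @ q" for p i x j y k q
    proof -
      have ik: "Suc i < k" using ord[of p i x "[(j, y)]" k q] Vd by auto
      have kK: "k < K" using sV Vd by auto
      have yj: "z = y \<and> j = Suc i" if "z \<in> set (B (Suc i))" for z
        using between[OF Vd, of i x k "(Suc i, z)"] that ik kK sV by auto
      have "hd (B (Suc i)) \<in> set (B (Suc i))" using ne by simp
      then have "j = Suc i" "\<forall>z \<in> set (B (Suc i)). z = y" using yj by blast+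
      moreover define z where "z = hd (B (k - 1))"
      have z: "z \<in> set (B (k - 1))" unfolding z_def using ne by simp
      define k' where "k' = k - 1"
      then have k': "k' < K" "i < k'" "k' < k" "Suc k' = k" using ik kK by auto
      have "(k', z) = (j, y)"
        using between[OF Vd, of i x k "(k', z)"] z[folded k'_def] k' sV by auto
      moreover have "B (Suc i) = [y]"
        using calculation(2) ne[of "Suc i"] dist[of "Suc i"]
        by (cases "B (Suc i)" rule: list.exhaust; cases "tl (B (Suc i))") auto
      ultimately show ?thesis using k' by auto
    qed
    have vS: "v \<in> lists S" using comm_equiv_lists v lU by blast
    from b vS show False
    proof (cases rule: has_braidE)
      case (square p q s)
      then obtain p' i k q' where Vd: "V = p' @ [(i, s), (k, s)] @ q'"
        unfolding V(1) by (auto simp: map_eq_append_conv map_eq_Cons_conv)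
      have ik: "Suc i < k" using ord[of p' i s "[]" k q'] Vd by auto
      define z where "z = hd (B (Suc i))"
      have z: "z \<in> set (B (Suc i))" unfolding z_def using ne by simp
      have "k < K" using sV Vd by auto
      then show False using between[OF Vd, of i s k "(Suc i, z)"] z ik sV by auto
    next
      case (braid p q s t k)
      then obtain l where l: "k = Suc (Suc (Suc l))" by (metis Suc_le_D numeral_3_eq_3 Suc_le_mono)
      obtain p' i j k' R where Vd: "V = p' @ [(i, s), (j, t), (k', s)] @ R" "map snd R = alt l t s @ q"
      proof -
        define y where "y = alt l t s @ q"
        have "map snd V = p @ s # t # s # y" using braid(3) unfolding V(1) l y_def by simp
        then obtain p' R where "V = p' @ R" "map snd R = s # t # s # y"
          by (auto simp: map_eq_append_conv)
        then show ?thesis using that unfolding y_def[symmetric] by (auto simp: map_eq_Cons_conv)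
      qed
      note t = triple[OF Vd(1)]
      have B3: "s \<in> set (B i)" "s \<in> set (B (Suc (Suc i)))" using sV Vd t by auto
      have "4 \<le> m s t" using L3[of s i t] t B3 by blast
      \<comment> \<open>The label is at least 4, so the braid has a fourth letter. The second
        triple, starting at \<open>t\<close>, then makes three consecutive blocks violate
        \<open>L4\<close>.\<close>
      then obtain l' where l': "l = Suc l'" using braid(1) l by (cases l) (auto simp: numeral_eq_enat)
      then obtain n R' where R: "R = (n, t) # R'" using Vd(2) by (cases R) auto
      have "V = (p' @ [(i, s)]) @ [(j, t), (k', s), (n, t)] @ R'" using Vd R by simp
      from triple[OF this] have t2: "n = Suc (Suc j)" "B (Suc j) = [s]" by auto
      have "t \<in> set (B n)" using sV Vd R by auto
      then show False using L4[of s i t] t t2 B3 by auto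
    qed
  qed
  then show ?thesis using lU unfolding good_def mapU by blast
qed

text \<open>
  \<open>\<rho> i + 2\<close> bounds the length of a consecutive alternating factor that starts with the letter at
  position \<open>i\<close>, in any word commutation equivalent to the given one.
\<close>

lemma ranked_good:
  fixes f :: "nat \<Rightarrow> 'a" and \<rho> :: "nat \<Rightarrow> nat"
  assumes fS: "\<And>i. f i \<in> S"
    and gap: "\<And>i. i < N \<Longrightarrow>
      (\<exists>z1 z2. i < z1 \<and> z1 < z2 \<and> adj (f i) (f z1) \<and> adj (f i) (f z2) \<and> (\<forall>k \<in> {i<..z2}. f k \<noteq> f i)) \<or>
      (\<exists>d > i. adj (f i) (f d) \<and> (\<forall>k \<in> {i<..d}. f k \<noteq> f i) \<and> \<rho> d < \<rho> i \<and> enat (\<rho> i + 2) < m (f i) (f d))"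
  shows "good (map f [0..<N])"
proof -
  have lS: "map f [0..<N] \<in> lists S" using fS by (auto simp: in_lists_conv_set)
  have "\<not> has_braid v" if v: "comm_equiv m (map f [0..<N]) v" for v
  proof
    assume b: "has_braid v"
    obtain V where V: "v = map f V" "mset V = mset [0..<N]" "order_kept f id V"
      using comm_equiv_lift[OF v lS, of id] by auto
    have sV: "set V = {0..<N}" using V(2) by (metis set_mset_mset set_upt)
    have dV: "distinct V" using V(2) by (metis distinct_upt mset_eq_imp_distinct_iff)
    have lt: "i < k" if "V = p @ i # r @ k # q" "f i = f k" for p i r k q
    proof -
      have "m (f i) (f k) \<noteq> 2" using that(2) m_eq_1[OF fS fS, of k k] by auto
      moreover have "m (f i) (f k) \<noteq> 2 \<longrightarrow> i \<le> k"
        using V(3) unfolding that(1) order_kept_def by (simp add: sorted_wrt_append)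
      ultimately have "i \<le> k" by blast
      then show ?thesis using dV that by (cases "i = k") auto
    qed
    have between: "z \<in> set es"
      if "V = p @ es @ q" "i \<in> set es" "k \<in> set es" "f i = f k" "i < z" "z < k" "adj (f i) (f z)"
      for p es q i k z
    proof (rule order_kept_between[of f id p es q i k])
      show "m (f z) (f i) \<noteq> 2" "m (f k) (f z) \<noteq> 2"
        using that adj_noncomm adj_sym by metis+
      have "k < N" using sV that by auto
      then show "z \<in> set (p @ es @ q)" using that(6) unfolding that(1)[symmetric] sV by simp
    qed (use that V(3) in auto)
    have triple: "\<rho> j < \<rho> i \<and> enat (\<rho> i + 2) < m (f i) (f j)"
      if Vd: "V = p @ [i, j, k] @ q" "f i = f k" for p i j k q
    proof -
      have ik: "i < k" using lt[of p i "[j]" k q] Vd by auto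
      have "i < N" using sV Vd by auto
      from gap[OF this] show ?thesis
      proof (elim disjE exE conjE)
        fix z1 z2 assume z: "i < z1" "z1 < z2" "adj (f i) (f z1)" "adj (f i) (f z2)"
          "\<forall>k \<in> {i<..z2}. f k \<noteq> f i"
        then have "z2 < k" using ik Vd(2) by (metis greaterThanAtMost_iff not_le)
        then have "z1 \<in> set [i, j, k]" "z2 \<in> set [i, j, k]"
          using between[OF Vd(1), of i k z1] between[OF Vd(1), of i k z2] z Vd(2) by auto
        then have "z1 = j" "z2 = j" using z \<open>z2 < k\<close> by auto
        then show ?thesis using z by simp
      next
        fix d assume d: "i < d" "adj (f i) (f d)" "\<forall>k \<in> {i<..d}. f k \<noteq> f i" "\<rho> d < \<rho> i"
          "enat (\<rho> i + 2) < m (f i) (f d)"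
        then have "d < k" using ik Vd(2) by (metis greaterThanAtMost_iff not_le)
        then have "d \<in> set [i, j, k]" using between[OF Vd(1), of i k] d Vd(2) by auto
        then show ?thesis using d \<open>d < k\<close> by auto
      qed
    qed
    \<comment> \<open>Each letter of an alternating factor that is followed by two more has larger
      rank than its successor.\<close>
    have chain: "n \<le> \<rho> (hd es)"
      if "V = p @ es @ q" "map f es = alt (Suc (Suc n)) s t" for p es q n s t
      using that
    proof (induction n arbitrary: p es s t)
      case (Suc n)
      obtain i j k r where es: "es = i # j # k # r" "f i = s" "f k = s"
        using Suc.prems(2) by (auto simp: map_eq_Cons_conv)
      have "n \<le> \<rho> (hd (j # k # r))"
        using Suc.prems es by (intro Suc.IH[of "p @ [i]" _ t s]) auto
      moreover have "\<rho> j < \<rho> i" using triple[of p i j k "r @ q"] Suc.prems es by simp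
      ultimately show ?case using es by simp
    qed simp
    have vS: "v \<in> lists S" using comm_equiv_lists v lS by blast
    from b vS show False
    proof (cases rule: has_braidE)
      case (square p q s)
      then obtain p' i k q' where Vd: "V = p' @ [i, k] @ q'" "f i = s" "f k = s"
        unfolding V(1) by (auto simp: map_eq_append_conv map_eq_Cons_conv)
      have ik: "i < k" using lt[of p' i "[]" k q'] Vd by auto
      have "i < N" using sV Vd by auto
      have "\<exists>d > i. adj (f i) (f d) \<and> (\<forall>k \<in> {i<..d}. f k \<noteq> f i)"
        using gap[OF \<open>i < N\<close>] by (metis greaterThanAtMost_iff less_imp_le order_trans)
      then obtain d where d: "i < d" "adj (f i) (f d)" "\<forall>k \<in> {i<..d}. f k \<noteq> f i" by blast
      then have "d < k" using ik Vd by (metis greaterThanAtMost_iff not_le)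
      then have "d \<in> set [i, k]" using between[OF Vd(1), of i k d] d Vd by auto
      then show False using d \<open>d < k\<close> by auto
    next
      case (braid p q s t k)
      obtain l where l: "k = Suc (Suc (Suc l))" using braid(2) by (metis Suc_le_D numeral_3_eq_3 Suc_le_mono)
      obtain p' es q' where Vd: "V = p' @ es @ q'" "map f es = alt k s t"
        using braid(3) unfolding V(1) by (metis map_eq_append_conv)
      obtain i j k' r where es: "es = i # j # k' # r" "f i = s" "f j = t" "f k' = s"
        using Vd(2) unfolding l by (auto simp: map_eq_Cons_conv)
      have "Suc l \<le> \<rho> i" using chain[OF Vd(1), of "Suc l" s t] Vd(2) l es by simp
      moreover have "enat (\<rho> i + 2) < m s t" using triple[of p' i j k' "r @ q'"] Vd(1) es by simp
      ultimately show False using braid(1) l by simp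
    qed
  qed
  then show ?thesis using lS unfolding good_def by blast
qed

end

section \<open>Periodic words\<close>

lemma concat_replicate_Suc: "concat (replicate (Suc k) w) = concat (replicate k w) @ w"
  by (induction k) auto

lemma upt_mult_Suc: "[0..<Suc k * n] = [0..<k * n] @ [k * n..<Suc k * n]"
  using upt_add_eq_append[of 0 "k * n" n] by (simp add: add.commute)

lemma concat_replicate_nth:
  "concat (replicate k w) = map (\<lambda>i. w ! (i mod length w)) [0..<k * length w]"
proof (induction k)
  case (Suc k)
  have "map (\<lambda>i. w ! (i mod length w)) [k * length w..<Suc k * length w] = w"
    by (rule nth_equalityI) auto
  then show ?case unfolding concat_replicate_Suc upt_mult_Suc map_append Suc by simp
qed simp

lemma concat_replicate_periodic:
  assumes per: "\<And>i. B (i + N) = B i"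
  shows "concat (replicate k (concat (map B [0..<N]))) = concat (map B [0..<k * N])"
proof (induction k)
  case (Suc k)
  have p: "B (i + k * N) = B i" for i k
  proof (induction k)
    case (Suc k)
    then show ?case using per[of "i + k * N"] by (simp add: ac_simps)
  qed simp
  have "map B [k * N..<Suc k * N] = map B [0..<N]"
    by (rule nth_equalityI) (use p in \<open>auto simp: add.commute\<close>)
  then show ?case unfolding concat_replicate_Suc upt_mult_Suc map_append concat_append Suc by simp
qed simp

text \<open>
  The hypotheses of \<open>ranked_good\<close> for a periodic word.  In \<open>E\<close>, a triple \<open>(a, b, l)\<close> is an
  edge with label at least \<open>l\<close>.  The \<open>r\<close>-th entry \<open>(d, d', \<rho>)\<close> of \<open>D\<close> gives the offsets of two
  neighbours of the \<open>r\<close>-th letter before its next occurrence, or of a single one if \<open>d' = 0\<close>.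
\<close>

definition pattern_edge :: "(nat \<times> nat \<times> nat) list \<Rightarrow> nat \<Rightarrow> nat \<Rightarrow> nat \<Rightarrow> bool" where
  "pattern_edge E a b l \<longleftrightarrow> list_ex (\<lambda>(x, y, k). (x = a \<and> y = b \<or> x = b \<and> y = a) \<and> l \<le> k) E"

definition pattern_ok :: "(nat \<times> nat \<times> nat) list \<Rightarrow> nat list \<Rightarrow> (nat \<times> nat \<times> nat) list \<Rightarrow> bool" where
  "pattern_ok E w D \<longleftrightarrow> w \<noteq> [] \<and> list_all (\<lambda>r.
     let (d, d', \<rho>) = D ! r; x = (\<lambda>d. w ! ((r + d) mod length w)) in
     0 < d \<and> pattern_edge E (w ! r) (x d) 3 \<and>
     (if d' = 0
      then pattern_edge E (w ! r) (x d) (\<rho> + 3) \<and> list_all (\<lambda>d. x d \<noteq> w ! r) [1..<Suc d] \<and>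
        snd (snd (D ! ((r + d) mod length w))) < \<rho>
      else d < d' \<and> pattern_edge E (w ! r) (x d') 3 \<and> list_all (\<lambda>d. x d \<noteq> w ! r) [1..<Suc d']))
     [0..<length w]"

context coxeter_matrix
begin

lemma pattern_good:
  fixes g :: "nat \<Rightarrow> 'a"
  assumes ok: "pattern_ok E w D" and inj: "inj_on g (set w)"
    and E: "\<And>a b l. (a, b, l) \<in> set E \<Longrightarrow> adj (g a) (g b) \<and> enat l \<le> m (g a) (g b)"
  shows "good (concat (replicate k (map g w)))"
proof -
  let ?n = "length w"
  define f where "f i = g (w ! (i mod ?n))" for i
  define \<rho> where "\<rho> i = snd (snd (D ! (i mod ?n)))" for i
  have n: "?n > 0" using ok by (auto simp: pattern_ok_def)
  have inw: "w ! (i mod ?n) \<in> set w" for i using n by simp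
  have edge: "adj (g a) (g b) \<and> enat l \<le> m (g a) (g b)" if pe: "pattern_edge E a b l" for a b l
  proof -
    obtain e where e: "e \<in> set E" "case e of (x, y, k) \<Rightarrow> (x = a \<and> y = b \<or> x = b \<and> y = a) \<and> l \<le> k"
      using pe unfolding pattern_edge_def list_ex_iff by blast
    obtain x y k where "e = (x, y, k)" by (cases e)
    with e have xy: "(x, y, k) \<in> set E" "x = a \<and> y = b \<or> x = b \<and> y = a" "l \<le> k" by auto
    then have "adj (g x) (g y)" "enat k \<le> m (g x) (g y)" using E by auto
    then have "adj (g a) (g b)" "enat k \<le> m (g a) (g b)" using xy(2) adj_sym m_sym
      by (auto simp: adj_def)
    then show ?thesis using xy(3) by (meson enat_ord_simps(1) order_trans)
  qed
  have step: "(\<exists>z1 z2. i < z1 \<and> z1 < z2 \<and> adj (f i) (f z1) \<and> adj (f i) (f z2) \<and> (\<forall>k \<in> {i<..z2}. f k \<noteq> f i)) \<or>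
      (\<exists>d > i. adj (f i) (f d) \<and> (\<forall>k \<in> {i<..d}. f k \<noteq> f i) \<and> \<rho> d < \<rho> i \<and> enat (\<rho> i + 2) < m (f i) (f d))"
    for i
  proof -
    let ?r = "i mod ?n"
    obtain d d' \<rho>' where D: "D ! ?r = (d, d', \<rho>')" by (metis prod_cases3)
    define x where "x = (\<lambda>d. w ! ((?r + d) mod ?n))"
    have r: "0 < d" "pattern_edge E (w ! ?r) (x d) 3"
      "d' = 0 \<Longrightarrow> pattern_edge E (w ! ?r) (x d) (\<rho>' + 3) \<and> list_all (\<lambda>d. x d \<noteq> w ! ?r) [1..<Suc d] \<and>
        snd (snd (D ! ((?r + d) mod ?n))) < \<rho>'"
      "d' \<noteq> 0 \<Longrightarrow> d < d' \<and> pattern_edge E (w ! ?r) (x d') 3 \<and> list_all (\<lambda>d. x d \<noteq> w ! ?r) [1..<Suc d']"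
      using ok n D unfolding pattern_ok_def list_all_iff x_def
      by (auto simp: Let_def split: if_splits dest!: bspec[of _ _ ?r])
    have fx: "f (i + e) = g (x e)" for e unfolding f_def x_def by (simp add: mod_add_left_eq)
    have fi: "f i = g (w ! ?r)" unfolding f_def ..
    have neq: "f k \<noteq> f i" if "list_all (\<lambda>d. x d \<noteq> w ! ?r) [1..<Suc e]" "k \<in> {i<..i + e}" for e k
    proof -
      have "k - i \<in> set [1..<Suc e]" using that(2) by auto
      then have "x (k - i) \<noteq> w ! ?r" using that(1) unfolding list_all_iff by blast
      moreover have "x (k - i) \<in> set w" "w ! ?r \<in> set w" unfolding x_def using n by auto
      moreover have "f k = g (x (k - i))" using fx[of "k - i"] that by simp
      ultimately show ?thesis unfolding fi using inj by (auto dest: inj_onD)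
    qed
    show ?thesis
    proof (cases "d' = 0")
      case True
      have "adj (f i) (f (i + d))" using edge[OF r(2)] fx fi by simp
      moreover have "enat (\<rho> i + 2) < m (f i) (f (i + d))"
      proof -
        have "enat (\<rho>' + 3) \<le> m (f i) (f (i + d))" using edge r(3)[OF True] fx fi by auto
        moreover have "\<rho> i = \<rho>'" unfolding \<rho>_def D by simp
        ultimately show ?thesis by (cases "m (f i) (f (i + d))") auto
      qed
      moreover have "\<rho> (i + d) < \<rho> i" using r(3)[OF True] unfolding \<rho>_def D
        by (simp add: mod_add_left_eq)
      ultimately show ?thesis using r(1) r(3)[OF True] neq[of d]
        by (intro disjI2 exI[of _ "i + d"]) auto
    next
      case False
      then show ?thesis using r(1) r(4)[OF False] edge[OF r(2)] edge[of "w ! ?r" "x d'" 3] neq[of d'] fx fi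
        by (intro disjI1 exI[of _ "i + d"] exI[of _ "i + d'"]) auto
    qed
  qed
  have "f i \<in> S" for i using step[of i] by (auto simp: adj_def)
  then have "good (map f [0..<k * ?n])" using step by (intro ranked_good[of f _ \<rho>]) auto
  moreover have "map f [0..<k * ?n] = concat (replicate k (map g w))"
    unfolding concat_replicate_nth f_def using n by (auto intro!: map_cong)
  ultimately show ?thesis by simp
qed

end

section \<open>Coxeter graphs with infinitely many CFC elements\<close>

context coxeter_matrix
begin

text \<open>Non-backtracking walks. Only an immediate return is forbidden, so the condition can be
  checked locally; that vertices never repeat follows from the absence of cycles.\<close>

fun nb_walk :: "'a list \<Rightarrow> bool" where
  "nb_walk (x # y # z # r) \<longleftrightarrow> adj x y \<and> x \<noteq> z \<and> nb_walk (y # z # r)"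
| "nb_walk [x, y] \<longleftrightarrow> adj x y"
| "nb_walk [x] \<longleftrightarrow> True"
| "nb_walk [] \<longleftrightarrow> True"

lemma nb_walk_Cons: "nb_walk (x # xs) \<longleftrightarrow> nb_walk xs \<and> (xs \<noteq> [] \<longrightarrow> adj x (hd xs)) \<and> (tl xs \<noteq> [] \<longrightarrow> x \<noteq> hd (tl xs))"
  by (cases xs rule: nb_walk.cases) auto

lemma nb_walk_iff_nth:
  "nb_walk xs \<longleftrightarrow> (\<forall>i. Suc i < length xs \<longrightarrow> adj (xs ! i) (xs ! Suc i)) \<and>
    (\<forall>i. Suc (Suc i) < length xs \<longrightarrow> xs ! i \<noteq> xs ! Suc (Suc i))"
proof (induction xs rule: nb_walk.induct)
  case (1 x y z r)
  have all: "(\<forall>i. P i) \<longleftrightarrow> P 0 \<and> (\<forall>i. P (Suc i))" for P :: "nat \<Rightarrow> bool" by (metis not0_implies_Suc)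
  show ?case unfolding nb_walk.simps 1
    by (subst (3) all, subst (4) all) auto
qed auto

lemma nb_walk_append_snoc:
  assumes "nb_walk (xs @ [p, q])" "adj q r" "r \<noteq> p" shows "nb_walk (xs @ [p, q, r])"
  using assms
proof (induction xs)
  case (Cons x xs)
  then show ?case by (cases xs rule: nb_walk.cases) (auto simp: nb_walk_Cons)
qed (auto intro: adj_sym)

end

text \<open>The triangle wave: a point running from 0 to n + 1 and back, with period 2n + 2.\<close>

definition bounce :: "nat \<Rightarrow> nat \<Rightarrow> nat" where
  "bounce n i = (let j = i mod (2 * n + 2) in if j \<le> Suc n then j else 2 * n + 2 - j)"

lemma bounce_step:
  "bounce n (Suc i) = Suc (bounce n i) \<or> bounce n i = Suc (bounce n (Suc i))"
  "bounce n i \<le> Suc n"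
proof -
  define j where "j = i mod (2 * n + 2)"
  have j: "j < 2 * n + 2" unfolding j_def by simp
  have "Suc i mod (2 * n + 2) = (if Suc j = 2 * n + 2 then 0 else Suc j)"
    unfolding j_def by (rule mod_Suc)
  then show "bounce n (Suc i) = Suc (bounce n i) \<or> bounce n i = Suc (bounce n (Suc i))"
    unfolding bounce_def j_def[symmetric] using j by (auto simp: Let_def)
  show "bounce n i \<le> Suc n" unfolding bounce_def j_def[symmetric] using j by auto
qed

lemma bounce_turn:
  assumes turn: "bounce n (Suc (Suc i)) = bounce n i"
  shows "bounce n (Suc i) = 0 \<or> bounce n (Suc i) = Suc n"
proof -
  define j where "j = i mod (2 * n + 2)"
  define a where "a = Suc i mod (2 * n + 2)"
  define b where "b = Suc (Suc i) mod (2 * n + 2)"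
  have j: "j < 2 * n + 2" unfolding j_def by simp
  have a: "a = (if Suc j = 2 * n + 2 then 0 else Suc j)" unfolding a_def j_def by (rule mod_Suc)
  have b: "b = (if Suc a = 2 * n + 2 then 0 else Suc a)" unfolding a_def b_def by (rule mod_Suc)
  have t: "(if b \<le> Suc n then b else 2 * n + 2 - b) = (if j \<le> Suc n then j else 2 * n + 2 - j)"
    using turn unfolding bounce_def Let_def j_def b_def .
  have "a = 0 \<or> a = Suc n"
  proof (rule ccontr)
    assume "\<not> ?thesis"
    then have a': "a = Suc j" "j \<noteq> n" using a by (auto split: if_splits)
    then have jn: "Suc j < 2 * n + 2" using a j by (auto split: if_splits)
    show False
    proof (cases "j < n")
      case True
      then show False using b t a' by simp
    next
      case False
      then have "n < j" using a' by simp
      then show False using b t a' jn by (cases "Suc a = 2 * n + 2") (auto split: if_splits)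
    qed
  qed
  then show ?thesis unfolding bounce_def Let_def a_def by auto
qed

lemma bounce_periodic: "bounce n (i + (2 * n + 2)) = bounce n i"
  unfolding bounce_def by (metis mod_add_self2)

text \<open>CFC-finiteness in terms of words, so that the graph can be studied apart from the
  group.\<close>

locale cfc_finite_graph = coxeter_matrix +
  assumes no_infinite: "\<And>u. u \<noteq> [] \<Longrightarrow> (\<And>k. good (concat (replicate k u))) \<Longrightarrow> False"
begin

lemma no_layered:
  fixes B :: "nat \<Rightarrow> 'a list"
  assumes "\<And>i. B i \<noteq> []" "\<And>i. distinct (B i)"
    and "\<And>i x y. x \<in> set (B i) \<Longrightarrow> y \<in> set (B (Suc i)) \<Longrightarrow> adj x y"
    and "\<And>i x y. x \<in> set (B i) \<Longrightarrow> B (Suc i) = [y] \<Longrightarrow> x \<in> set (B (Suc (Suc i))) \<Longrightarrow> 4 \<le> m x y"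
    and "\<And>i x y. x \<in> set (B i) \<Longrightarrow> B (Suc i) = [y] \<Longrightarrow> B (Suc (Suc i)) = [x]
      \<Longrightarrow> y \<notin> set (B (Suc (Suc (Suc i))))"
    and "\<And>i. B (i + N) = B i" "N > 0"
  shows False
proof (rule no_infinite)
  have "[0..<N] \<noteq> []" using assms(7) by simp
  then show "concat (map B [0..<N]) \<noteq> []" using assms(1,7) by (auto simp: Suc_le_eq intro!: bexI[of _ 0])
  show "good (concat (replicate k (concat (map B [0..<N]))))" for k
    unfolding concat_replicate_periodic[of B, OF assms(6)]
    by (rule layered_good) (fact assms(1-5))+
qed

text \<open>Run around the cycle forever. Letters two steps apart differ, so no alternating factor
  of three letters can arise.\<close>

lemma no_cycle:
  assumes dist: "distinct xs" and len: "length xs \<ge> 3"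
    and adj: "\<And>i. Suc i < length xs \<Longrightarrow> adj (xs ! i) (xs ! Suc i)"
    and last: "adj (xs ! (length xs - 1)) (xs ! 0)"
  shows False
proof -
  let ?n = "length xs"
  define B where "B i = [xs ! (i mod ?n)]" for i
  have lt: "i mod ?n < ?n" for i using len by (intro mod_less_divisor) auto
  have step: "Suc i mod ?n = (if Suc (i mod ?n) = ?n then 0 else Suc (i mod ?n))" for i
    by (rule mod_Suc)
  have two: "Suc (Suc i) mod ?n \<noteq> i mod ?n" for i
    unfolding step[of "Suc i"] step[of i] using len lt[of i] by auto
  have two': "xs ! (Suc (Suc i) mod ?n) \<noteq> xs ! (i mod ?n)" for i
    using two lt dist by (metis nth_eq_iff_index_eq)
  show False
  proof (rule no_layered[of B ?n])
    fix i x y assume "x \<in> set (B i)" "y \<in> set (B (Suc i))"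
    then have "x = xs ! (i mod ?n)" "y = xs ! (if Suc (i mod ?n) = ?n then 0 else Suc (i mod ?n))"
      unfolding B_def step by auto
    moreover have "i mod ?n = ?n - 1" if "Suc (i mod ?n) = ?n" using that by simp
    ultimately show "adj x y" using adj[of "i mod ?n"] last lt[of i] by (auto split: if_splits)
  qed (use len two' two'[symmetric] in \<open>auto simp: B_def\<close>)
qed

text \<open>A repetition at minimal distance along the walk would close a cycle; distances 1 and 2
  are excluded by adjacency and by the ban on immediate returns.\<close>

lemma nb_walk_distinct:
  assumes "nb_walk xs" shows "distinct xs"
proof (rule ccontr)
  assume "\<not> distinct xs"
  define P where "P l \<longleftrightarrow> l > 0 \<and> (\<exists>i. i + l < length xs \<and> xs ! i = xs ! (i + l))" for l
  have "\<exists>l. P l"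
  proof -
    obtain i j where "i < length xs" "j < length xs" "i \<noteq> j" "xs ! i = xs ! j"
      using \<open>\<not> distinct xs\<close> unfolding distinct_conv_nth by blast
    then show ?thesis
    proof (induction i j rule: linorder_wlog)
      case (le i j)
      then have "P (j - i)" unfolding P_def by (auto intro!: exI[of _ i])
      then show ?case ..
    qed (metis)
  qed
  define l where "l = (LEAST l. P l)"
  have "P l" unfolding l_def using \<open>\<exists>l. P l\<close> by (rule LeastI_ex)
  then obtain i where i: "i + l < length xs" "xs ! i = xs ! (i + l)" "l > 0" unfolding P_def by blast
  have min: "\<not> P k" if "k < l" for k using that not_less_Least unfolding l_def by blast
  have a: "adj (xs ! k) (xs ! Suc k)" if "Suc k < length xs" for k using assms that nb_walk_iff_nth by blast
  have "l \<noteq> 1" using a[of i] i adj_irrefl by (metis Suc_eq_plus1)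
  moreover have "l \<noteq> 2" using i assms unfolding nb_walk_iff_nth by (metis add_2_eq_Suc')
  ultimately have l3: "l \<ge> 3" using i by simp
  let ?ys = "take l (drop i xs)"
  have len: "length ?ys = l" using i by simp
  have nth: "?ys ! k = xs ! (i + k)" if "k < l" for k using that i by simp
  show False
  proof (rule no_cycle[of ?ys])
    show "distinct ?ys"
    proof (rule ccontr)
      assume "\<not> distinct ?ys"
      then obtain j k where jk: "j < l" "k < l" "j \<noteq> k" "xs ! (i + j) = xs ! (i + k)"
        unfolding distinct_conv_nth len using nth by metis
      then show False
      proof (induction j k rule: linorder_wlog)
        case (le j k)
        then have "P (k - j)" unfolding P_def using i by (auto intro!: exI[of _ "i + j"])
        then show ?case using min[of "k - j"] le by simp
      qed metis
    qed
    show "adj (?ys ! j) (?ys ! Suc j)" if "Suc j < length ?ys" for j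
      using that len nth[of j] nth[of "Suc j"] a[of "i + j"] i by simp
    have "Suc (i + (l - 1)) = i + l" using i by simp
    then show "adj (?ys ! (length ?ys - 1)) (?ys ! 0)"
      using len nth[of "l - 1"] nth[of 0] a[of "i + (l - 1)"] i by simp
    show "3 \<le> length ?ys" using len l3 by simp
  qed
qed

text \<open>
  The word \<open>E cs F (rev cs)\<close> walks back and forth along \<open>cs\<close>, and at the turning points a braid is
  prevented by a large label or by a second neighbour.
\<close>

lemma no_zigzag:
  assumes cs: "cs \<noteq> []"
    and walk: "\<And>a e. a \<in> set E \<Longrightarrow> e \<in> set F \<Longrightarrow> nb_walk (a # cs @ [e])"
    and E: "E \<noteq> []" "distinct E" "\<And>y. E = [y] \<Longrightarrow> 4 \<le> m (hd cs) y"
    and F: "F \<noteq> []" "distinct F" "\<And>y. F = [y] \<Longrightarrow> 4 \<le> m (last cs) y"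
  shows False
proof -
  let ?n = "length cs"
  \<comment> \<open>Positions 0 and n + 1 carry the whole ends \<open>E\<close> and
    \<open>F\<close>, so that a turn passes all letters of an end at once.\<close>
  define C where "C k = (if k = 0 then E else if k = Suc ?n then F else [cs ! (k - 1)])" for k
  have n: "?n > 0" using cs by simp
  have nthC: "x = (a # cs @ [e]) ! k"
    if "x \<in> set (C k)" "k \<le> Suc ?n" "k = 0 \<Longrightarrow> x = a" "k = Suc ?n \<Longrightarrow> x = e" for x k a e
    using that unfolding C_def by (cases k) (auto simp: nth_append split: if_splits)
  have w: "\<exists>a \<in> set E. \<exists>e \<in> set F. (k = 0 \<longrightarrow> x = a) \<and> (l = Suc ?n \<longrightarrow> y = e)"
    if xy: "x \<in> set (C k)" "y \<in> set (C l)" for x y k l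
  proof -
    obtain a e where "a \<in> set E" "e \<in> set F" using E(1) F(1) by (meson last_in_set)
    then show ?thesis using xy unfolding C_def by (cases "k = 0"; cases "l = Suc ?n") auto
  qed
  have adjC: "adj x y" if xy: "x \<in> set (C k)" "y \<in> set (C (Suc k))" "k \<le> ?n" for x y k
  proof -
    obtain a e where ae: "a \<in> set E" "e \<in> set F" "k = 0 \<longrightarrow> x = a" "Suc k = Suc ?n \<longrightarrow> y = e"
      using w[OF xy(1,2)] by blast
    have "x = (a # cs @ [e]) ! k" using nthC[OF xy(1)] ae xy(3) by auto
    moreover have "y = (a # cs @ [e]) ! Suc k" using nthC[OF xy(2)] ae xy(3) by auto
    ultimately show ?thesis using walk[OF ae(1,2)] xy(3) unfolding nb_walk_iff_nth by auto
  qed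
  have disjC: "x \<noteq> y" if xy: "x \<in> set (C k)" "y \<in> set (C (Suc (Suc k)))" "Suc k \<le> ?n" for x y k
  proof -
    obtain a e where ae: "a \<in> set E" "e \<in> set F" "k = 0 \<longrightarrow> x = a" "Suc (Suc k) = Suc ?n \<longrightarrow> y = e"
      using w[OF xy(1,2)] by blast
    have "x = (a # cs @ [e]) ! k" using nthC[OF xy(1)] ae xy(3) by auto
    moreover have "y = (a # cs @ [e]) ! Suc (Suc k)" using nthC[OF xy(2)] ae xy(3) by auto
    ultimately show ?thesis using walk[OF ae(1,2)] xy(3) unfolding nb_walk_iff_nth
      by (metis Suc_le_lessD length_Cons length_append_singleton less_Suc_eq_le not_less_eq)
  qed
  define B where "B i = C (bounce ?n i)" for i
  have turn: "bounce ?n (Suc (Suc i)) = bounce ?n i" if x: "x \<in> set (B i)" "x \<in> set (B (Suc (Suc i)))" for x i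
  proof (rule ccontr)
    assume "bounce ?n (Suc (Suc i)) \<noteq> bounce ?n i"
    then have "bounce ?n (Suc (Suc i)) = Suc (Suc (bounce ?n i)) \<or> bounce ?n i = Suc (Suc (bounce ?n (Suc (Suc i))))"
      using bounce_step(1)[of ?n i] bounce_step(1)[of ?n "Suc i"] by linarith
    then show False using x disjC[of x "bounce ?n i" x] disjC[of x "bounce ?n (Suc (Suc i))" x]
        bounce_step(2)[of ?n i] bounce_step(2)[of ?n "Suc (Suc i)"] unfolding B_def by auto
  qed
  show False
  proof (rule no_layered[of B "2 * ?n + 2"])
    show "B i \<noteq> []" "distinct (B i)" for i unfolding B_def C_def using E F by auto
    show "B (i + (2 * ?n + 2)) = B i" for i unfolding B_def bounce_periodic ..
    show "adj x y" if "x \<in> set (B i)" "y \<in> set (B (Suc i))" for i x y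
      using that bounce_step(1)[of ?n i] bounce_step(2)[of ?n i] bounce_step(2)[of ?n "Suc i"]
        adjC[of x "bounce ?n i" y] adjC[of y "bounce ?n (Suc i)" x] adj_sym unfolding B_def by auto
    show "4 \<le> m x y" if x: "x \<in> set (B i)" "B (Suc i) = [y]" "x \<in> set (B (Suc (Suc i)))" for i x y
    proof -
      from bounce_turn[OF turn[OF x(1,3)]] show ?thesis
      proof
        assume b: "bounce ?n (Suc i) = 0"
        then have "bounce ?n i = 1" using bounce_step(1)[of ?n i] by simp
        then have "x = hd cs" using x(1) n unfolding B_def C_def by (auto simp: hd_conv_nth)
        then show ?thesis using E(3) x(2) b unfolding B_def C_def by simp
      next
        assume b: "bounce ?n (Suc i) = Suc ?n"
        then have "bounce ?n i = ?n"
          using bounce_step(1)[of ?n i] bounce_step(2)[of ?n i] by simp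
        then have "x = last cs" using x(1) n unfolding B_def C_def by (auto simp: last_conv_nth)
        then show ?thesis using F(3) x(2) b unfolding B_def C_def by simp
      qed
    qed
    \<comment> \<open>Four alternating letters would mean turning at two successive times, but the
      turning points are n + 1 > 1 steps apart.\<close>
    show "y \<notin> set (B (Suc (Suc (Suc i))))" if x: "x \<in> set (B i)" "B (Suc i) = [y]" "B (Suc (Suc i)) = [x]" for i x y
    proof
      assume y: "y \<in> set (B (Suc (Suc (Suc i))))"
      have "bounce ?n (Suc i) = 0 \<or> bounce ?n (Suc i) = Suc ?n"
        using bounce_turn[OF turn[of x i]] x by auto
      moreover have "bounce ?n (Suc (Suc i)) = 0 \<or> bounce ?n (Suc (Suc i)) = Suc ?n"
        using bounce_turn[OF turn[of y "Suc i"]] x y by auto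
      ultimately show False using bounce_step(1)[of ?n "Suc i"] n by auto
    qed
  qed simp
qed

lemma label_finite:
  assumes "adj s t" shows "m s t \<noteq> \<infinity>"
proof
  assume inf: "m s t = \<infinity>"
  define f where "f i = (if even i then s else t)" for i :: nat
  have fS: "f i \<in> S" for i using assms unfolding f_def adj_def by auto
  have fn: "[s, t] ! (i mod 2) = f i" for i
    unfolding f_def by (cases "even i") (auto simp: odd_iff_mod_2_eq_one)
  have step: "adj (f i) (f (Suc i)) \<and> m (f i) (f (Suc i)) = \<infinity>" for i
    using assms adj_sym inf m_sym[of s t] unfolding f_def adj_def by auto
  show False
  proof (rule no_infinite[of "[s, t]"])
    fix k
    have "good (map f [0..<k * 2])"
    \<comment> \<open>The rank counts the letters left. It is not periodic, which is harmless
      because an infinite label exceeds every rank.\<close>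
    proof (rule ranked_good[of f _ "\<lambda>i. k * 2 - i"])
      fix i assume "i < k * 2"
      moreover have "f (Suc i) \<noteq> f i" using step[of i] adj_neq by metis
      moreover from this have "\<forall>j \<in> {i<..Suc i}. f j \<noteq> f i" by (auto simp: le_Suc_eq)
      ultimately have "\<exists>d > i. adj (f i) (f d) \<and> (\<forall>k \<in> {i<..d}. f k \<noteq> f i) \<and> k * 2 - d < k * 2 - i \<and>
        enat (k * 2 - i + 2) < m (f i) (f d)"
        using step[of i] by (intro exI[of _ "Suc i"]) auto
      then show "(\<exists>z1 z2. i < z1 \<and> z1 < z2 \<and> adj (f i) (f z1) \<and> adj (f i) (f z2) \<and> (\<forall>k \<in> {i<..z2}. f k \<noteq> f i)) \<or>
        (\<exists>d > i. adj (f i) (f d) \<and> (\<forall>k \<in> {i<..d}. f k \<noteq> f i) \<and> k * 2 - d < k * 2 - i \<and>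
        enat (k * 2 - i + 2) < m (f i) (f d))" ..
    qed (rule fS)
    then show "good (concat (replicate k [s, t]))"
      unfolding concat_replicate_nth by (simp add: fn numeral_2_eq_2[symmetric])
  qed simp
qed

lemma no_pattern:
  assumes "pattern_ok E w D" and "distinct xs" "set w \<subseteq> {..<length xs}"
    and "\<And>a b l. (a, b, l) \<in> set E \<Longrightarrow> adj (xs ! a) (xs ! b) \<and> enat l \<le> m (xs ! a) (xs ! b)"
  shows False
proof (rule no_infinite[of "map (nth xs) w"])
  show "map (nth xs) w \<noteq> []" using assms(1) by (auto simp: pattern_ok_def)
  have "inj_on (nth xs) (set w)"
    using assms(2,3) by (auto simp: inj_on_def nth_eq_iff_index_eq subset_iff)
  then show "good (concat (replicate k (map (nth xs) w)))" for k
    by (intro pattern_good[OF assms(1)]) (use assms(4) in auto)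
qed

text \<open>
  In the following lemmas the periodic word is coded by positions in the list of the vertices; the
  first one is \<open>x1 y3 y1 x1 x2 y2 y1 x1 x3 y1 x2 y2\<close>.
\<close>

lemma no_4_in_path6:
  assumes w: "nb_walk [x3, x2, x1, y1, y2, y3]" and l: "4 \<le> m x1 y1" shows False
proof -
  \<comment> \<open>Both \<open>x1\<close> and \<open>y1\<close> have just one gap per period that
    contains a single neighbour, namely at the entries of rank 1. Alternating factors thus have at
    most three letters, which label 4 permits.\<close>
  have "pattern_ok [(0, 1, 3), (1, 2, 3), (2, 3, 4), (3, 4, 3), (4, 5, 3)]
    [2, 5, 3, 2, 1, 4, 3, 2, 0, 3, 1, 4]
    [(2, 0, 1), (4, 10, 0), (1, 3, 0), (1, 3, 0), (3, 4, 0), (1, 4, 0), (1, 0, 1), (2, 3, 0),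
        (2, 8, 0), (2, 3, 0), (2, 5, 0), (2, 3, 0)]" by code_simp
  moreover have "distinct [x3, x2, x1, y1, y2, y3]" using w by (rule nb_walk_distinct)
  ultimately show False by (rule no_pattern) (use w l in \<open>auto simp: adj_3 numeral_eq_enat\<close>)
qed

text \<open>The word is x1 y1 x1 y1 x2 y2. Its largest rank is 2, so alternating factors have at
  most four letters.\<close>

lemma no_5_in_path4:
  assumes w: "nb_walk [x2, x1, y1, y2]" and l: "5 \<le> m x1 y1" shows False
proof -
  have "pattern_ok [(0, 1, 3), (1, 2, 5), (2, 3, 3)]
    [1, 2, 1, 2, 0, 3]
    [(1, 0, 2), (1, 0, 1), (1, 2, 0), (2, 3, 0), (2, 4, 0), (2, 4, 0)]" by code_simp
  moreover have "distinct [x2, x1, y1, y2]" using w by (rule nb_walk_distinct)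
  ultimately show False by (rule no_pattern) (use w l in \<open>auto simp: adj_3 numeral_eq_enat\<close>)
qed

text \<open>The word is a b a b c. Moving c past the next a yields a b a b a, and the largest rank 3
  shows that five letters are the maximum.\<close>

lemma no_6_in_path3:
  assumes w: "nb_walk [a, b, c]" and l: "6 \<le> m a b" shows False
proof -
  have "pattern_ok [(0, 1, 6), (1, 2, 3)]
    [0, 1, 0, 1, 2]
    [(1, 0, 3), (1, 0, 2), (1, 0, 1), (1, 2, 0), (2, 4, 0)]" by code_simp
  moreover have "distinct [a, b, c]" using w by (rule nb_walk_distinct)
  ultimately show False by (rule no_pattern) (use w l in \<open>auto simp: adj_3 numeral_eq_enat\<close>)
qed

text \<open>The graph of affine E6. The letters occur 3, 2 and 1 times from \<open>c\<close>
  outwards, as in the null root: the neighbours of each vertex occur twice as often as the vertex,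
  which leaves exactly two for every gap.\<close>

lemma no_tripod_222:
  assumes w: "nb_walk [x2, x1, c, y1, y2]" "nb_walk [x2, x1, c, z1, z2]" "nb_walk [y2, y1, c, z1, z2]" shows False
proof -
  have "pattern_ok [(0, 1, 3), (0, 3, 3), (0, 5, 3), (1, 2, 3), (3, 4, 3), (5, 6, 3)]
    [0, 3, 5, 6, 0, 1, 5, 2, 0, 1, 3, 4]
    [(1, 2, 0), (3, 7, 0), (1, 2, 0), (3, 11, 0), (1, 2, 0), (2, 3, 0), (2, 6, 0), (2, 10, 0),
        (1, 2, 0), (3, 7, 0), (1, 2, 0), (2, 11, 0)]" by code_simp
  moreover have "distinct [c, x1, x2, y1, y2, z1, z2]" using w[THEN nb_walk_distinct] by auto
  ultimately show False by (rule no_pattern) (use w adj_sym in \<open>auto simp: adj_3\<close>)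
qed

text \<open>The graph of affine E7, again with the multiplicities of the null root: 4 for
  \<open>c\<close>, 2 on the short arm, and 3, 2, 1 on each long arm.\<close>

lemma no_tripod_133:
  assumes w: "nb_walk [x1, c, y1, y2, y3]" "nb_walk [x1, c, z1, z2, z3]" "nb_walk [y3, y2, y1, c, z1, z2, z3]" shows False
proof -
  have "pattern_ok [(0, 1, 3), (0, 2, 3), (0, 5, 3), (2, 3, 3), (3, 4, 3), (5, 6, 3), (6, 7, 3)]
    [0, 1, 4, 2, 3, 0, 2, 5, 6, 0, 1, 7, 5, 6, 0, 2, 5, 3]
    [(1, 3, 0), (4, 8, 0), (2, 15, 0), (1, 2, 0), (2, 11, 0), (1, 2, 0), (3, 8, 0), (1, 2, 0),
        (3, 4, 0), (1, 3, 0), (4, 8, 0), (2, 15, 0), (1, 2, 0), (3, 12, 0), (1, 2, 0), (2, 3, 0),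
        (2, 7, 0), (3, 4, 0)]" by code_simp
  moreover have "distinct [c, x1, y1, y2, y3, z1, z2, z3]" using w[THEN nb_walk_distinct] by auto
  ultimately show False by (rule no_pattern) (use w adj_sym in \<open>auto simp: adj_3\<close>)
qed

end

section \<open>Gaps in a cyclic word\<close>

lemma comm_equiv_commute_back:
  assumes "\<And>y. y \<in> set v \<Longrightarrow> m y x = 2"
  shows "comm_equiv m (p @ v @ x # q) (p @ x # v @ q)"
  using assms
proof (induction v arbitrary: q rule: rev_induct)
  case (snoc y v)
  have "comm_equiv m ((p @ v) @ y # x # q) ((p @ v) @ x # y # q)"
    using snoc.prems by (intro comm_equiv_swap) auto
  moreover have "comm_equiv m (p @ v @ x # (y # q)) (p @ x # v @ (y # q))"
    using snoc.prems by (intro snoc.IH) auto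
  ultimately show ?case using comm_equiv_trans by fastforce
qed simp

context coxeter_matrix
begin

lemma not_good_square:
  assumes "good (s # v @ [s])" "\<And>y. y \<in> set v \<Longrightarrow> m s y = 2" shows False
proof -
  have "comm_equiv m ([] @ s # v @ [s]) ([] @ v @ s # [s])"
    using assms(2) by (rule comm_equiv_commute_past)
  moreover have "has_braid ([] @ v @ s # [s])" unfolding has_braid_def
    by (intro disjI1 exI[of _ v] exI[of _ "[]"] exI[of _ s]) simp
  ultimately show False using assms(1) unfolding good_def by auto
qed

lemma has_braid_alt: "m s t = enat k \<Longrightarrow> 3 \<le> k \<Longrightarrow> has_braid (p @ alt k s t @ q)"
  unfolding has_braid_def by blast

lemma not_good_braid3:
  assumes g: "good (s # v1 @ t # v2 @ [s])" and m: "m s t = 3"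
    and c: "\<And>y. y \<in> set (v1 @ v2) \<Longrightarrow> m s y = 2 \<and> m y s = 2"
  shows False
proof -
  have "comm_equiv m ([] @ s # v1 @ (t # v2 @ [s])) ([] @ v1 @ s # (t # v2 @ [s]))"
    using c by (intro comm_equiv_commute_past) auto
  moreover have "comm_equiv m ((v1 @ [s, t]) @ v2 @ s # []) ((v1 @ [s, t]) @ s # v2 @ [])"
    using c by (intro comm_equiv_commute_back) auto
  ultimately have "comm_equiv m (s # v1 @ t # v2 @ [s]) (v1 @ alt 3 s t @ v2)"
    using comm_equiv_trans by (fastforce simp: numeral_3_eq_3)
  moreover have "has_braid (v1 @ alt 3 s t @ v2)"
    using m by (intro has_braid_alt) (auto simp: numeral_eq_enat)
  ultimately show False using g unfolding good_def by blast
qed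

text \<open>The first \<open>a\<close> crosses only \<open>v1\<close>, the second crosses
  \<open>v2\<close> backwards, and the last \<open>b\<close> crosses \<open>v3\<close> and
  \<open>v2\<close>. So only the middle part has to commute with both letters.\<close>

lemma not_good_braid4:
  assumes g: "good (a # v1 @ b # v2 @ a # v3 @ [b])" and m: "m a b = 4"
    and ca: "\<And>y. y \<in> set (v1 @ v2) \<Longrightarrow> m a y = 2 \<and> m y a = 2"
    and cb: "\<And>y. y \<in> set (v2 @ v3) \<Longrightarrow> m b y = 2 \<and> m y b = 2"
  shows False
proof -
  have 1: "comm_equiv m ([] @ a # v1 @ (b # v2 @ a # v3 @ [b])) ([] @ v1 @ a # (b # v2 @ a # v3 @ [b]))"
    using ca by (intro comm_equiv_commute_past) auto
  have 2: "comm_equiv m ((v1 @ [a, b]) @ v2 @ a # (v3 @ [b])) ((v1 @ [a, b]) @ a # v2 @ (v3 @ [b]))"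
    using ca by (intro comm_equiv_commute_back) auto
  have 3: "comm_equiv m ((v1 @ [a, b, a]) @ (v2 @ v3) @ b # []) ((v1 @ [a, b, a]) @ b # (v2 @ v3) @ [])"
    using cb by (intro comm_equiv_commute_back) auto
  have "comm_equiv m (a # v1 @ b # v2 @ a # v3 @ [b]) (v1 @ [a, b, a, b] @ v2 @ v3)"
    using comm_equiv_trans[OF comm_equiv_trans[OF 1[simplified] 2[simplified]] 3[simplified]] by simp
  moreover have "has_braid (v1 @ alt 4 a b @ (v2 @ v3))"
    using m by (intro has_braid_alt) (auto simp: numeral_eq_enat)
  ultimately show False using g unfolding good_def by (simp add: eval_nat_numeral)
qed

lemma not_good_braid5:
  assumes g: "good (a # v1 @ b # v2 @ a # v3 @ b # v4 @ [a])" and m: "m a b = 5"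
    and ca: "\<And>y. y \<in> set (v1 @ v2 @ v3 @ v4) \<Longrightarrow> m a y = 2 \<and> m y a = 2"
    and cb: "\<And>y. y \<in> set (v2 @ v3) \<Longrightarrow> m b y = 2 \<and> m y b = 2"
  shows False
proof -
  have 1: "comm_equiv m ([] @ a # v1 @ (b # v2 @ a # v3 @ b # v4 @ [a])) ([] @ v1 @ a # (b # v2 @ a # v3 @ b # v4 @ [a]))"
    using ca by (intro comm_equiv_commute_past) auto
  have 2: "comm_equiv m ((v1 @ [a, b]) @ v2 @ a # (v3 @ b # v4 @ [a])) ((v1 @ [a, b]) @ a # v2 @ (v3 @ b # v4 @ [a]))"
    using ca by (intro comm_equiv_commute_back) auto
  have 3: "comm_equiv m ((v1 @ [a, b, a]) @ (v2 @ v3) @ b # (v4 @ [a])) ((v1 @ [a, b, a]) @ b # (v2 @ v3) @ (v4 @ [a]))"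
    using cb by (intro comm_equiv_commute_back) auto
  have 4: "comm_equiv m ((v1 @ [a, b, a, b]) @ (v2 @ v3 @ v4) @ a # []) ((v1 @ [a, b, a, b]) @ a # (v2 @ v3 @ v4) @ [])"
    using ca by (intro comm_equiv_commute_back) auto
  have "comm_equiv m (a # v1 @ b # v2 @ a # v3 @ b # v4 @ [a]) (v1 @ [a, b, a, b, a] @ v2 @ v3 @ v4)"
    using comm_equiv_trans[OF comm_equiv_trans[OF comm_equiv_trans[OF 1[simplified] 2[simplified]] 3[simplified]] 4[simplified]]
    by simp
  moreover have "has_braid (v1 @ alt 5 a b @ (v2 @ v3 @ v4))"
    using m by (intro has_braid_alt) (auto simp: numeral_eq_enat)
  ultimately show False using g unfolding good_def by (simp add: eval_nat_numeral)
qed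

lemma label_3_or_ge_4: "adj s t \<Longrightarrow> m s t = 3 \<or> 4 \<le> m s t"
  by (cases "m s t") (auto simp: adj_def numeral_eq_enat)

end

text \<open>The word is repeated along all integers, so gaps across its end need no special
  treatment. The windows of length \<open>n\<close> are its cyclic shifts.\<close>

locale cyclic_word = cfc_finite_graph +
  fixes f :: "int \<Rightarrow> 'a" and n :: nat
  assumes period: "\<And>i. f (i + int n) = f i"
    and window: "\<And>i. good (map f [i..i + int n - 1])"
    and n_pos: "n > 0"
    and connected: "\<And>s t. s \<in> S \<Longrightarrow> t \<in> S \<Longrightarrow> adj\<^sup>*\<^sup>* s t"
begin

lemma period': "f (i - int n) = f i"
  using period[of "i - int n"] by simp

lemma f_in_S: "f i \<in> S"
proof -
  have "i \<in> set [i..i + int n - 1]" using n_pos by simp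
  then show ?thesis using good_lists[OF window[of i]] by (auto simp: in_lists_conv_set)
qed

lemma window_good: "j < i + int n \<Longrightarrow> good (map f [i..j])"
proof (cases "i \<le> j")
  case True
  assume "j < i + int n"
  then have "[i..i + int n - 1] = [] @ [i..j] @ [j + 1..i + int n - 1]"
    using True upto_split1[of i "j + 1" "i + int n - 1"] upto_split2[of i j "i + int n - 1"] by simp
  then have "map f [i..i + int n - 1] = [] @ map f [i..j] @ map f [j + 1..i + int n - 1]" by simp
  then show ?thesis using window[of i] good_factor by metis
next
  case False
  then show ?thesis using good_factor[of "[]" "[]"] window[of i] by simp
qed

lemma f_commutes: "f k \<noteq> s \<Longrightarrow> \<not> adj s (f k) \<Longrightarrow> s \<in> S \<Longrightarrow> m s (f k) = 2 \<and> m (f k) s = 2"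
  using m_cases[OF _ f_in_S, of s k] m_sym[OF _ f_in_S, of s k] by auto

definition consec :: "'a \<Rightarrow> int \<Rightarrow> int \<Rightarrow> bool" where
  "consec s i j \<longleftrightarrow> i < j \<and> f i = s \<and> f j = s \<and> (\<forall>k. i < k \<and> k < j \<longrightarrow> f k \<noteq> s)"

text \<open>The occurrences must lie within one period, because every letter that occurs at all
  recurs after \<open>n\<close> steps.\<close>

definition multi :: "'a \<Rightarrow> bool" where
  "multi s \<longleftrightarrow> (\<exists>i j. i < j \<and> j < i + int n \<and> f i = s \<and> f j = s)"

definition tri :: "'a \<Rightarrow> bool" where
  "tri s \<longleftrightarrow> (\<exists>i j k. i < j \<and> j < k \<and> k < i + int n \<and> f i = s \<and> f j = s \<and> f k = s)"

lemma tri_multi: "tri s \<Longrightarrow> multi s"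
proof -
  assume "tri s"
  then obtain i j k where "i < j" "j < k" "k < i + int n" "f i = s" "f j = s" unfolding tri_def by blast
  moreover from this have "j < i + int n" by simp
  ultimately show ?thesis unfolding multi_def by blast
qed

lemma split_at: "i \<le> k \<Longrightarrow> k \<le> j \<Longrightarrow> map f [i..j] = map f [i..k - 1] @ f k # map f [k + 1..j]"
  using upto_split3[of i k j] by simp

lemma window_ends: "i < j \<Longrightarrow> map f [i..j] = f i # map f [i + 1..j - 1] @ [f j]"
  using upto_rec1[of i j] upto_rec2[of "i + 1" j] by simp

text \<open>Without a neighbour in the gap the two equal letters can be brought together; with a
  single neighbour of label 3 everything else can be moved out of the braid.\<close>

lemma gap_rule:
  assumes c: "consec s i j" and j: "j < i + int n"
  shows "\<exists>k. i < k \<and> k < j \<and> adj s (f k) \<and> (4 \<le> m s (f k) \<or> (\<exists>l. l \<noteq> k \<and> i < l \<and> l < j \<and> adj s (f l)))"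
proof -
  have ij: "i < j" "f i = s" "f j = s" "\<And>k. i < k \<Longrightarrow> k < j \<Longrightarrow> f k \<noteq> s" using c by (auto simp: consec_def)
  have sS: "s \<in> S" using f_in_S ij by metis
  have g: "good (s # map f [i + 1..j - 1] @ [s])"
    using window_good[OF j] window_ends[OF ij(1)] ij by simp
  have "\<exists>k. i < k \<and> k < j \<and> adj s (f k)"
  proof (rule ccontr)
    assume n: "\<nexists>k. i < k \<and> k < j \<and> adj s (f k)"
    show False
    proof (rule not_good_square[OF g])
      fix y assume "y \<in> set (map f [i + 1..j - 1])"
      then obtain k where "y = f k" "i < k" "k < j" by auto
      then show "m s y = 2" using f_commutes[of k s] ij(4) n sS by blast
    qed
  qed
  then obtain k where k: "i < k" "k < j" "adj s (f k)" by blast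
  show ?thesis
  proof (rule ccontr)
    assume n: "\<not> ?thesis"
    then have m3: "m s (f k) = 3" using k label_3_or_ge_4 by blast
    have un: "\<not> adj s (f l)" if "i < l" "l < j" "l \<noteq> k" for l using n k that by blast
    have "good (s # map f [i + 1..k - 1] @ f k # map f [k + 1..j - 1] @ [s])"
      using g split_at[of "i + 1" k "j - 1"] k by simp
    then show False
    proof (rule not_good_braid3[OF _ m3])
      fix y assume "y \<in> set (map f [i + 1..k - 1] @ map f [k + 1..j - 1])"
      then obtain l where "y = f l" "i < l" "l < j" "l \<noteq> k" using k by auto
      then show "m s y = 2 \<and> m y s = 2" using f_commutes[of l s] ij(4) un sS by blast
    qed
  qed
qed

lemma chain_rule4:
  assumes i: "i1 < i2" "i2 < i3" "i3 < i4" "i4 < i1 + int n"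
    and f: "f i1 = a" "f i2 = b" "f i3 = a" "f i4 = b" and m: "m a b = 4"
    and ca: "\<And>k. i1 < k \<Longrightarrow> k < i3 \<Longrightarrow> k \<noteq> i2 \<Longrightarrow> f k \<noteq> a \<and> \<not> adj a (f k)"
    and cb: "\<And>k. i2 < k \<Longrightarrow> k < i4 \<Longrightarrow> k \<noteq> i3 \<Longrightarrow> f k \<noteq> b \<and> \<not> adj b (f k)"
  shows False
proof (rule not_good_braid4[OF _ m])
  have "map f [i1..i4] = a # map f [i1 + 1..i4 - 1] @ [b]" using window_ends[of i1 i4] i f by simp
  also have "map f [i1 + 1..i4 - 1] = map f [i1 + 1..i2 - 1] @ b # map f [i2 + 1..i4 - 1]"
    using split_at[of "i1 + 1" i2 "i4 - 1"] i f by simp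
  also have "map f [i2 + 1..i4 - 1] = map f [i2 + 1..i3 - 1] @ a # map f [i3 + 1..i4 - 1]"
    using split_at[of "i2 + 1" i3 "i4 - 1"] i f by simp
  finally show "good (a # map f [i1 + 1..i2 - 1] @ b # map f [i2 + 1..i3 - 1] @ a # map f [i3 + 1..i4 - 1] @ [b])"
    using window_good[OF i(4)] by simp
next
  have S: "a \<in> S" "b \<in> S" using f f_in_S by metis+
  fix y
  show "m a y = 2 \<and> m y a = 2" if y: "y \<in> set (map f [i1 + 1..i2 - 1] @ map f [i2 + 1..i3 - 1])"
  proof -
    obtain k where "y = f k" "i1 < k" "k < i3" "k \<noteq> i2" using y i by auto
    then show ?thesis using f_commutes[of k a] ca S by blast
  qed
  show "m b y = 2 \<and> m y b = 2" if y: "y \<in> set (map f [i2 + 1..i3 - 1] @ map f [i3 + 1..i4 - 1])"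
  proof -
    obtain k where "y = f k" "i2 < k" "k < i4" "k \<noteq> i3" using y i by auto
    then show ?thesis using f_commutes[of k b] cb S by blast
  qed
qed

lemma chain_rule5:
  assumes i: "i1 < i2" "i2 < i3" "i3 < i4" "i4 < i5" "i5 < i1 + int n"
    and f: "f i1 = a" "f i2 = b" "f i3 = a" "f i4 = b" "f i5 = a" and m: "m a b = 5"
    and ca: "\<And>k. i1 < k \<Longrightarrow> k < i5 \<Longrightarrow> k \<noteq> i2 \<Longrightarrow> k \<noteq> i3 \<Longrightarrow> k \<noteq> i4 \<Longrightarrow> f k \<noteq> a \<and> \<not> adj a (f k)"
    and cb: "\<And>k. i2 < k \<Longrightarrow> k < i4 \<Longrightarrow> k \<noteq> i3 \<Longrightarrow> f k \<noteq> b \<and> \<not> adj b (f k)"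
  shows False
proof (rule not_good_braid5[OF _ m])
  have "map f [i1..i5] = a # map f [i1 + 1..i5 - 1] @ [a]" using window_ends[of i1 i5] i f by simp
  also have "map f [i1 + 1..i5 - 1] = map f [i1 + 1..i2 - 1] @ b # map f [i2 + 1..i5 - 1]"
    using split_at[of "i1 + 1" i2 "i5 - 1"] i f by simp
  also have "map f [i2 + 1..i5 - 1] = map f [i2 + 1..i3 - 1] @ a # map f [i3 + 1..i5 - 1]"
    using split_at[of "i2 + 1" i3 "i5 - 1"] i f by simp
  also have "map f [i3 + 1..i5 - 1] = map f [i3 + 1..i4 - 1] @ b # map f [i4 + 1..i5 - 1]"
    using split_at[of "i3 + 1" i4 "i5 - 1"] i f by simp
  finally show "good (a # map f [i1 + 1..i2 - 1] @ b # map f [i2 + 1..i3 - 1] @ a # map f [i3 + 1..i4 - 1]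
      @ b # map f [i4 + 1..i5 - 1] @ [a])"
    using window_good[OF i(5)] by simp
next
  have S: "a \<in> S" "b \<in> S" using f f_in_S by metis+
  fix y
  show "m a y = 2 \<and> m y a = 2" if y: "y \<in> set (map f [i1 + 1..i2 - 1] @ map f [i2 + 1..i3 - 1] @
      map f [i3 + 1..i4 - 1] @ map f [i4 + 1..i5 - 1])"
  proof -
    obtain k where "y = f k" "i1 < k" "k < i5" "k \<noteq> i2" "k \<noteq> i3" "k \<noteq> i4" using y i by auto
    then show ?thesis using f_commutes[of k a] ca S by blast
  qed
  show "m b y = 2 \<and> m y b = 2" if y: "y \<in> set (map f [i2 + 1..i3 - 1] @ map f [i3 + 1..i4 - 1])"
  proof -
    obtain k where "y = f k" "i2 < k" "k < i4" "k \<noteq> i3" using y i by auto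
    then show ?thesis using f_commutes[of k b] cb S by blast
  qed
qed

lemma consec_between:
  assumes "i < j" "f i = s" "f j = s" shows "\<exists>k. consec s i k \<and> k \<le> j"
proof -
  define l where "l = (LEAST l. f (i + int (Suc l)) = s)"
  have "f (i + int (Suc (nat (j - i - 1)))) = s" using assms by simp
  then have l: "f (i + int (Suc l)) = s" "l \<le> nat (j - i - 1)"
    unfolding l_def by (rule LeastI, rule Least_le)
  have "f k \<noteq> s" if "i < k" "k < i + int (Suc l)" for k
  proof
    assume "f k = s"
    then have "f (i + int (Suc (nat (k - i - 1)))) = s" using that by simp
    then have "l \<le> nat (k - i - 1)" unfolding l_def by (rule Least_le)
    then show False using that by simp
  qed
  then have "consec s i (i + int (Suc l))" unfolding consec_def using l assms by auto
  moreover have "i + int (Suc l) \<le> j" using l(2) assms by simp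
  ultimately show ?thesis by blast
qed

lemma consec_before:
  assumes "i < j" "f i = s" "f j = s" shows "\<exists>k. consec s k j \<and> i \<le> k"
proof -
  define l where "l = (LEAST l. f (j - int (Suc l)) = s)"
  have "f (j - int (Suc (nat (j - i - 1)))) = s" using assms by simp
  then have l: "f (j - int (Suc l)) = s" "l \<le> nat (j - i - 1)"
    unfolding l_def by (rule LeastI, rule Least_le)
  have "f k \<noteq> s" if "k < j" "j - int (Suc l) < k" for k
  proof
    assume "f k = s"
    then have "f (j - int (Suc (nat (j - k - 1)))) = s" using that by simp
    then have "l \<le> nat (j - k - 1)" unfolding l_def by (rule Least_le)
    then show False using that by simp
  qed
  then have "consec s (j - int (Suc l)) j" unfolding consec_def using l assms by auto
  moreover have "i \<le> j - int (Suc l)" using l(2) assms by simp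
  ultimately show ?thesis by blast
qed

lemma period_mult: "f (i + k * int n) = f i"
proof (induction k rule: int_induct[of _ 0])
  case (step1 k)
  then show ?case using period[of "i + k * int n"] by (simp add: algebra_simps)
next
  case (step2 k)
  then show ?case using period'[of "i + k * int n"] by (simp add: algebra_simps)
qed simp

text \<open>The representative of \<open>k\<close> modulo the period in the window that starts at
  \<open>i\<close>.\<close>

definition shift_to :: "int \<Rightarrow> int \<Rightarrow> int" where
  "shift_to i k = i + (k - i) mod int n"

lemma shift_to: "i \<le> shift_to i k" "shift_to i k < i + int n" "f (shift_to i k) = f k"
proof -
  show "i \<le> shift_to i k" "shift_to i k < i + int n" using n_pos by (auto simp: shift_to_def)
  have "shift_to i k = k + (- ((k - i) div int n)) * int n"
    unfolding shift_to_def by (simp add: minus_div_mult_eq_mod[symmetric])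
  then show "f (shift_to i k) = f k" using period_mult by metis
qed

lemma shift_to_inj:
  assumes "j < k" "k < j + int n" shows "shift_to i j \<noteq> shift_to i k"
proof
  assume "shift_to i j = shift_to i k"
  then have "(j - i) mod int n = (k - i) mod int n" unfolding shift_to_def by simp
  then have "int n dvd (k - i) - (j - i)" by (simp add: mod_eq_dvd_iff dvd_diff_commute)
  then have "int n dvd k - j" by simp
  then show False using assms zdvd_not_zless[of "k - j" "int n"] by simp
qed

lemma multi_next:
  assumes "multi s" "f i = s" shows "\<exists>j. consec s i j \<and> j < i + int n"
proof -
  obtain p q where pq: "p < q" "q < p + int n" "f p = s" "f q = s" using assms(1) unfolding multi_def by blast
  have "\<exists>j. i < j \<and> j < i + int n \<and> f j = s"
    using shift_to[of i p] shift_to[of i q] shift_to_inj[OF pq(1,2), of i] pq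
    by (cases "shift_to i p = i") (metis order_le_less)+
  then obtain j where "i < j" "j < i + int n" "f j = s" by blast
  then show ?thesis using consec_between[of i j s] assms(2) by force
qed

lemma consec_period: "consec s i j \<Longrightarrow> j \<le> i + int n"
  using period[of i] n_pos unfolding consec_def by (metis linorder_not_le zless_add1_eq less_add_same_cancel1 of_nat_0_less_iff)

lemma multi_consec: "multi s \<Longrightarrow> consec s i j \<Longrightarrow> j < i + int n"
proof -
  assume "multi s" "consec s i j"
  moreover from this obtain k where "consec s i k" "k < i + int n"
    using multi_next[of s i] by (auto simp: consec_def)
  ultimately show ?thesis unfolding consec_def by (metis linorder_neqE not_less_iff_gr_or_eq order.strict_trans)
qed

lemma multi_prev:
  assumes "multi s" "f i = s" shows "\<exists>j. consec s j i"
  using consec_before[of "i - int n" i s] assms n_pos period' by force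

end

section \<open>Branches of the Coxeter graph\<close>

context coxeter_matrix
begin

text \<open>A step between directed edges that continues without going back. Its closure starting
  from (s, t) reaches the edges beyond t.\<close>

definition turn :: "'a \<times> 'a \<Rightarrow> 'a \<times> 'a \<Rightarrow> bool" where
  "turn e e' \<longleftrightarrow> adj (fst e) (snd e) \<and> fst e' = snd e \<and> adj (snd e) (snd e') \<and> snd e' \<noteq> fst e"

lemma turn_iff [simp]: "turn (s, t) (p, q) \<longleftrightarrow> adj s t \<and> p = t \<and> adj t q \<and> q \<noteq> s"
  by (auto simp: turn_def)

text \<open>
  What lies beyond \<open>t\<close>, seen from \<open>s\<close>, is a path with labels \<open>3\<close>; the label of the edge from \<open>s\<close> to \<open>t\<close>
  itself is arbitrary.
\<close>

definition plain :: "'a \<Rightarrow> 'a \<Rightarrow> bool" where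
  "plain s t \<longleftrightarrow> adj s t \<and> (\<forall>p q. turn\<^sup>*\<^sup>* (s, t) (p, q) \<longrightarrow>
     (\<forall>r r'. adj q r \<and> r \<noteq> p \<and> adj q r' \<and> r' \<noteq> p \<longrightarrow> r = r') \<and> (\<forall>r. adj q r \<and> r \<noteq> p \<longrightarrow> m q r = 3))"

lemma plain_adj: "plain s t \<Longrightarrow> adj s t"
  by (simp add: plain_def)

lemma plain_unique: "plain s t \<Longrightarrow> adj t r \<Longrightarrow> r \<noteq> s \<Longrightarrow> adj t r' \<Longrightarrow> r' \<noteq> s \<Longrightarrow> r = r'"
  unfolding plain_def by blast

lemma plain_label: "plain s t \<Longrightarrow> adj t r \<Longrightarrow> r \<noteq> s \<Longrightarrow> m t r = 3"
  unfolding plain_def by blast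

lemma plain_turn: "plain s t \<Longrightarrow> adj t r \<Longrightarrow> r \<noteq> s \<Longrightarrow> plain t r"
  unfolding plain_def by (metis converse_rtranclp_into_rtranclp turn_iff)

lemma turn_adj: "turn\<^sup>*\<^sup>* e e' \<Longrightarrow> adj (fst e) (snd e) \<Longrightarrow> adj (fst e') (snd e')"
  by (induction rule: rtranclp_induct) (auto simp: turn_def)

lemma turn_walk:
  assumes "turn\<^sup>*\<^sup>* (s, t) (p, q)" "adj s t"
  shows "\<exists>xs. nb_walk xs \<and> (\<exists>ys. xs = s # t # ys) \<and> (\<exists>zs. xs = zs @ [p, q])"
  using assms
proof (induction "(p, q)" arbitrary: p q rule: rtranclp_induct)
  case base
  then show ?case by (intro exI[of _ "[s, t]"]) auto
next
  case (step e)
  obtain p' q' where e: "e = (p', q')" by (cases e)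
  then obtain xs ys zs where xs: "nb_walk xs" "xs = s # t # ys" "xs = zs @ [p', q']"
    using step by blast
  have t: "q' = p" "adj p q" "q \<noteq> p'" using step e by auto
  have "nb_walk (zs @ [p', p, q])" using nb_walk_append_snoc[of zs p' p q] xs t by simp
  moreover have "zs @ [p', p, q] = s # t # (ys @ [q])" using xs t by simp
  ultimately show ?case by (metis append.assoc append_Cons append_Nil)
qed

text \<open>A feature at \<open>q\<close> as seen on arrival from \<open>p\<close>; the edge between
  them does not count. These are the conditions under which a zigzag can turn at
  \<open>q\<close>.\<close>

definition feature :: "'a \<Rightarrow> 'a \<Rightarrow> bool" where
  "feature p q \<longleftrightarrow> (\<exists>r. adj q r \<and> r \<noteq> p \<and> 4 \<le> m q r) \<or>
     (\<exists>r r'. r \<noteq> r' \<and> adj q r \<and> adj q r' \<and> r \<noteq> p \<and> r' \<noteq> p)"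

lemma featureE:
  assumes "feature p q"
  obtains E where "E \<noteq> []" "distinct E" "\<And>r. r \<in> set E \<Longrightarrow> adj q r \<and> r \<noteq> p" "\<And>y. E = [y] \<Longrightarrow> 4 \<le> m q y"
  using assms unfolding feature_def
proof (elim disjE exE conjE)
  fix r assume r: "adj q r" "r \<noteq> p" "4 \<le> m q r"
  show ?thesis by (rule that[of "[r]"]) (use r in auto)
next
  fix r r' assume r: "r \<noteq> r'" "adj q r" "adj q r'" "r \<noteq> p" "r' \<noteq> p"
  show ?thesis by (rule that[of "[r, r']"]) (use r in auto)
qed

lemma not_feature: "\<not> feature p q \<Longrightarrow> adj q r \<Longrightarrow> r \<noteq> p \<Longrightarrow> m q r = 3"
  using label_3_or_ge_4 unfolding feature_def by blast

end

context cfc_finite_graph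
begin

text \<open>The zigzag along the single vertex \<open>c\<close>, with two disjoint ends attached to
  it.\<close>

lemma no_two_ends:
  assumes "E \<noteq> []" "distinct E" "\<And>y. E = [y] \<Longrightarrow> 4 \<le> m c y" "\<And>r. r \<in> set E \<Longrightarrow> adj c r"
    and "F \<noteq> []" "distinct F" "\<And>y. F = [y] \<Longrightarrow> 4 \<le> m c y" "\<And>r. r \<in> set F \<Longrightarrow> adj c r"
    and "set E \<inter> set F = {}"
  shows False
proof (rule no_zigzag[of "[c]" E F])
  show "nb_walk (a # [c] @ [e])" if "a \<in> set E" "e \<in> set F" for a e
    using that assms(4)[of a] assms(8)[of e] assms(9) adj_sym by auto
qed (use assms in auto)

lemma no_two_features:
  assumes t: "turn\<^sup>*\<^sup>* (s, t) (p, q)" "adj s t" and f: "feature t s" "feature p q" shows False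
proof -
  obtain xs ys zs where xs: "nb_walk xs" "xs = s # t # ys" "xs = zs @ [p, q]" using turn_walk[OF t] by blast
  obtain E where E: "E \<noteq> []" "distinct E" "\<And>r. r \<in> set E \<Longrightarrow> adj s r \<and> r \<noteq> t" "\<And>y. E = [y] \<Longrightarrow> 4 \<le> m s y"
    using featureE[OF f(1)] by blast
  obtain F where F: "F \<noteq> []" "distinct F" "\<And>r. r \<in> set F \<Longrightarrow> adj q r \<and> r \<noteq> p" "\<And>y. F = [y] \<Longrightarrow> 4 \<le> m q y"
    using featureE[OF f(2)] by blast
  show False
  proof (rule no_zigzag[of xs E F])
    show "nb_walk (a # xs @ [e])" if a: "a \<in> set E" and e: "e \<in> set F" for a e
    proof -
      have "nb_walk (a # xs)" using xs(1,2) E(3)[OF a] adj_sym by simp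
      then have "nb_walk ((a # zs) @ [p, q])" using xs(3) by simp
      from nb_walk_append_snoc[OF this] F(3)[OF e] show ?thesis unfolding xs(3) by simp
    qed
    show "4 \<le> m (hd xs) y" if "E = [y]" for y using E(4)[OF that] xs(2) by simp
    show "4 \<le> m (last xs) y" if "F = [y]" for y using F(4)[OF that] xs(3) by simp
    show "xs \<noteq> []" using xs(2) by simp
  qed (use E F in auto)
qed

lemma plain_of_feature:
  assumes "adj s t" "feature t s" shows "plain s t"
  unfolding plain_def
proof (intro conjI allI impI assms; elim conjE)
  fix p q assume "turn\<^sup>*\<^sup>* (s, t) (p, q)"
  then have n: "\<not> feature p q" using no_two_features assms by blast
  show "r = r'" if "adj q r" "r \<noteq> p" "adj q r'" "r' \<noteq> p" for r r'
    using n that unfolding feature_def by blast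
  show "m q r = 3" if "adj q r" "r \<noteq> p" for r
    using not_feature n that by blast
qed

lemma label_of_feature:
  assumes "adj s t" "feature t s" shows "m s t = 3"
proof (rule ccontr)
  assume "m s t \<noteq> 3"
  then have m: "4 \<le> m s t" using label_3_or_ge_4 assms(1) by blast
  obtain E where E: "E \<noteq> []" "distinct E" "\<And>r. r \<in> set E \<Longrightarrow> adj s r \<and> r \<noteq> t" "\<And>y. E = [y] \<Longrightarrow> 4 \<le> m s y"
    using featureE[OF assms(2)] by blast
  then show False using no_two_ends[of E s "[t]"] m assms(1) by auto
qed

text \<open>Seen from any further neighbour of \<open>a\<close>, the heavy edge is itself a feature
  at \<open>a\<close>, so nothing special can lie beyond that neighbour. At \<open>a\<close> itself
  the heavy edge would be one of two ends.\<close>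

lemma plain_of_heavy:
  assumes a: "adj b a" and h: "4 \<le> m b a" shows "plain b a"
proof -
  have h': "4 \<le> m a b" using h a m_sym by (auto simp: adj_def)
  have u: "r = r'" if "adj a r" "r \<noteq> b" "adj a r'" "r' \<noteq> b" for r r'
    using no_two_ends[of "[r, r']" a "[b]"] that h' adj_sym[OF a] by auto
  have l: "m a r = 3" if r: "adj a r" "r \<noteq> b" for r
    using no_two_ends[of "[r]" a "[b]"] r h' adj_sym[OF a] label_3_or_ge_4[of a r] by auto
  have t: "plain a r" if "adj a r" "r \<noteq> b" for r
    using plain_of_feature[OF that(1)] h' adj_sym[OF a] that(2) unfolding feature_def by blast
  show ?thesis unfolding plain_def
  proof (intro conjI allI impI a; elim conjE)
    fix p q r r' assume pq: "turn\<^sup>*\<^sup>* (b, a) (p, q)" and r: "adj q r" "r \<noteq> p" "adj q r'" "r' \<noteq> p"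
    from pq show "r = r'"
    proof (cases rule: converse_rtranclpE)
      case base
      then show ?thesis using u r by auto
    next
      case (step e)
      then obtain x where "e = (a, x)" "adj a x" "x \<noteq> b" by (cases e) auto
      then show ?thesis using t[of x] step(2) r unfolding plain_def by blast
    qed
  next
    fix p q r assume pq: "turn\<^sup>*\<^sup>* (b, a) (p, q)" and r: "adj q r" "r \<noteq> p"
    from pq show "m q r = 3"
    proof (cases rule: converse_rtranclpE)
      case base
      then show ?thesis using l r by auto
    next
      case (step e)
      then obtain x where "e = (a, x)" "adj a x" "x \<noteq> b" by (cases e) auto
      then show ?thesis using t[of x] step(2) r unfolding plain_def by blast
    qed
  qed
qed

text \<open>Induction from the leaves towards the edge. It is well-founded because non-backtracking
  walks have distinct vertices in the finite set \<open>S\<close>.\<close>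

lemma turn_induct [consumes 1, case_names turn]:
  assumes "adj s t"
    and step: "\<And>s t. adj s t \<Longrightarrow> (\<And>r. adj t r \<Longrightarrow> r \<noteq> s \<Longrightarrow> P t r) \<Longrightarrow> P s t"
  shows "P s t"
proof -
  have "P s t" if "nb_walk (zs @ [s, t])" "adj s t" for zs s t
    using that
  proof (induction "card S - length zs" arbitrary: zs s t rule: less_induct)
    case less
    have d: "distinct (zs @ [s, t])" using less.prems nb_walk_distinct by blast
    have "set (zs @ [s, t]) \<subseteq> S"
    proof
      fix x assume "x \<in> set (zs @ [s, t])"
      then obtain i where i: "i < length (zs @ [s, t])" "x = (zs @ [s, t]) ! i" by (metis in_set_conv_nth)
      show "x \<in> S"
      proof (cases "Suc i < length (zs @ [s, t])")
        case True
        then show ?thesis using less.prems(1) i unfolding nb_walk_iff_nth adj_def by metis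
      next
        case False
        then have "x = t" using i by (simp add: nth_append)
        then show ?thesis using less.prems(2) by (simp add: adj_def)
      qed
    qed
    then have "length (zs @ [s, t]) \<le> card S"
      using distinct_card[OF d] card_mono[OF finite_S] by metis
    then have lt: "card S - length (zs @ [s]) < card S - length zs" by simp
    show ?case
    proof (rule step[OF less.prems(2)])
      fix r assume r: "adj t r" "r \<noteq> s"
      have "nb_walk ((zs @ [s]) @ [t, r])" using nb_walk_append_snoc[OF less.prems(1) r] by simp
      then show "P t r" using less.hyps[OF lt] r by blast
    qed
  qed
  from this[of "[]"] show ?thesis using assms(1) by simp
qed

end

context cyclic_word
begin

lemma reach:
  assumes "c \<in> S" "q \<in> S" "q \<noteq> c" shows "\<exists>x p. adj c x \<and> turn\<^sup>*\<^sup>* (c, x) (p, q)"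
proof -
  have "adj\<^sup>*\<^sup>* c q" using connected assms by blast
  then have "q = c \<or> (\<exists>x p. adj c x \<and> turn\<^sup>*\<^sup>* (c, x) (p, q))"
  proof (induction rule: rtranclp_induct)
    case (step y z)
    show ?case
    proof (cases "y = c")
      case True
      then show ?thesis using step by blast
    next
      case False
      then obtain x p where x: "adj c x" "turn\<^sup>*\<^sup>* (c, x) (p, y)" using step by blast
      show ?thesis
      proof (cases "z = p")
        case True
        \<comment> \<open>The walk steps back, so its last turn is dropped. If there was no turn, it
          has returned to \<open>c\<close>.\<close>
        from x(2) show ?thesis
        proof (cases rule: rtranclp.cases)
          case rtrancl_refl
          then show ?thesis using True by auto
        next
          case (rtrancl_into_rtrancl e)
          then obtain p' where "e = (p', p)" by (cases e) auto
          then show ?thesis using x rtrancl_into_rtrancl True by auto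
        qed
      next
        case False
        have "adj p y" using turn_adj[OF x(2)] x(1) by simp
        then have "turn (p, y) (y, z)" using step(2) False by simp
        then show ?thesis using x by (meson rtranclp.rtrancl_into_rtrancl)
      qed
    qed
  qed simp
  then show ?thesis using assms by blast
qed

text \<open>Infinite descent. A gap of \<open>t\<close> without \<open>s\<close> must contain two
  neighbours other than \<open>s\<close>; beyond \<open>t\<close> there is only one vertex, so it
  occurs twice inside the gap without a \<open>t\<close> between, at a smaller distance.\<close>

lemma plain_gap:
  assumes "plain s t" "f i = t" "f j = t" "i < j" "j < i + int n" "\<And>k. i < k \<Longrightarrow> k < j \<Longrightarrow> f k \<noteq> s"
  shows False
  using assms
proof (induction "nat (j - i)" arbitrary: s t i j rule: less_induct)
  case less
  obtain j' where j': "consec t i j'" "j' \<le> j" using consec_between[of i j t] less.prems by blast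
  then have "j' < i + int n" using less.prems by simp
  from gap_rule[OF j'(1) this] obtain k where k: "i < k" "k < j'" "adj t (f k)"
    "4 \<le> m t (f k) \<or> (\<exists>l. l \<noteq> k \<and> i < l \<and> l < j' \<and> adj t (f l))" by blast
  have ks: "f k \<noteq> s" using less.prems(6)[of k] k j' by simp
  have "m t (f k) = 3" using plain_label[OF less.prems(1) k(3) ks] .
  then obtain l where l: "l \<noteq> k" "i < l" "l < j'" "adj t (f l)" using k(4) by auto
  have ls: "f l \<noteq> s" using less.prems(6)[of l] l j' by simp
  have e: "f l = f k" using plain_unique[OF less.prems(1) l(4) ls k(3) ks] .
  define a where "a = min k l"
  define b where "b = max k l"
  have ab: "a < b" "i < a" "b < j'" "f a = f k" "f b = f k" using k l e unfolding a_def b_def by (auto simp: min_def max_def)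
  show ?case
  proof (rule less.hyps[of b a t "f k"])
    show "nat (b - a) < nat (j - i)" using ab j' by simp
    show "plain t (f k)" using plain_turn[OF less.prems(1) k(3) ks] .
    show "b < a + int n" using ab j' less.prems by simp
    show "f x \<noteq> t" if "a < x" "x < b" for x using that j'(1) ab unfolding consec_def by auto
  qed (use ab in auto)
qed

text \<open>Two successive gaps of \<open>s\<close> fit into one period and contain an occurrence of
  \<open>t\<close> each.\<close>

lemma multi_from_gaps:
  assumes "multi s" "\<And>i j. consec s i j \<Longrightarrow> \<exists>k. i < k \<and> k < j \<and> f k = t" shows "multi t"
proof -
  obtain i where "f i = s" using assms(1) unfolding multi_def by blast
  then obtain j where j: "consec s i j" "j < i + int n" using multi_next[OF assms(1)] by blast
  have fj: "f j = s" "f (i + int n) = s" using j period unfolding consec_def by auto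
  then obtain k where k: "consec s j k" "k \<le> i + int n" using consec_between[of j "i + int n" s] j by blast
  obtain p where "i < p" "p < j" "f p = t" using assms(2)[OF j(1)] by blast
  moreover obtain q where "j < q" "q < k" "f q = t" using assms(2)[OF k(1)] by blast
  ultimately show ?thesis using k(2) unfolding multi_def by (intro exI[of _ p] exI[of _ q]) auto
qed

text \<open>If every gap of \<open>s\<close> contained \<open>t\<close>, then \<open>t\<close> would
  be repeated, and no gap of \<open>t\<close> could contain two \<open>s\<close>. So every gap of
  \<open>t\<close> would need a neighbour other than \<open>s\<close>, always the same vertex, which
  contradicts the induction hypothesis one edge further out.\<close>

lemma plain_missing:
  assumes "plain s t" "m s t = 3" "multi s"
  shows "\<exists>i j. consec s i j \<and> (\<forall>k. i < k \<and> k < j \<longrightarrow> f k \<noteq> t)"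
proof -
  have "adj s t" using assms plain_adj by blast
  then show ?thesis using assms
  proof (induction rule: turn_induct)
    case (turn s t)
    show ?case
    proof (rule ccontr)
      assume "\<not> ?case"
      then have all: "\<exists>k. i < k \<and> k < j \<and> f k = t" if "consec s i j" for i j using that by blast
      have mt: "multi t" using multi_from_gaps[OF turn.prems(3) all] by blast
      have mts: "m t s = 3" using turn.prems turn.hyps m_sym by (auto simp: adj_def)
      have other: "\<exists>l. i < l \<and> l < j \<and> adj t (f l) \<and> f l \<noteq> s" if c: "consec t i j" for i j
      proof -
        have jn: "j < i + int n" using multi_consec[OF mt c] .
        obtain k where k: "i < k" "k < j" "adj t (f k)"
          "4 \<le> m t (f k) \<or> (\<exists>l. l \<noteq> k \<and> i < l \<and> l < j \<and> adj t (f l))" using gap_rule[OF c jn] by blast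
        show ?thesis
        proof (cases "f k = s")
          case True
          then obtain l where l: "l \<noteq> k" "i < l" "l < j" "adj t (f l)" using k mts by auto
          have "f l \<noteq> s"
          proof
            assume ls: "f l = s"
            define a b where "a = min k l" and "b = max k l"
            have ab: "a < b" "f a = s" "f b = s" "i < a" "b < j" using True ls l k unfolding a_def b_def by (auto simp: min_def max_def)
            then obtain b' where b': "consec s a b'" "b' \<le> b" using consec_between by blast
            then obtain x where "a < x" "x < b'" "f x = t" using all by blast
            then show False using c ab b' unfolding consec_def by auto
          qed
          then show ?thesis using l by blast
        qed (use k in blast)
      qed
      obtain i where "f i = t" using mt unfolding multi_def by blast
      then obtain j where "consec t i j" using multi_next[OF mt] by blast
      then obtain l where l: "adj t (f l)" "f l \<noteq> s" using other by blast
      define r where "r = f l"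
      have "\<exists>i j. consec t i j \<and> (\<forall>k. i < k \<and> k < j \<longrightarrow> f k \<noteq> r)"
      proof (rule turn.IH)
        show "adj t r" "r \<noteq> s" using l unfolding r_def by auto
        then show "plain t r" "m t r = 3" using turn.prems plain_turn plain_label by blast+
      qed (rule mt)
      then obtain i j where c: "consec t i j" "\<forall>k. i < k \<and> k < j \<longrightarrow> f k \<noteq> r" by blast
      then obtain l' where "i < l'" "l' < j" "adj t (f l')" "f l' \<noteq> s" using other by blast
      moreover from this have "f l' = r" using plain_unique[OF turn.prems(1)] l unfolding r_def by blast
      ultimately show False using c by blast
    qed
  qed
qed

text \<open>Some gap of \<open>t\<close> misses the next vertex outwards, so it contains two
  \<open>s\<close>; the following gap contains a third one by \<open>plain_gap\<close>.\<close>

lemma plain_grow: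
  assumes p: "plain s t" "m s t = 3" "multi t" shows "tri s"
proof -
  have st: "adj s t" using p plain_adj by blast
  have hit: "\<exists>k. i < k \<and> k < j \<and> f k = s" if c: "consec t i j" for i j
    using plain_gap[OF p(1), of i j] multi_consec[OF p(3) c] c unfolding consec_def by blast
  have mts: "m t s = 3" using p st m_sym by (auto simp: adj_def)
  have "\<exists>i j. consec t i j \<and> (\<forall>k. i < k \<and> k < j \<and> adj t (f k) \<longrightarrow> f k = s)"
  proof (cases "\<exists>r. adj t r \<and> r \<noteq> s")
    case True
    then obtain r where r: "adj t r" "r \<noteq> s" by blast
    then have "plain t r" "m t r = 3" using p plain_turn plain_label by blast+
    then obtain i j where "consec t i j" "\<forall>k. i < k \<and> k < j \<longrightarrow> f k \<noteq> r" using plain_missing p(3) by blast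
    then show ?thesis using plain_unique[OF p(1)] r by blast
  next
    case False
    obtain i where "f i = t" using p(3) unfolding multi_def by blast
    then show ?thesis using multi_next[OF p(3)] False by blast
  qed
  then obtain i j where c: "consec t i j" "\<And>k. i < k \<Longrightarrow> k < j \<Longrightarrow> adj t (f k) \<Longrightarrow> f k = s" by blast
  have jn: "j < i + int n" using multi_consec[OF p(3) c(1)] .
  obtain k where k: "i < k" "k < j" "adj t (f k)"
    "4 \<le> m t (f k) \<or> (\<exists>l. l \<noteq> k \<and> i < l \<and> l < j \<and> adj t (f l))" using gap_rule[OF c(1) jn] by blast
  have fk: "f k = s" using c(2) k by blast
  then obtain l where l: "l \<noteq> k" "i < l" "l < j" "adj t (f l)" using k mts by auto
  have fl: "f l = s" using c(2) l by blast
  have "f j = t" "f (i + int n) = t" using c(1) period unfolding consec_def by auto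
  then obtain j' where j': "consec t j j'" "j' \<le> i + int n" using consec_between[of j "i + int n" t] jn by blast
  obtain x where x: "j < x" "x < j'" "f x = s" using hit[OF j'(1)] by blast
  show ?thesis unfolding tri_def
    by (rule exI[of _ "min k l"], rule exI[of _ "max k l"], rule exI[of _ x])
      (use k l fk fl x j' in \<open>auto simp: min_def max_def\<close>)
qed

lemma plain_chain_grow:
  assumes "turn\<^sup>*\<^sup>* (s, t) (p, q)" "plain s t" "m s t = 3" "multi q" shows "tri s"
  using assms
proof (induction "(s, t)" arbitrary: s t rule: converse_rtranclp_induct)
  case base
  then show ?case using plain_grow by blast
next
  case (step e)
  then obtain r where e: "e = (t, r)" "adj t r" "r \<noteq> s" by (cases e) auto
  have "plain t r" "m t r = 3" using step.prems e plain_turn plain_label by blast+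
  then have "tri t" using step.hyps(3)[of t r] step.prems e by blast
  then show ?case using plain_grow[OF step.prems(1,2)] tri_multi by blast
qed

lemma consec_le: "consec s i j \<Longrightarrow> f k = s \<Longrightarrow> i < k \<Longrightarrow> j \<le> k"
  unfolding consec_def by force

lemma consec_ge: "consec s i j \<Longrightarrow> f k = s \<Longrightarrow> k < j \<Longrightarrow> k \<le> i"
  unfolding consec_def by force

lemma two_neighbours:
  assumes "consec s i j" "j < i + int n" "\<And>k. i < k \<Longrightarrow> k < j \<Longrightarrow> adj s (f k) \<Longrightarrow> m s (f k) = 3"
  shows "\<exists>k l. i < k \<and> k < l \<and> l < j \<and> adj s (f k) \<and> adj s (f l)"
proof -
  obtain k where k: "i < k" "k < j" "adj s (f k)"
    "4 \<le> m s (f k) \<or> (\<exists>l. l \<noteq> k \<and> i < l \<and> l < j \<and> adj s (f l))" using gap_rule[OF assms(1,2)] by blast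
  then obtain l where "l \<noteq> k" "i < l" "l < j" "adj s (f l)" using assms(3)[of k] by auto
  then show ?thesis using k by (metis linorder_neqE)
qed

lemma plain_once:
  assumes "plain s t" "consec s i j" "j \<le> i + int n" "i < k" "k < j" "i < l" "l < j" "f k = t" "f l = t"
  shows "k = l"
proof (rule ccontr)
  assume "k \<noteq> l"
  then consider "k < l" | "l < k" by linarith
  then show False
    using plain_gap[OF assms(1), of k l] plain_gap[OF assms(1), of l k] assms unfolding consec_def
    by cases auto
qed

section \<open>Repeated generators\<close>

text \<open>Some gap of \<open>s\<close> misses one neighbour, so it would have to contain the only
  other neighbour twice.\<close>

lemma unbranched_not_multi:
  assumes deg: "\<And>c x y z. adj c x \<Longrightarrow> adj c y \<Longrightarrow> adj c z \<Longrightarrow> x = y \<or> y = z \<or> x = z"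
    and lab: "\<And>s t. adj s t \<Longrightarrow> m s t = 3"
  shows "\<not> multi s"
proof
  assume ms: "multi s"
  have plain: "plain s t" if st: "adj s t" for s t
    unfolding plain_def
  proof (intro conjI allI impI st; elim conjE)
    fix p q assume "turn\<^sup>*\<^sup>* (s, t) (p, q)"
    then have "adj q p" using turn_adj st adj_sym by fastforce
    then show "r = r'" if "adj q r" "r \<noteq> p" "adj q r'" "r' \<noteq> p" for r r'
      using deg that by blast
    show "m q r = 3" if "adj q r" "r \<noteq> p" for r using lab that by blast
  qed
  obtain i where i: "f i = s" using ms unfolding multi_def by blast
  then obtain j where "consec s i j" "j < i + int n" using multi_next[OF ms] by blast
  then obtain r where r: "adj s r" using gap_rule by blast
  obtain i j where ij: "consec s i j" "\<And>k. i < k \<Longrightarrow> k < j \<Longrightarrow> f k \<noteq> r"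
    using plain_missing[OF plain[OF r] lab[OF r] ms] by blast
  have jn: "j < i + int n" using multi_consec ms ij by blast
  obtain k l where kl: "i < k" "k < l" "l < j" "adj s (f k)" "adj s (f l)"
    using two_neighbours[OF ij(1) jn] lab by blast
  have "f k \<noteq> r" "f l \<noteq> r" using ij(2) kl by auto
  then have "f l = f k" using deg[OF r kl(4,5)] by auto
  then have "k = l" using plain_once[OF plain[OF kl(4)] ij(1)] jn kl by auto
  then show False using kl by simp
qed

text \<open>Occurrences of \<open>y\<close> in two adjacent gaps of \<open>c\<close> enclose a single \<open>c\<close>, so a second neighbour of \<open>y\<close>.\<close>

lemma adjacent_gaps:
  assumes mc: "multi c" and c: "consec c i j" "consec c j k" and y: "plain c y" "m c y = 3"
    and p: "i < p" "p < j" "f p = y" and q: "j < q" "q < k" "f q = y"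
  shows "consec y p q" "q < p + int n" "\<exists>e. p < e \<and> e < q \<and> adj y (f e) \<and> f e \<noteq> c"
proof -
  have yc: "y \<noteq> c" using plain_adj[OF y(1)] adj_irrefl by blast
  have fj: "f j = c" using c by (auto simp: consec_def)
  have jn: "j < i + int n" "k < j + int n" using multi_consec mc c by blast+
  have "\<not> i + int n < k" using c(2) jn period[of i] c(1) unfolding consec_def by auto
  then have kn: "k \<le> i + int n" by simp
  show cons: "consec y p q" unfolding consec_def
  proof (intro conjI allI impI)
    fix l assume l: "p < l \<and> l < q"
    consider "l < j" | "l = j" | "j < l" by linarith
    then show "f l \<noteq> y"
    proof cases
      case 1
      then show ?thesis using plain_once[OF y(1) c(1), of p l] jn p l by auto
    next
      case 2
      then show ?thesis using fj yc by simp
    next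
      case 3
      then show ?thesis using plain_once[OF y(1) c(2), of l q] jn q l by auto
    qed
  qed (use p q in auto)
  show qn: "q < p + int n" using kn p q by simp
  have lab: "m y r = 3" if "adj y r" for r
    using plain_label[OF y(1) that] y(2) adj_label_sym[OF plain_adj[OF y(1)]] by (cases "r = c") auto
  obtain e e' where e: "p < e" "e < e'" "e' < q" "adj y (f e)" "adj y (f e')"
    using two_neighbours[OF cons qn] lab by blast
  have "\<not> (f e = c \<and> f e' = c)"
  proof
    assume "f e = c \<and> f e' = c"
    then have "e = j" "e' = j"
      using consec_le[OF c(1), of e] consec_le[OF c(1), of e'] consec_ge[OF c(2), of e]
        consec_ge[OF c(2), of e'] e p q by auto
    then show False using e by simp
  qed
  moreover have "e < q" "p < e'" using e by auto
  ultimately show "\<exists>e. p < e \<and> e < q \<and> adj y (f e) \<and> f e \<noteq> c" using e by blast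
qed

text \<open>A gap of \<open>c\<close> that misses \<open>z\<close> contains \<open>x\<close> and
  \<open>y\<close>. The leaf \<open>x\<close> cannot also occur in the gaps on either side, so these
  contain \<open>y\<close> too. The three \<open>y\<close> enclose two occurrences of the vertex
  beyond \<open>y\<close>, and between these there is only one \<open>y\<close>. But
  \<open>y\<close> is the only neighbour of that vertex.\<close>

lemma tripod_core:
  assumes xyz: "adj c x" "adj c y" "adj c z" "x \<noteq> y" "x \<noteq> z" "y \<noteq> z"
    and nb: "\<And>r. adj c r \<Longrightarrow> r = x \<or> r = y \<or> r = z"
    and plain: "\<And>r. adj c r \<Longrightarrow> plain c r \<and> m c r = 3"
    and leaf: "\<And>r. adj x r \<Longrightarrow> r = c"
    and short: "\<And>r r'. adj y r \<Longrightarrow> r \<noteq> c \<Longrightarrow> adj r r' \<Longrightarrow> r' = y"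
    and mc: "multi c"
  shows False
proof -
  \<comment> \<open>A gap that misses one arm contains the other two, since no arm can supply two
    letters.\<close>
  have pick: "\<exists>k. i < k \<and> k < j \<and> f k = r"
    if c: "consec c i j" and v: "v \<in> {x, y, z}" "\<And>k. i < k \<Longrightarrow> k < j \<Longrightarrow> f k \<noteq> v" and r: "r \<in> {x, y, z}" "r \<noteq> v"
    for i j v r
  proof (rule ccontr)
    assume n: "\<not> ?thesis"
    have jn: "j < i + int n" using multi_consec mc c by blast
    obtain k l where kl: "i < k" "k < l" "l < j" "adj c (f k)" "adj c (f l)"
      using two_neighbours[OF c jn] plain by blast
    have "f k \<noteq> v" "f l \<noteq> v" "f k \<noteq> r" "f l \<noteq> r" using v(2) n kl by auto
    then have "f l = f k" using nb[OF kl(4)] nb[OF kl(5)] v(1) r by auto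
    then show False using plain_once[OF conjunct1[OF plain[OF kl(4)]] c, of k l] jn kl by auto
  qed
  obtain i j where c: "consec c i j" "\<And>k. i < k \<Longrightarrow> k < j \<Longrightarrow> f k \<noteq> z"
    using plain_missing[of c z] plain[OF xyz(3)] mc by blast
  have jn: "j < i + int n" using multi_consec mc c(1) by blast
  have fc: "f i = c" "f j = c" using c(1) by (auto simp: consec_def)
  obtain px where px: "i < px" "px < j" "f px = x" using pick[OF c(1), of z x] c(2) xyz by auto
  obtain py where py: "i < py" "py < j" "f py = y" using pick[OF c(1), of z y] c(2) xyz by auto
  obtain k where k: "consec c j k" using multi_next[OF mc fc(2)] by blast
  obtain h where h: "consec c h i" using multi_prev[OF mc fc(1)] by blast
  \<comment> \<open>Otherwise the two occurrences of \<open>x\<close> would enclose a neighbour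
    other than \<open>c\<close>, but \<open>x\<close> is a leaf.\<close>
  have "f q \<noteq> x" if "j < q" "q < k" for q
    using adjacent_gaps(3)[OF mc c(1) k _ _ px that] plain[OF xyz(1)] leaf by blast
  then obtain qy where qy: "j < qy" "qy < k" "f qy = y" using pick[OF k, of x y] xyz by auto
  have "f q \<noteq> x" if "h < q" "q < i" for q
    using adjacent_gaps(3)[OF mc h c(1) _ _ that _ px] plain[OF xyz(1)] leaf by blast
  then obtain oy where oy: "h < oy" "oy < i" "f oy = y" using pick[OF h, of x y] xyz by auto
  note py2 = plain[OF xyz(2)]
  note A = adjacent_gaps[OF mc c(1) k conjunct1[OF py2] conjunct2[OF py2] py qy]
  note B = adjacent_gaps[OF mc h c(1) conjunct1[OF py2] conjunct2[OF py2] oy py]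
  obtain e1 where e1: "py < e1" "e1 < qy" "adj y (f e1)" "f e1 \<noteq> c" using A(3) by blast
  obtain e2 where e2: "oy < e2" "e2 < py" "adj y (f e2)" "f e2 \<noteq> c" using B(3) by blast
  define y2 where "y2 = f e1"
  have fe: "f e1 = y2" "f e2 = y2" using plain_unique[of c y] py2 e1 e2 unfolding y2_def by blast+
  have y2: "adj y y2" "y2 \<noteq> c" using e1 unfolding y2_def by auto
  have pl: "plain y y2" using plain_turn[OF conjunct1[OF py2] y2] .
  have pl2: "m y2 y = 3" using plain_label[OF conjunct1[OF py2] y2] adj_label_sym[OF y2(1)] by simp
  have hn: "i < h + int n" using multi_consec mc h by blast
  then have "j \<le> h + int n" using consec_le[OF c(1)] period[of h] h unfolding consec_def by auto
  then have "py < oy + int n" using oy py by simp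
  then have "qy \<le> oy + int n" using consec_le[OF A(1)] period[of oy] oy by simp
  then have en: "e1 < e2 + int n" using e1 e2 by simp
  have "consec y2 e2 e1" unfolding consec_def
  proof (intro conjI allI impI)
    fix l assume l: "e2 < l \<and> l < e1"
    consider "l < py" | "l = py" | "py < l" by linarith
    then show "f l \<noteq> y2"
    proof cases
      case 1
      then show ?thesis using plain_once[OF pl B(1), of e2 l] B(2) e2 fe l by auto
    next
      case 2
      then show ?thesis using py y2 adj_irrefl by auto
    next
      case 3
      then show ?thesis using plain_once[OF pl A(1), of l e1] A(2) e1 fe l by auto
    qed
  qed (use e1 e2 fe in auto)
  then obtain k l where kl: "e2 < k" "k < l" "l < e1" "adj y2 (f k)" "adj y2 (f l)"
    using two_neighbours[OF _ en] pl2 short[OF y2] by blast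
  then have "f k = y" "f l = y" using short[OF y2] by auto
  moreover have "x = py" if "oy < x" "x < qy" "f x = y" for x
    using consec_ge[OF A(1) that(3,2)] consec_le[OF B(1) that(3,1)] by simp
  from this[of k] this[of l] have "\<lbrakk>f k = y; f l = y\<rbrakk> \<Longrightarrow> k = l" using kl e1 e2 by simp
  ultimately show False using kl by simp
qed

text \<open>Any repetition spreads inwards to \<open>c\<close>. Excluding affine E6 makes one arm a
  single vertex, and excluding affine E7 leaves another arm with at most two, as
  \<open>tripod_core\<close> requires.\<close>

lemma tripod_not_multi:
  assumes xyz: "adj c x" "adj c y" "adj c z" "x \<noteq> y" "x \<noteq> z" "y \<noteq> z"
  shows "\<not> multi s"
proof
  assume ms: "multi s"
  have nb: "r = x \<or> r = y \<or> r = z" if "adj c r" for r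
    using no_two_ends[of "[x, y]" c "[z, r]"] xyz that by auto
  have ft: "feature r c" if "adj c r" for r
    using nb[OF that] xyz unfolding feature_def by auto
  have plain: "plain c r \<and> m c r = 3" if "adj c r" for r
    using plain_of_feature[OF that ft[OF that]] label_of_feature[OF that ft[OF that]] by blast
  have mc: "multi c"
  proof (cases "s = c")
    case False
    have "s \<in> S" using ms f_in_S unfolding multi_def by blast
    moreover have "c \<in> S" using xyz by (simp add: adj_def)
    ultimately obtain r p where "adj c r" "turn\<^sup>*\<^sup>* (c, r) (p, s)" using reach False by blast
    then show ?thesis using plain_chain_grow plain ms tri_multi by blast
  qed (use ms in simp)
  define leaf where "leaf v \<longleftrightarrow> (\<forall>r. adj v r \<longrightarrow> r = c)" for v
  define short where "short v \<longleftrightarrow> (\<forall>r r'. adj v r \<longrightarrow> r \<noteq> c \<longrightarrow> adj r r' \<longrightarrow> r' = v)" for v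
  have core: "\<not> (leaf a \<and> short b)" if "{a, b, d} = {x, y, z}" "a \<noteq> b" "a \<noteq> d" "b \<noteq> d" for a b d
  proof
    assume ab: "leaf a \<and> short b"
    have "a \<in> {x, y, z}" "b \<in> {x, y, z}" "d \<in> {x, y, z}" using that(1) by blast+
    then have "adj c a" "adj c b" "adj c d" using xyz by auto
    moreover have "r = a \<or> r = b \<or> r = d" if "adj c r" for r
      using nb[OF that] \<open>{a, b, d} = {x, y, z}\<close> by blast
    ultimately show False
      using tripod_core[of c a b d] that(2-4) plain mc ab unfolding leaf_def short_def by blast
  qed
  \<comment> \<open>Two arms of length at least 3 and any third arm contain the graph of affine
    E7.\<close>
  have long: "short b \<or> short d" if "{a, b, d} = {x, y, z}" "a \<noteq> b" "a \<noteq> d" "b \<noteq> d" for a b d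
  proof (rule ccontr)
    assume n: "\<not> ?thesis"
    have "a \<in> {x, y, z}" "b \<in> {x, y, z}" "d \<in> {x, y, z}" using that(1) by blast+
    then have adj: "adj c a" "adj c b" "adj c d" using xyz by auto
    from n obtain b2 b3 d2 d3 where "adj b b2" "b2 \<noteq> c" "adj b2 b3" "b3 \<noteq> b" "adj d d2" "d2 \<noteq> c" "adj d2 d3" "d3 \<noteq> d"
      unfolding short_def by blast
    then show False using no_tripod_133[of a c b b2 b3 d d2 d3] adj that(2-4) adj_sym by auto
  qed
  have "leaf x \<or> leaf y \<or> leaf z"
  proof (rule ccontr)
    assume "\<not> ?thesis"
    then obtain x2 y2 z2 where "adj x x2" "x2 \<noteq> c" "adj y y2" "y2 \<noteq> c" "adj z z2" "z2 \<noteq> c"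
      unfolding leaf_def by blast
    then show False using no_tripod_222[of x2 x c y y2 z z2] xyz adj_sym by auto
  qed
  then show False
    using core[of x y z] core[of x z y] core[of y x z] core[of y z x] core[of z x y] core[of z y x]
      long[of x y z] long[of y x z] long[of z x y] xyz(4-6) by (auto simp: insert_commute)
qed

lemma heavy_branch:
  assumes "adj a b" "4 \<le> m a b" "adj b r" "r \<noteq> a" shows "plain b r" "m b r = 3"
  using plain_turn[OF plain_of_heavy[OF assms(1,2)] assms(3,4)]
    plain_label[OF plain_of_heavy[OF assms(1,2)] assms(3,4)] by auto

text \<open>A gap of \<open>b\<close> without \<open>a\<close> would need two occurrences of the one
  remaining neighbour. Two \<open>a\<close> in a gap are impossible because \<open>plain b a\<close>
  restricts only what lies beyond \<open>a\<close>, not the label of the edge.\<close>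

lemma heavy_gap:
  assumes h: "adj a b" "4 \<le> m a b" and mb: "multi b" and c: "consec b i j"
  shows "\<exists>k. i < k \<and> k < j \<and> f k = a \<and> (\<forall>l. i < l \<longrightarrow> l < j \<longrightarrow> f l = a \<longrightarrow> l = k)"
proof -
  have jn: "j < i + int n" using multi_consec mb c by blast
  have h': "adj b a" "4 \<le> m b a" using h adj_sym adj_label_sym[OF h(1)] by auto
  have "\<exists>k. i < k \<and> k < j \<and> f k = a"
  proof (rule ccontr)
    assume n: "\<not> ?thesis"
    have na: "f k \<noteq> a" if "i < k" "k < j" for k using n that by blast
    obtain k l where kl: "i < k" "k < l" "l < j" "adj b (f k)" "adj b (f l)"
      using two_neighbours[OF c jn] heavy_branch(2)[OF h] na by blast
    have "f l = f k" using plain_unique[OF plain_of_heavy[OF h] kl(5) _ kl(4)] kl na by simp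
    then have "k = l" using plain_once[OF heavy_branch(1)[OF h kl(4)] c, of k l] kl na jn by auto
    then show False using kl by simp
  qed
  then show ?thesis using plain_once[OF plain_of_heavy[OF h'] c] jn by auto
qed

lemma heavy_multi:
  assumes "adj a b" "4 \<le> m a b" "multi b" shows "multi a"
proof (rule multi_from_gaps[OF assms(3)])
  fix i j assume "consec b i j"
  from heavy_gap[OF assms this] show "\<exists>k. i < k \<and> k < j \<and> f k = a" by blast
qed

lemma heavy_reach:
  assumes h: "adj a b" "4 \<le> m a b" and s: "multi s" "s \<noteq> a" "s \<noteq> b"
  shows "(\<exists>r. adj b r \<and> r \<noteq> a \<and> tri b) \<or> (\<exists>r. adj a r \<and> r \<noteq> b \<and> tri a)"
proof -
  have h': "adj b a" "4 \<le> m b a" using h adj_sym adj_label_sym[OF h(1)] by auto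
  have "s \<in> S" "a \<in> S" using s(1) h f_in_S unfolding multi_def adj_def by blast+
  then obtain x p where x: "adj a x" "turn\<^sup>*\<^sup>* (a, x) (p, s)" using reach s(2) by blast
  show ?thesis
  proof (cases "x = b")
    case False
    then show ?thesis using plain_chain_grow[OF x(2) heavy_branch[OF h' x(1) False] s(1)] x by blast
  next
    case True
    from x(2) show ?thesis
    proof (cases rule: converse_rtranclpE)
      case base
      then show ?thesis using True s by simp
    next
      case (step e)
      then obtain r where "e = (b, r)" "adj b r" "r \<noteq> a" using True by (cases e) auto
      then show ?thesis using plain_chain_grow[OF _ heavy_branch[OF h, of r] s(1)] step(2) by blast
    qed
  qed
qed

text \<open>A gap of \<open>a\<close> whose only neighbour is \<open>b\<close> lies inside a pattern
  b a b a b at i0 < ... < i4. Since neither half may become a braid of four letters, both gaps of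
  \<open>b\<close> contain a further neighbour r. These two r enclose a single \<open>b\<close>, yet
  r has no other neighbour.\<close>

lemma heavy4_not_multi:
  assumes h: "adj a b" "m a b = 4"
    and short: "\<And>r r'. adj b r \<Longrightarrow> r \<noteq> a \<Longrightarrow> adj r r' \<Longrightarrow> r' = b"
  shows "\<not> multi b"
proof
  assume mb: "multi b"
  have h4: "4 \<le> m a b" using h by simp
  have h': "adj b a" "m b a = 4" "4 \<le> m b a" using h adj_sym adj_label_sym[OF h(1)] by auto
  have ma: "multi a" using heavy_multi[OF h(1) h4 mb] .
  have "\<exists>i j. consec a i j \<and> (\<forall>k. i < k \<and> k < j \<and> adj a (f k) \<longrightarrow> f k = b)"
  proof (cases "\<exists>r. adj a r \<and> r \<noteq> b")
    case True
    then obtain r where r: "adj a r" "r \<noteq> b" by blast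
    then obtain i j where ij: "consec a i j" "\<And>k. i < k \<Longrightarrow> k < j \<Longrightarrow> f k \<noteq> r"
      using plain_missing[OF heavy_branch[OF h'(1,3) r] ma] by blast
    have "f k = b" if "i < k" "k < j" "adj a (f k)" for k
      using plain_unique[OF plain_of_heavy[OF h'(1,3)] that(3) _ r] ij(2)[OF that(1,2)] by blast
    then show ?thesis using ij(1) by blast
  next
    case False
    obtain i where "f i = a" using ma unfolding multi_def by blast
    then show ?thesis using multi_next[OF ma] False by blast
  qed
  then obtain i1 i3 where c13: "consec a i1 i3" "\<And>k. i1 < k \<Longrightarrow> k < i3 \<Longrightarrow> adj a (f k) \<Longrightarrow> f k = b" by blast
  obtain i2 where i2: "i1 < i2" "i2 < i3" "f i2 = b" "\<And>l. i1 < l \<Longrightarrow> l < i3 \<Longrightarrow> f l = b \<Longrightarrow> l = i2"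
    using heavy_gap[OF h'(1,3) ma c13(1)] by blast
  have f13: "f i1 = a" "f i3 = a" "a \<noteq> b" using c13 h adj_irrefl by (auto simp: consec_def)
  obtain i4 where c24: "consec b i2 i4" using multi_next[OF mb i2(3)] by blast
  obtain i0 where c02: "consec b i0 i2" using multi_prev[OF mb i2(3)] by blast
  have f04: "f i0 = b" "f i4 = b" "i0 < i2" "i2 < i4" using c24 c02 by (auto simp: consec_def)
  have i34: "i3 < i4"
  proof (rule ccontr)
    assume "\<not> ?thesis"
    moreover have "i4 \<noteq> i3" using f04(2) f13(2,3) by metis
    ultimately have "i4 = i2" using i2(1) f04(2,4) by (intro i2(4)) simp_all
    then show False using f04(4) by simp
  qed
  have i01: "i0 < i1"
  proof (rule ccontr)
    assume "\<not> ?thesis"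
    moreover have "i0 \<noteq> i1" using f04(1) f13(1,3) by metis
    ultimately have "i0 = i2" using i2(2) f04(1,3) by (intro i2(4)) simp_all
    then show False using f04(3) by simp
  qed
  have i3n: "i3 < i1 + int n" using multi_consec ma c13 by blast
  have "f (i1 + int n) = a" using period f13 by simp
  then obtain i5 where i5: "consec a i3 i5" "i5 \<le> i1 + int n" using consec_between[of i3 _ a] i3n f13 by blast
  obtain l where "i3 < l" "l < i5" "f l = b" using heavy_gap[OF h'(1,3) ma i5(1)] by blast
  \<comment> \<open>The gap of \<open>a\<close> after \<open>i3\<close> ends within one period of
    \<open>i1\<close> and contains a \<open>b\<close>, so \<open>i4\<close> comes before its
    end.\<close>
  then have i4n: "i4 < i1 + int n" using consec_le[OF c24, of l] i2(1-3) i5(2) by simp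
  have "f (i0 + int n) = b" "i2 < i0 + int n" using period f04 multi_consec[OF mb c02] by auto
  then have i4n0: "i4 \<le> i0 + int n" using consec_le[OF c24] by simp
  have noa: "f k \<noteq> a \<and> \<not> adj a (f k)" if "i1 < k" "k < i3" "k \<noteq> i2" for k
    using c13(1) c13(2)[of k] i2(4)[of k] that unfolding consec_def by blast
  have "\<exists>k. i2 < k \<and> k < i4 \<and> k \<noteq> i3 \<and> adj b (f k)"
  proof (rule ccontr)
    assume "\<not> ?thesis"
    then have nb: "f k \<noteq> b \<and> \<not> adj b (f k)" if "i2 < k" "k < i4" "k \<noteq> i3" for k
      using c24 that unfolding consec_def by blast
    show False
      by (rule chain_rule4[OF i2(1,2) i34 i4n f13(1) i2(3) f13(2) f04(2) h(2)]) (fact noa nb)+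
  qed
  then obtain k where k: "i2 < k" "k < i4" "k \<noteq> i3" "adj b (f k)" by blast
  have "\<exists>k. i0 < k \<and> k < i2 \<and> k \<noteq> i1 \<and> adj b (f k)"
  proof (rule ccontr)
    assume "\<not> ?thesis"
    then have nb: "f k \<noteq> b \<and> \<not> adj b (f k)" if "i0 < k" "k < i2" "k \<noteq> i1" for k
      using c02 that unfolding consec_def by blast
    have "i3 < i0 + int n" using i4n0 i34 by simp
    then show False
      by (rule chain_rule4[OF i01 i2(1,2) _ f04(1) f13(1) i2(3) f13(2) h'(2)]) (fact nb noa)+
  qed
  then obtain k' where k': "i0 < k'" "k' < i2" "k' \<noteq> i1" "adj b (f k')" by blast
  obtain x where "\<And>l. i2 < l \<Longrightarrow> l < i4 \<Longrightarrow> f l = a \<Longrightarrow> l = x" using heavy_gap[OF h(1) h4 mb c24] by blast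
  then have ka: "f k \<noteq> a" using k i2(2) i34 f13 by blast
  obtain x where "\<And>l. i0 < l \<Longrightarrow> l < i2 \<Longrightarrow> f l = a \<Longrightarrow> l = x" using heavy_gap[OF h(1) h4 mb c02] by blast
  then have ka': "f k' \<noteq> a" using k' i2(1) i01 f13 by blast
  define r where "r = f k"
  have r: "f k = r" "f k' = r" "adj b r" "r \<noteq> a"
    using plain_unique[OF plain_of_heavy[OF h(1) h4]] k k' ka ka' unfolding r_def by blast+
  have pr: "plain b r" "m r b = 3"
    using heavy_branch[OF h(1) h4 r(3,4)] adj_label_sym[OF r(3)] by auto
  have n24: "i4 \<le> i2 + int n" "i2 \<le> i0 + int n" using consec_period c24 c02 by blast+
  have "consec r k' k" unfolding consec_def
  proof (intro conjI allI impI)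
    fix l assume l: "k' < l \<and> l < k"
    consider "l < i2" | "l = i2" | "i2 < l" by linarith
    then show "f l \<noteq> r"
    proof cases
      case 1
      then show ?thesis using plain_once[OF pr(1) c02 n24(2), of k' l] k' r l by auto
    next
      case 2
      then show ?thesis using i2(3) r adj_irrefl by auto
    next
      case 3
      then show ?thesis using plain_once[OF pr(1) c24 n24(1), of l k] k r l by auto
    qed
  qed (use k k' r in auto)
  moreover have "k < k' + int n" using i4n0 k k' by simp
  ultimately obtain p q where pq: "k' < p" "p < q" "q < k" "adj r (f p)" "adj r (f q)"
    using two_neighbours[of r k' k] pr(2) short[OF r(3,4)] by blast
  then have "f p = b" "f q = b" using short[OF r(3,4)] by auto
  moreover have "x = i2" if "i0 < x" "x < i4" "f x = b" for x
    using consec_le[OF c02 that(3,1)] consec_ge[OF c24 that(3,2)] by simp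
  from this[of p] this[of q] have "\<lbrakk>f p = b; f q = b\<rbrakk> \<Longrightarrow> p = q" using pq k k' by simp
  ultimately show False using pq by simp
qed

text \<open>A gap of \<open>b\<close> that misses \<open>r\<close> contains only \<open>a\<close>.
  As \<open>a\<close> is a leaf, the pattern a b a b a around that gap becomes a braid, provided
  that it fits into one period.\<close>

lemma heavy5_not_tri:
  assumes h: "adj a b" "m a b = 5" and leaf: "\<And>r. adj a r \<Longrightarrow> r = b" and r: "adj b r" "r \<noteq> a"
  shows "\<not> tri b"
proof
  assume tb: "tri b"
  have mb: "multi b" using tri_multi tb by blast
  have h4: "4 \<le> m a b" using h by (simp add: numeral_eq_enat)
  have h': "adj b a" "4 \<le> m b a" using h4 h(1) adj_sym adj_label_sym[OF h(1)] by auto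
  have ma: "multi a" using heavy_multi[OF h(1) h4 mb] .
  obtain i2 i4 where c24: "consec b i2 i4" "\<And>k. i2 < k \<Longrightarrow> k < i4 \<Longrightarrow> f k \<noteq> r"
    using plain_missing[OF heavy_branch[OF h(1) h4 r] mb] by blast
  obtain i3 where i3: "i2 < i3" "i3 < i4" "f i3 = a" "\<And>l. i2 < l \<Longrightarrow> l < i4 \<Longrightarrow> f l = a \<Longrightarrow> l = i3"
    using heavy_gap[OF h(1) h4 mb c24(1)] by blast
  have f24: "f i2 = b" "f i4 = b" "a \<noteq> b" using c24 h adj_irrefl by (auto simp: consec_def)
  obtain i5 where c35: "consec a i3 i5" using multi_next[OF ma i3(3)] by blast
  obtain i1 where c13: "consec a i1 i3" using multi_prev[OF ma i3(3)] by blast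
  have f15: "f i1 = a" "f i5 = a" "i1 < i3" "i3 < i5" using c13 c35 by (auto simp: consec_def)
  have i12: "i1 < i2"
  proof (rule ccontr)
    assume "\<not> ?thesis"
    moreover have "i1 \<noteq> i2" using f15(1) f24(1,3) by metis
    ultimately have "i1 = i3" using i3(2) f15(1,3) by (intro i3(4)) simp_all
    then show False using f15(3) by simp
  qed
  have i45: "i4 < i5"
  proof (rule ccontr)
    assume "\<not> ?thesis"
    moreover have "i4 \<noteq> i5" using f15(2) f24(2,3) by metis
    ultimately have "i5 = i3" using i3(1) f15(2,4) by (intro i3(4)) simp_all
    then show False using f15(4) by simp
  qed
  have b: "k = i2 \<or> k = i4" if "i1 < k" "k < i5" "f k = b" for k
  proof -
    have "k \<noteq> i3" using that i3(3) f24 by auto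
    obtain x where x: "\<And>l. i1 < l \<Longrightarrow> l < i3 \<Longrightarrow> f l = b \<Longrightarrow> l = x" using heavy_gap[OF h' ma c13] by blast
    obtain y where y: "\<And>l. i3 < l \<Longrightarrow> l < i5 \<Longrightarrow> f l = b \<Longrightarrow> l = y" using heavy_gap[OF h' ma c35] by blast
    show ?thesis
      using x[of k] x[of i2] y[of k] y[of i4] that i12 i3(1-3) i45 f24 \<open>k \<noteq> i3\<close> by (cases "k < i3") auto
  qed
  \<comment> \<open>Here the third \<open>b\<close> is used: if the pattern did not fit, all
    occurrences of \<open>b\<close> in a period would be at \<open>i2\<close> and
    \<open>i4\<close>.\<close>
  have "i5 < i1 + int n"
  proof (rule ccontr)
    assume n: "\<not> ?thesis"
    obtain p q s where pqs: "p < q" "q < s" "s < p + int n" "f p = b" "f q = b" "f s = b"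
      using tb unfolding tri_def by blast
    have in2: "shift_to i1 x = i2 \<or> shift_to i1 x = i4" if "f x = b" for x
    proof (rule b)
      have "shift_to i1 x \<noteq> i1" using shift_to(3)[of i1 x] that f15 f24 by metis
      then show "i1 < shift_to i1 x" using shift_to(1)[of i1 x] by simp
      show "shift_to i1 x < i5" using shift_to(2)[of i1 x] n by simp
      show "f (shift_to i1 x) = b" using shift_to(3) that by simp
    qed
    have "shift_to i1 p \<noteq> shift_to i1 q" "shift_to i1 q \<noteq> shift_to i1 s" "shift_to i1 p \<noteq> shift_to i1 s"
      using shift_to_inj[of p q i1] shift_to_inj[of q s i1] shift_to_inj[of p s i1] pqs(1-3) by simp_all
    then show False using in2[OF pqs(4)] in2[OF pqs(5)] in2[OF pqs(6)] by auto
  qed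
  then show False
  proof (rule chain_rule5[OF i12 i3(1,2) i45 _ f15(1) f24(1) i3(3) f24(2) f15(2) h(2)])
    fix k assume k: "i1 < k" "k < i5" "k \<noteq> i2" "k \<noteq> i3" "k \<noteq> i4"
    have "f k \<noteq> a" using consec_le[OF c13, of k] consec_ge[OF c35, of k] k by auto
    moreover have "f k \<noteq> b" using b k by blast
    ultimately show "f k \<noteq> a \<and> \<not> adj a (f k)" using leaf by blast
  next
    fix k assume k: "i2 < k" "k < i4" "k \<noteq> i3"
    have "f k \<noteq> b" using c24 k unfolding consec_def by blast
    moreover have "f k \<noteq> a" using i3(4) k by blast
    ultimately show "f k \<noteq> b \<and> \<not> adj b (f k)"
      using plain_unique[OF plain_of_heavy[OF h(1) h4], of "f k" r] c24(2)[of k] k r by blast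
  qed
qed

end

lemma enat_ge_Suc: "enat k \<le> x \<Longrightarrow> x \<noteq> enat k \<Longrightarrow> enat (Suc k) \<le> x"
  by (cases x) auto

context cyclic_word
begin

text \<open>With label 4 the path cannot extend by two vertices on both sides, so
  \<open>heavy4_not_multi\<close> applies to one of the two ends. Both ends are repeated.\<close>

lemma heavy_ge_5:
  assumes h: "adj a b" "4 \<le> m a b" and mb: "multi b" shows "5 \<le> m a b"
proof -
  have "m a b \<noteq> 4"
  proof
    assume 4: "m a b = 4"
    have h': "adj b a" "m b a = 4" using h 4 adj_sym adj_label_sym[OF h(1)] by auto
    have "\<not> multi b \<or> \<not> multi a"
    proof (cases "\<forall>r r'. adj b r \<longrightarrow> r \<noteq> a \<longrightarrow> adj r r' \<longrightarrow> r' = b")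
      case True
      then show ?thesis using heavy4_not_multi[OF h(1) 4] by blast
    next
      case False
      then obtain b2 b3 where b: "adj b b2" "b2 \<noteq> a" "adj b2 b3" "b3 \<noteq> b" by blast
      have "r' = a" if r: "adj a r" "r \<noteq> b" "adj r r'" for r r'
      proof (rule ccontr)
        assume "r' \<noteq> a"
        then have "nb_walk [r', r, a, b, b2, b3]" using b r h(1) adj_sym by auto
        then show False using no_4_in_path6 h(2) by blast
      qed
      then show ?thesis using heavy4_not_multi[OF h'] by blast
    qed
    then show False using mb heavy_multi[OF h mb] by blast
  qed
  then show ?thesis using enat_ge_Suc[of 4 "m a b"] h(2) by (simp add: numeral_eq_enat)
qed

text \<open>A label of at least 5 leaves no further vertex on one side, and one of at least 6 leaves
  none on either side. Label 5 with a further vertex is type H.\<close>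

lemma heavy_cases:
  assumes h: "adj a b" "4 \<le> m a b" and mb: "multi b"
  shows "S = {a, b} \<or> (m a b = 5 \<and> (\<forall>r. adj a r \<longrightarrow> r = b) \<and> \<not> tri b) \<or>
    (m a b = 5 \<and> (\<forall>r. adj b r \<longrightarrow> r = a) \<and> \<not> tri a)"
proof -
  have h5: "5 \<le> m a b" using heavy_ge_5[OF h mb] .
  have h': "adj b a" "m b a = m a b" using h adj_sym adj_label_sym[OF h(1)] by auto
  have is5: "m a b = 5" if "\<not> 6 \<le> m a b"
    using enat_ge_Suc[of 5 "m a b"] h5 that by (auto simp: numeral_eq_enat)
  show ?thesis
  proof (cases "\<exists>r. adj a r \<and> r \<noteq> b")
    case True
    then obtain a2 where a2: "adj a a2" "a2 \<noteq> b" by blast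
    have b: "r = a" if "adj b r" for r
      using no_5_in_path4[of a2 a b r] h5 a2 h(1) that adj_sym by auto
    have "m a b = 5" using is5 no_6_in_path3[of b a a2] h' a2 by auto
    then show ?thesis using b heavy5_not_tri[OF h'(1) _ _ a2] h'(2) by auto
  next
    case False
    show ?thesis
    proof (cases "\<exists>r. adj b r \<and> r \<noteq> a")
      case True
      then obtain b2 where b2: "adj b b2" "b2 \<noteq> a" by blast
      have "m a b = 5" using is5 no_6_in_path3[of a b b2] h b2 by auto
      then show ?thesis using False heavy5_not_tri[OF h(1) _ _ b2] by auto
    next
      case F: False
      have "q = b" if q: "q \<in> S" "q \<noteq> a" for q
      proof -
        have "a \<in> S" using h by (simp add: adj_def)
        then obtain x p where x: "adj a x" "turn\<^sup>*\<^sup>* (a, x) (p, q)" using reach q by blast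
        then have "x = b" using False by blast
        from x(2) show ?thesis
        proof (cases rule: converse_rtranclpE)
          case base
          then show ?thesis using \<open>x = b\<close> by simp
        next
          case (step e)
          then have "adj b (snd e) \<and> snd e \<noteq> a" using \<open>x = b\<close> by (cases e) auto
          then show ?thesis using F by blast
        qed
      qed
      then have "S = {a, b}" using h by (auto simp: adj_def)
      then show ?thesis ..
    qed
  qed
qed

lemma multi_structure:
  assumes ms: "multi s"
  shows "\<exists>t. adj s t \<and> 5 \<le> m s t \<and> multi t \<and> (\<forall>i j. consec s i j \<longrightarrow> (\<exists>k. i < k \<and> k < j \<and> f k = t)) \<and>
    (\<forall>i j. consec t i j \<longrightarrow> (\<exists>k. i < k \<and> k < j \<and> f k = s)) \<and>
    (S = {s, t} \<or> m s t = 5 \<and> (\<not> tri s \<or> \<not> tri t))"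
proof -
  have "\<exists>a b. adj a b \<and> 4 \<le> m a b"
  proof (rule ccontr)
    assume "\<not> ?thesis"
    then have "\<And>s t. adj s t \<Longrightarrow> m s t = 3" using label_3_or_ge_4 by blast
    moreover have "x = y \<or> y = z \<or> x = z" if "adj c x" "adj c y" "adj c z" for c x y z
      using tripod_not_multi[of c x y z s] that ms by blast
    ultimately show False using unbranched_not_multi[of s] ms by blast
  qed
  then obtain a b where h: "adj a b" "4 \<le> m a b" by blast
  have h': "adj b a" "4 \<le> m b a" using h adj_sym adj_label_sym[OF h(1)] by auto
  \<comment> \<open>A repetition away from the heavy edge would produce three occurrences of an end
    with a further neighbour, against every case of \<open>heavy_cases\<close>.\<close>
  have "s = a \<or> s = b"
  proof (rule ccontr)
    assume n: "\<not> ?thesis"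
    have "s \<in> S" using ms f_in_S unfolding multi_def by blast
    consider r where "adj b r" "r \<noteq> a" "tri b" | r where "adj a r" "r \<noteq> b" "tri a"
      using heavy_reach[OF h ms] n by blast
    then show False
    proof cases
      case 1
      then show False using heavy_cases[OF h] tri_multi n \<open>s \<in> S\<close> by blast
    next
      case 2
      then show False using heavy_cases[OF h'] tri_multi n \<open>s \<in> S\<close> by blast
    qed
  qed
  moreover have main: ?thesis if h: "adj s t" "4 \<le> m s t" for t
  proof -
    have h': "adj t s" "4 \<le> m t s" using h adj_sym adj_label_sym[OF h(1)] by auto
    have mt: "multi t" using heavy_multi[OF h' ms] .
    have "S = {s, t} \<or> m s t = 5 \<and> (\<not> tri s \<or> \<not> tri t)" using heavy_cases[OF h mt] by blast
    moreover have "\<exists>k. i < k \<and> k < j \<and> f k = t" if "consec s i j" for i j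
      using heavy_gap[OF h' ms that] by blast
    moreover have "\<exists>k. i < k \<and> k < j \<and> f k = s" if "consec t i j" for i j
      using heavy_gap[OF h mt that] by blast
    ultimately show ?thesis using h heavy_ge_5[OF h mt] mt by blast
  qed
  ultimately show ?thesis using h h' by blast
qed

end

section \<open>Alternation and counting in the finite word\<close>

lemma not_distinct_adj_filter:
  assumes "\<not> distinct_adj (filter P xs)"
  shows "\<exists>i j. i < j \<and> j < length xs \<and> xs ! i = xs ! j \<and> P (xs ! i) \<and> (\<forall>k. i < k \<and> k < j \<longrightarrow> \<not> P (xs ! k))"
  using assms
proof (induction xs)
  case (Cons x xs)
  show ?case
  proof (cases "distinct_adj (filter P xs)")
    case False
    then obtain i j where ij: "i < j" "j < length xs" "xs ! i = xs ! j" "P (xs ! i)"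
      "\<forall>k. i < k \<and> k < j \<longrightarrow> \<not> P (xs ! k)" using Cons.IH by blast
    then have "\<not> P ((x # xs) ! k)" if "Suc i < k \<and> k < Suc j" for k
      using that by (cases k) auto
    then show ?thesis using ij by (intro exI[of _ "Suc i"] exI[of _ "Suc j"]) auto
  next
    case True
    then have px: "P x" using Cons.prems by (auto split: if_splits)
    then have hd: "filter P xs \<noteq> []" "hd (filter P xs) = x" using Cons.prems True
      by (auto simp: distinct_adj_Cons)
    then obtain ys zs where "xs = ys @ x # zs" "\<forall>y \<in> set ys. \<not> P y"
      by (cases "filter P xs") (auto simp: filter_eq_Cons_iff)
    then show ?thesis using px
      by (intro exI[of _ 0] exI[of _ "Suc (length ys)"]) (auto simp: nth_Cons' nth_append)
  qed
qed simp

lemma distinct_adj_alt: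
  "distinct_adj (x # F) \<Longrightarrow> set (x # F) \<subseteq> {x, y} \<Longrightarrow> x # F = alt (length (x # F)) x y"
proof (induction F arbitrary: x y)
  case (Cons z F)
  then have "z = y" by (auto simp: distinct_adj_Cons)
  then show ?case using Cons.IH[of y x] Cons.prems by (auto simp: distinct_adj_Cons)
qed simp

lemma last_alt_odd: "last (alt (Suc (2 * k)) x y) = x"
  by (induction k) (auto simp: last_conv_nth)

text \<open>Where the two copies of \<open>F\<close> meet, its last letter differs from its first,
  so the length is even.\<close>

lemma distinct_adj_cyclic_alt:
  assumes d: "distinct_adj (F @ F)" and F: "set F \<subseteq> {x, y}" "hd F = x" "F \<noteq> []"
  shows "\<exists>k. F = alt (2 * k) x y"
proof -
  obtain G where G: "F = x # G" using F by (cases F) auto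
  have "distinct_adj F" using d by (simp add: distinct_adj_append_iff)
  then have e: "F = alt (length F) x y" using distinct_adj_alt[of x G y] F unfolding G by blast
  have "last F \<noteq> x" using d F by (auto simp: distinct_adj_append_iff)
  then have "even (length F)" using e last_alt_odd by (metis oddE Suc_eq_plus1)
  then show ?thesis using e by (metis evenE)
qed

lemma count_list_alt: "x \<noteq> y \<Longrightarrow> count_list (alt (2 * k) x y) x = k \<and> count_list (alt (2 * k) x y) y = k"
  by (induction k) auto

lemma alt_prefix: "\<exists>z. alt (q + r) x y = alt q x y @ z"
  by (induction q arbitrary: x y) auto

lemma count_list_filter_self: "P x \<Longrightarrow> count_list (filter P u) x = count_list u x"
  by (induction u) auto

lemma count_list_positions: "count_list u x = card {i. i < length u \<and> u ! i = x}"
  by (simp add: count_list_eq_length_filter length_filter_conv_card eq_commute)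

lemma three_increasing:
  fixes A :: "nat set"
  assumes "3 \<le> card A" shows "\<exists>i j k. i < j \<and> j < k \<and> {i, j, k} \<subseteq> A"
proof -
  obtain B where "B \<subseteq> A" "card B = 3" using assms by (metis obtain_subset_with_card_n)
  then obtain x y z where "{x, y, z} \<subseteq> A" "x \<noteq> y" "y \<noteq> z" "x \<noteq> z" by (auto simp: card_3_iff)
  then show ?thesis by (metis insert_commute linorder_neqE_nat)
qed

lemma two_increasing:
  fixes A :: "nat set"
  assumes "2 \<le> card A" shows "\<exists>i j. i < j \<and> {i, j} \<subseteq> A"
proof -
  obtain B where "B \<subseteq> A" "card B = 2" using assms by (metis obtain_subset_with_card_n)
  then obtain x y where "{x, y} \<subseteq> A" "x \<noteq> y" by (auto simp: card_2_iff)
  then show ?thesis by (metis insert_commute linorder_neqE_nat)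
qed

context cfc_finite_graph
begin

lemma word_structure:
  assumes con: "\<And>s t. s \<in> S \<Longrightarrow> t \<in> S \<Longrightarrow> adj\<^sup>*\<^sup>* s t"
    and rot: "\<And>k. good (rotate k u)" and s: "2 \<le> count_list u s"
  shows "\<exists>t. adj s t \<and> 5 \<le> m s t \<and> enat (2 * count_list u s) < m s t \<and>
    count_list u t = count_list u s \<and> alternate_in s t u"
proof -
  define n where "n = length u"
  define f where "f i = u ! nat (i mod int n)" for i
  have n: "n > 0" using s unfolding n_def by (cases u) auto
  have fnat: "f (int i) = u ! (i mod n)" for i
    unfolding f_def by (simp add: zmod_int[symmetric] del: zmod_int)
  have win: "map f [i..i + int n - 1] = rotate (nat (i mod int n)) u" for i
  proof (rule nth_equalityI)
    fix k assume "k < length (map f [i..i + int n - 1])"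
    then have k: "k < n" by simp
    have "nat ((i + int k) mod int n) = (nat (i mod int n) + k) mod n"
    proof -
      have "int ((nat (i mod int n) + k) mod n) = (i mod int n + int k) mod int n"
        using n by (simp add: zmod_int)
      also have "\<dots> = (i + int k) mod int n" by (simp add: mod_add_left_eq)
      finally show ?thesis by simp
    qed
    then show "map f [i..i + int n - 1] ! k = rotate (nat (i mod int n)) u ! k"
      using k by (simp add: f_def nth_rotate n_def[symmetric])
  qed (simp add: n_def)
  interpret cyclic_word S m f n
  proof unfold_locales
    show "f (i + int n) = f i" for i unfolding f_def by simp
    show "good (map f [i..i + int n - 1])" for i unfolding win by (rule rot)
    show "0 < n" by (rule n)
    show "adj\<^sup>*\<^sup>* x y" if "x \<in> S" "y \<in> S" for x y using that by (rule con)
  qed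
  have pos: "\<exists>i j. i < j \<and> j < i + int n \<and> f i = x \<and> f j = x" if c: "2 \<le> count_list u x" for x
  proof -
    obtain i j where "i < j" "{i, j} \<subseteq> {i. i < length u \<and> u ! i = x}"
      using two_increasing c unfolding count_list_positions by blast
    then show ?thesis by (intro exI[of _ "int i"] exI[of _ "int j"]) (auto simp: fnat n_def)
  qed
  have tri: "tri x" if c: "3 \<le> count_list u x" for x
  proof -
    obtain i j k where "i < j" "j < k" "{i, j, k} \<subseteq> {i. i < length u \<and> u ! i = x}"
      using three_increasing c unfolding count_list_positions by blast
    then show ?thesis unfolding tri_def
      by (intro exI[of _ "int i"] exI[of _ "int j"] exI[of _ "int k"]) (auto simp: fnat n_def)
  qed
  have "multi s" using pos[OF s] unfolding multi_def by blast
  then obtain t where t: "adj s t" "5 \<le> m s t" "multi t"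
    "\<And>i j. consec s i j \<Longrightarrow> \<exists>k. i < k \<and> k < j \<and> f k = t"
    "\<And>i j. consec t i j \<Longrightarrow> \<exists>k. i < k \<and> k < j \<and> f k = s"
    "S = {s, t} \<or> m s t = 5 \<and> (\<not> tri s \<or> \<not> tri t)"
    using multi_structure by blast
  have st: "s \<noteq> t" using t adj_irrefl by blast
  define P where "P x \<longleftrightarrow> x = s \<or> x = t" for x
  define F where "F = filter P u"
  have uu: "(u @ u) ! i = f (int i)" if "i < length (u @ u)" for i
    using that unfolding fnat n_def by (auto simp: nth_append mod_if)
  \<comment> \<open>Doubling the word includes the gap across its end; this is what makes the two
    counts equal. Equal neighbours in the projection would bound a gap of \<open>s\<close> or
    \<open>t\<close> without the other.\<close>
  have dist: "distinct_adj (F @ F)"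
  proof (rule ccontr)
    assume "\<not> ?thesis"
    then have "\<not> distinct_adj (filter P (u @ u))" unfolding F_def by simp
    then obtain i j where ij: "i < j" "j < length (u @ u)" "(u @ u) ! i = (u @ u) ! j" "P ((u @ u) ! i)"
      "\<forall>k. i < k \<and> k < j \<longrightarrow> \<not> P ((u @ u) ! k)" using not_distinct_adj_filter by blast
    define x where "x = f (int i)"
    have x: "f (int i) = x" "f (int j) = x" "P x" using ij uu[of i] uu[of j] unfolding x_def by auto
    have no: "\<not> P (f k)" if "int i < k" "k < int j" for k
    proof -
      define l where "l = nat k"
      have l: "k = int l" "i < l" "l < j" using that unfolding l_def by auto
      have "l < length (u @ u)" using l(3) ij(2) by (rule less_trans)
      then show ?thesis using ij(5) uu[of l] l by metis
    qed
    have "f k \<noteq> x" if "int i < k" "k < int j" for k using no[OF that] x(3) by metis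
    then have "consec x (int i) (int j)" unfolding consec_def using x ij(1) by auto
    then have "\<exists>k. int i < k \<and> k < int j \<and> P (f k)" using t(4,5) x(3) unfolding P_def by metis
    then show False using no by blast
  qed
  have cF: "count_list F s = count_list u s" "count_list F t = count_list u t"
    unfolding F_def P_def by (simp_all add: count_list_filter_self)
  have Fne: "F \<noteq> []" using cF s by auto
  have FP: "set F \<subseteq> {s, t}" unfolding F_def P_def by auto
  then have "hd F \<in> {s, t}" using Fne hd_in_set by blast
  then obtain x y where xy: "{x, y} = {s, t}" "hd F = x" by auto
  have "set F \<subseteq> {x, y}" using FP xy(1) by simp
  then obtain k where k: "F = alt (2 * k) x y" using distinct_adj_cyclic_alt[OF dist _ xy(2) Fne] by blast
  have "x \<noteq> y" using xy(1) st by (auto simp: doubleton_eq_iff)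
  then have ck: "count_list u s = k" "count_list u t = k"
    using count_list_alt[of x y k] cF xy(1) unfolding k by (auto simp: doubleton_eq_iff)
  have "enat (2 * k) < m s t"
    using t(6)
  proof (elim disjE)
    \<comment> \<open>In rank two \<open>u\<close> is the alternating word of length 2k itself, so
      it would contain the braid if the label were at most 2k.\<close>
    assume S: "S = {s, t}"
    have gu: "good u" using rot[of 0] by simp
    have "filter P u = u" using good_lists[OF gu] unfolding S P_def by (auto simp: filter_id_conv)
    then have u: "u = alt (2 * k) x y" using k unfolding F_def by simp
    have mxy: "m x y = m s t" using xy(1) adj_label_sym[OF t(1)] by (auto simp: doubleton_eq_iff)
    obtain q where q: "m s t = enat q" using label_finite[OF t(1)] by (cases "m s t") auto
    have "\<not> q \<le> 2 * k"
    proof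
      assume "q \<le> 2 * k"
      then obtain r where "2 * k = q + r" using le_Suc_ex by blast
      then obtain z where "u = [] @ alt q x y @ z" using u alt_prefix by fastforce
      moreover have "3 \<le> q" using t(2) q by (simp add: numeral_eq_enat)
      ultimately have "has_braid u" using has_braid_alt[of x y q "[]" z] mxy q by simp
      then show False using gu unfolding good_def by auto
    qed
    then show ?thesis using q by simp
  next
    \<comment> \<open>One of the two occurs at most twice and the counts agree, so 2k is at most
      4.\<close>
    assume 5: "m s t = 5 \<and> (\<not> tri s \<or> \<not> tri t)"
    then have "\<not> 3 \<le> k" using tri[of s] tri[of t] ck by auto
    then show ?thesis using 5 by (simp add: numeral_eq_enat)
  qed
  moreover have "alternate_in s t u"
    using dist unfolding alternate_in_def F_def P_def by (simp add: distinct_adj_append_iff)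
  ultimately show ?thesis using t(1,2) ck by auto
qed

end

section \<open>Transfer to the Coxeter system\<close>

lemma coxeter_groupI:
  assumes "coxeter_system W S m" shows "coxeter_group W S m"
proof -
  have h: "finite S" "has_presentation W S (coxeter_relators S m)"
    "\<And>s t. s \<in> S \<Longrightarrow> t \<in> S \<Longrightarrow> m s t = m t s \<and> 1 \<le> m s t \<and> (m s t = 1 \<longleftrightarrow> s = t)"
    using assms unfolding coxeter_system_def by blast+
  interpret group W using h(2) unfolding has_presentation_def by blast
  show ?thesis by unfold_locales (use h in auto)
qed

theorem corollary5p6:
  fixes W :: "('a, 'b) monoid_scheme" and S :: "'a set" and m :: "'a \<Rightarrow> 'a \<Rightarrow> enat"
    and w s :: 'a
  assumes "coxeter_system W S m"
    and "coxeter_irreducible S m"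
    and "CFC_finite W S m"
    and "w \<in> CFC W S m"
    and "s \<in> S"
    and "\<exists>u. reduced_expression W S u w \<and> count_list u s > 1"
  shows "(\<exists>!t. t \<in> S \<and> m s t \<ge> 5) \<and>
    (\<forall>t \<in> S. m s t \<ge> 5 \<longrightarrow>
      (\<exists>j. enat (2 * j) < m s t \<and>
        (\<forall>v. reduced_expression W S v w \<longrightarrow>
          count_list v s = j \<and> count_list v t = j \<and> alternate_in s t v)))"
proof -
  interpret coxeter_group W S m using assms(1) by (rule coxeter_groupI)
  interpret cfc_finite_graph S m
    by unfold_locales (use infinite_CFC assms(3) in \<open>auto simp: CFC_finite_def\<close>)
  have con: "adj\<^sup>*\<^sup>* x y" if "x \<in> S" "y \<in> S" for x y
  proof -
    have "coxeter_edges S m = {(x, y). adj x y}" unfolding coxeter_edges_def adj_def by auto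
    then have "(x, y) \<in> {(x, y). adj x y}\<^sup>*"
      using assms(2) that unfolding coxeter_irreducible_def by auto
    then show ?thesis by (simp add: rtranclp_rtrancl_eq)
  qed
  obtain u where u: "reduced_expression W S u w" "count_list u s > 1" using assms(6) by blast
  have count: "count_list v x = count_list u x" if "reduced_expression W S v w" for v x
    using CFC_count[OF assms(4) that u(1)] by (metis count_mset)
  have word: "\<exists>t. adj s t \<and> 5 \<le> m s t \<and> enat (2 * count_list v s) < m s t \<and>
      count_list v t = count_list v s \<and> alternate_in s t v" if v: "reduced_expression W S v w" for v
    by (rule word_structure) (use con CFC_rotate_good[OF assms(4) v] count[OF v] u(2) in auto)
  have adj5: "adj s t" if "t \<in> S" "5 \<le> m s t" for t
  proof -
    have "(3 :: enat) \<le> 5" by simp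
    then show ?thesis using that assms(5) order_trans unfolding adj_def by blast
  qed
  \<comment> \<open>Two such edges at \<open>s\<close> would be two heavy ends of a zigzag at the
    single vertex \<open>s\<close>.\<close>
  have unique: "t = t'" if t: "t \<in> S" "5 \<le> m s t" "t' \<in> S" "5 \<le> m s t'" for t t'
  proof (rule ccontr)
    assume "t \<noteq> t'"
    have "(4 :: enat) \<le> 5" by simp
    then have "4 \<le> m s t" "4 \<le> m s t'" using t order_trans by blast+
    then show False using no_two_ends[of "[t]" s "[t']"] adj5 t \<open>t \<noteq> t'\<close> by auto
  qed
  obtain t0 where t0: "adj s t0" "5 \<le> m s t0" using word[OF u(1)] by blast
  have t0S: "t0 \<in> S" using t0 by (simp add: adj_def)
  have "enat (2 * count_list u s) < m s t \<and> (\<forall>v. reduced_expression W S v w \<longrightarrow>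
      count_list v s = count_list u s \<and> count_list v t = count_list u s \<and> alternate_in s t v)"
    if t: "t \<in> S" "5 \<le> m s t" for t
  proof -
    have v: "enat (2 * count_list v s) < m s t \<and> count_list v t = count_list v s \<and> alternate_in s t v"
      if v: "reduced_expression W S v w" for v
    proof -
      obtain t' where "adj s t'" "5 \<le> m s t'" "enat (2 * count_list v s) < m s t'"
        "count_list v t' = count_list v s" "alternate_in s t' v" using word[OF v] by blast
      moreover from this have "t' = t" using unique[OF _ _ t] by (simp add: adj_def)
      ultimately show ?thesis by blast
    qed
    then show ?thesis using u(1) count by metis
  qed
  then show ?thesis using t0S t0(2) unique by blast
qed

end
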